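(* Let $K$ be a field, $Q$ a finite quiver with vertex set $I$, $<$ a total ordering on the arrows of the double $\overline{Q}$, $q\in(K^* )^I$, and $\Lambda^q=\Lambda^q(Q,<)$ the multiplicative preprojective algebra. If there is a simple representation $X$ of $\Lambda^q$ of dimension vector $\alpha\in\mathbb{N}^I$, then $\alpha$ is a positive root for $Q$. If in addition $\alpha$ is a real root, then $\operatorname{End}_{\Lambda^q}(X)=K$.
   Context: Arrows $a$ have head $h(a)$ and tail $t(a)$. The path algebra $KQ$ has as basis the paths $a_1\cdots a_n$ with $t(a_i)=h(a_{i+1})$ together with trivial paths $e_v$ ($v\in I$). The double $\overline{Q}$ is obtained from $Q$ by adjoining a reverse arrow $a^*$ for each arrow $a\in Q$; $(a^* )^*=a$; $\epsilon(a)=1$ if $a\in Q$ and $\epsilon(a)=-1$ if $a^*\in Q$. With $a_1<a_2<\dots<a_n$ the arrows of $\overline{Q}$, $\Lambda^q$ is the target of the universal $K$-algebra homomorphism $K\overline{Q}\to R$ such that $1+aa^*$ is invertible in $R$ for all $a\in\overline{Q}$ and $(1+a_1a_1^* )^{\epsilon(a_1)}\cdots(1+a_na_n^* )^{\epsilon(a_n)}=\sum_{v\in I}q_ve_v$ in $R$. Representations of $\Lambda^q$ are left $\Lambda^q$-modules; the dimension vector of a finite-dimensional representation $X$ has $v$-component $\dim_Ke_vX$. Roots of $Q$: put $(\alpha,\beta)=2\sum_{v\in I}\alpha_v\beta_v-\sum_{a\in Q}(\alpha_{h(a)}\beta_{t(a)}+\alpha_{t(a)}\beta_{h(a)})$ on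 $\mathbb{Z}^I$. A vertex $v$ is loopfree if no arrow has head and tail both equal to $v$. Let $\epsilon_v$ be the coordinate vectors. For loopfree $v$ put $s_v(\alpha)=\alpha-(\alpha,\epsilon_v)\epsilon_v$; the Weyl group $W\subseteq\mathrm{Aut}(\mathbb{Z}^I)$ is generated by the $s_v$. Real roots are the images under elements of $W$ of the $\epsilon_v$ with $v$ loopfree. The fundamental region is the set of nonzero $\alpha\in\mathbb{N}^I$ with connected support and $(\alpha,\epsilon_v)\le0$ for all $v$; imaginary roots are the elements of its closure under $W$ and change of sign. A root is a real or imaginary root; it is positive if it lies in $\mathbb{N}^I$. *)

theory Defs
  imports
    "HOL-Algebra.QuotRing"
    "HOL-Algebra.Module"
    "HOL-Algebra.Bij"
    "HOL-Algebra.Generated_Groups"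
    "Graph_Theory.Digraph_Component"
begin

section \<open>Algebras over a field, and modules over a non-commutative ring\<close>

text \<open>The locales \<open>module\<close> and \<open>algebra\<close> of HOL-Algebra require commutative rings, so the
  non-commutative versions are stated here. Only the record type is reused.\<close>

locale k_algebra = ring A for A :: "('k::field, 'a, 'm) module_scheme" (structure) +
  assumes smult_closed: "x \<in> carrier A \<Longrightarrow> c \<odot> x \<in> carrier A"
    and smult_l_distr: "x \<in> carrier A \<Longrightarrow> (c + d) \<odot> x = c \<odot> x \<oplus> d \<odot> x"
    and smult_r_distr: "x \<in> carrier A \<Longrightarrow> y \<in> carrier A \<Longrightarrow> c \<odot> (x \<oplus> y) = c \<odot> x \<oplus> c \<odot> y"
    and smult_assoc: "x \<in> carrier A \<Longrightarrow> (c * d) \<odot> x = c \<odot> (d \<odot> x)"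
    and smult_one: "x \<in> carrier A \<Longrightarrow> 1 \<odot> x = x"
    and smult_mult_l: "x \<in> carrier A \<Longrightarrow> y \<in> carrier A \<Longrightarrow> (c \<odot> x) \<otimes> y = c \<odot> (x \<otimes> y)"
    and smult_mult_r: "x \<in> carrier A \<Longrightarrow> y \<in> carrier A \<Longrightarrow> x \<otimes> (c \<odot> y) = c \<odot> (x \<otimes> y)"

definition alg_hom ::
  "('k::field, 'a, 'm) module_scheme \<Rightarrow> ('k, 'b, 'n) module_scheme \<Rightarrow> ('a \<Rightarrow> 'b) set" where
  "alg_hom A B =
     {f \<in> ring_hom A B. \<forall>c. \<forall>x \<in> carrier A. f (c \<odot>\<^bsub>A\<^esub> x) = c \<odot>\<^bsub>B\<^esub> f x}"

definition quotient_algebra ::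
  "('k::field, 'a, 'm) module_scheme \<Rightarrow> 'a set \<Rightarrow> ('k, 'a set) module" where
  "quotient_algebra A I =
     ring.extend (A Quot I)
       (module.fields (\<lambda>c X. (I +>\<^bsub>A\<^esub> (c \<odot>\<^bsub>A\<^esub> \<one>\<^bsub>A\<^esub>)) \<otimes>\<^bsub>A Quot I\<^esub> X))"

text \<open>The module is the whole type \<open>'x\<close>; \<open>act r\<close> is only constrained for ring elements \<open>r\<close>.\<close>

locale left_module = ring L for L (structure) +
  fixes act :: "'l \<Rightarrow> 'x::ab_group_add \<Rightarrow> 'x"
  assumes act_add_right: "r \<in> carrier L \<Longrightarrow> act r (x + y) = act r x + act r y"
    and act_add_left: "r \<in> carrier L \<Longrightarrow> s \<in> carrier L \<Longrightarrow> act (r \<oplus> s) x = act r x + act s x"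
    and act_mult: "r \<in> carrier L \<Longrightarrow> s \<in> carrier L \<Longrightarrow> act (r \<otimes> s) x = act r (act s x)"
    and act_one: "act \<one> x = x"

definition left_submodule ::
  "('l, 'm) ring_scheme \<Rightarrow> ('l \<Rightarrow> 'x::ab_group_add \<Rightarrow> 'x) \<Rightarrow> 'x set \<Rightarrow> bool" where
  "left_submodule L act U \<longleftrightarrow>
     0 \<in> U \<and> (\<forall>x\<in>U. \<forall>y\<in>U. x + y \<in> U) \<and> (\<forall>r\<in>carrier L. \<forall>x\<in>U. act r x \<in> U)"

definition simple_module ::
  "('l, 'm) ring_scheme \<Rightarrow> ('l \<Rightarrow> 'x::ab_group_add \<Rightarrow> 'x) \<Rightarrow> bool" where
  "simple_module L act \<longleftrightarrow>
     (UNIV :: 'x set) \<noteq> {0} \<and> (\<forall>U. left_submodule L act U \<longrightarrow> U = {0} \<or> U = UNIV)"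

definition endomorphisms ::
  "('l, 'm) ring_scheme \<Rightarrow> ('l \<Rightarrow> 'x::ab_group_add \<Rightarrow> 'x) \<Rightarrow> ('x \<Rightarrow> 'x) set" where
  "endomorphisms L act =
     {f. (\<forall>x y. f (x + y) = f x + f y) \<and> (\<forall>r\<in>carrier L. \<forall>x. f (act r x) = act r (f x))}"

definition scalar_act ::
  "('k::field, 'l, 'm) module_scheme \<Rightarrow> ('l \<Rightarrow> 'x::ab_group_add \<Rightarrow> 'x) \<Rightarrow> 'k \<Rightarrow> 'x \<Rightarrow> 'x" where
  "scalar_act L act c = act (c \<odot>\<^bsub>L\<^esub> \<one>\<^bsub>L\<^esub>)"

definition finite_dimensional_module ::
  "('k::field, 'l, 'm) module_scheme \<Rightarrow> ('l \<Rightarrow> 'x::ab_group_add \<Rightarrow> 'x) \<Rightarrow> bool" where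
  "finite_dimensional_module L act \<longleftrightarrow>
     (\<exists>B. finite B \<and> Modules.module.span (scalar_act L act) B = UNIV)"


section \<open>Path algebras\<close>

text \<open>A finite quiver is a \<^locale>\<open>fin_digraph\<close>; loops and multiple arrows are allowed.
  The path \<open>a\<^sub>1 \<dots> a\<^sub>n\<close> is represented by the pair of its head and its list of arrows,
  so that \<open>(v, [])\<close> is the trivial path at \<open>v\<close>. Paths compose like functions: the tail of
  each arrow is the head of the next one.\<close>

fun is_path :: "('v, 'b) pre_digraph \<Rightarrow> 'v \<Rightarrow> 'b list \<Rightarrow> bool" where
  "is_path Q v [] \<longleftrightarrow> v \<in> verts Q"
| "is_path Q v (a # as) \<longleftrightarrow> a \<in> arcs Q \<and> head Q a = v \<and> is_path Q (tail Q a) as"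

fun path_tail :: "('v, 'b) pre_digraph \<Rightarrow> 'v \<Rightarrow> 'b list \<Rightarrow> 'v" where
  "path_tail Q v [] = v"
| "path_tail Q v (a # as) = path_tail Q (tail Q a) as"

definition quiver_paths :: "('v, 'b) pre_digraph \<Rightarrow> ('v \<times> 'b list) set" where
  "quiver_paths Q = {(v, as). is_path Q v as}"

definition path_algebra :: "('v, 'b) pre_digraph \<Rightarrow> ('k::field, 'v \<times> 'b list \<Rightarrow> 'k) module" where
  "path_algebra Q =
     \<lparr> carrier = {f. finite {p. f p \<noteq> 0} \<and> {p. f p \<noteq> 0} \<subseteq> quiver_paths Q},
       monoid.mult = (\<lambda>f g (v, as). \<Sum>i\<le>length as.
                 f (v, take i as) * g (path_tail Q v (take i as), drop i as)),
       monoid.one = (\<lambda>(v, as). if v \<in> verts Q \<and> as = [] then 1 else 0),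
       ring.zero = (\<lambda>_. 0),
       ring.add = (\<lambda>f g p. f p + g p),
       module.smult = (\<lambda>c f p. c * f p) \<rparr>"

definition path_elt :: "'v \<times> 'b list \<Rightarrow> 'v \<times> 'b list \<Rightarrow> 'k::field" where
  "path_elt p = (\<lambda>p'. if p' = p then 1 else 0)"

definition vertex_elt :: "'v \<Rightarrow> 'v \<times> 'b list \<Rightarrow> 'k::field" where
  "vertex_elt v = path_elt (v, [])"

definition arrow_elt :: "('v, 'b) pre_digraph \<Rightarrow> 'b \<Rightarrow> 'v \<times> 'b list \<Rightarrow> 'k::field" where
  "arrow_elt Q a = path_elt (head Q a, [a])"


section \<open>The multiplicative preprojective algebra\<close>

text \<open>In the double, \<open>Inl a\<close> is the arrow \<open>a\<close> of \<open>Q\<close> and \<open>Inr a\<close> is its reverse.\<close>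

definition double :: "('v, 'b) pre_digraph \<Rightarrow> ('v, 'b + 'b) pre_digraph" where
  "double Q =
     \<lparr> verts = verts Q, arcs = Inl ` arcs Q \<union> Inr ` arcs Q,
       tail = case_sum (tail Q) (head Q), head = case_sum (head Q) (tail Q) \<rparr>"

fun rev_arrow :: "'b + 'b \<Rightarrow> 'b + 'b" where
  "rev_arrow (Inl a) = Inr a"
| "rev_arrow (Inr a) = Inl a"

fun arrow_sign :: "'b + 'b \<Rightarrow> int" where
  "arrow_sign (Inl a) = 1"
| "arrow_sign (Inr a) = -1"

text \<open>The elements of a finite set listed in increasing order.\<close>

definition ordered_list :: "'a rel \<Rightarrow> 'a set \<Rightarrow> 'a list" where
  "ordered_list r S = (THE xs. set xs = S \<and> sorted_wrt (\<lambda>a b. (a, b) \<in> r) xs)"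

definition list_prod :: "('a, 'm) monoid_scheme \<Rightarrow> 'a list \<Rightarrow> 'a" where
  "list_prod R xs = foldr (\<lambda>x y. x \<otimes>\<^bsub>R\<^esub> y) xs \<one>\<^bsub>R\<^esub>"

definition one_plus :: "('v, 'b) pre_digraph \<Rightarrow> 'b + 'b \<Rightarrow> 'v \<times> ('b + 'b) list \<Rightarrow> 'k::field" where
  "one_plus Q a =
     \<one>\<^bsub>path_algebra (double Q)\<^esub> \<oplus>\<^bsub>path_algebra (double Q)\<^esub>
       arrow_elt (double Q) a \<otimes>\<^bsub>path_algebra (double Q)\<^esub> arrow_elt (double Q) (rev_arrow a)"

definition vertex_sum :: "('v, 'b) pre_digraph \<Rightarrow> ('v \<Rightarrow> 'k::field) \<Rightarrow> 'v \<times> ('b + 'b) list \<Rightarrow> 'k" where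
  "vertex_sum Q q =
     (\<Oplus>\<^bsub>path_algebra (double Q)\<^esub> v \<in> verts Q. q v \<odot>\<^bsub>path_algebra (double Q)\<^esub> vertex_elt v)"

text \<open>The condition with respect to which the multiplicative preprojective algebra is universal.\<close>

definition mpa_condition ::
  "('v, 'b) pre_digraph \<Rightarrow> ('b + 'b) rel \<Rightarrow> ('v \<Rightarrow> 'k::field) \<Rightarrow> ('k, 'r, 'm) module_scheme \<Rightarrow>
    (('v \<times> ('b + 'b) list \<Rightarrow> 'k) \<Rightarrow> 'r) \<Rightarrow> bool" where
  "mpa_condition Q ord q R \<psi> \<longleftrightarrow>
     (\<forall>a \<in> arcs (double Q). \<psi> (one_plus Q a) \<in> Units R) \<and>
     list_prod R (map (\<lambda>a. \<psi> (one_plus Q a) [^]\<^bsub>R\<^esub> arrow_sign a) (ordered_list ord (arcs (double Q))))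
       = \<psi> (vertex_sum Q q)"

text \<open>The algebra is constructed by adjoining to the double, for each of its arrows \<open>a\<close>, a loop
  \<open>Inr a\<close> at \<open>head a\<close>. As \<open>1 + a a\<^sup>*\<close> is the sum of the idempotents at the vertices other than
  \<open>head a\<close> and of an element of the corner ring at \<open>head a\<close>, an inverse necessarily has the shape
  \<open>1 - e + l\<close> with \<open>e\<close> the idempotent at \<open>head a\<close> and \<open>l = e l e\<close>; the new loop serves as \<open>l\<close>.
  That the result has the universal property is proved in \<open>mpa_universal\<close> below.\<close>

definition adjoin_loops :: "('v, 'b) pre_digraph \<Rightarrow> ('v, 'b + 'b) pre_digraph" where
  "adjoin_loops G =
     \<lparr> verts = verts G, arcs = Inl ` arcs G \<union> Inr ` arcs G,
       tail = case_sum (tail G) (head G), head = case_sum (head G) (head G) \<rparr>"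

abbreviation loc_algebra ::
  "('v, 'b) pre_digraph \<Rightarrow> ('k::field, 'v \<times> (('b + 'b) + ('b + 'b)) list \<Rightarrow> 'k) module" where
  "loc_algebra Q \<equiv> path_algebra (adjoin_loops (double Q))"

definition path_embed :: "('v \<times> 'b list \<Rightarrow> 'k::field) \<Rightarrow> 'v \<times> ('b + 'c) list \<Rightarrow> 'k" where
  "path_embed f = (\<lambda>(v, bs). if set bs \<subseteq> range Inl then f (v, map projl bs) else 0)"

definition loc_inverse ::
  "('v, 'b) pre_digraph \<Rightarrow> 'b + 'b \<Rightarrow> 'v \<times> (('b + 'b) + ('b + 'b)) list \<Rightarrow> 'k::field" where
  "loc_inverse Q a =
     (\<one>\<^bsub>loc_algebra Q\<^esub> \<ominus>\<^bsub>loc_algebra Q\<^esub> vertex_elt (head (double Q) a))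
       \<oplus>\<^bsub>loc_algebra Q\<^esub> arrow_elt (adjoin_loops (double Q)) (Inr a)"

definition mpa_relations ::
  "('v, 'b) pre_digraph \<Rightarrow> ('b + 'b) rel \<Rightarrow> ('v \<Rightarrow> 'k::field) \<Rightarrow>
    ('v \<times> (('b + 'b) + ('b + 'b)) list \<Rightarrow> 'k) set" where
  "mpa_relations Q ord q =
     (\<Union>a \<in> arcs (double Q).
        {path_embed (one_plus Q a) \<otimes>\<^bsub>loc_algebra Q\<^esub> loc_inverse Q a \<ominus>\<^bsub>loc_algebra Q\<^esub> \<one>\<^bsub>loc_algebra Q\<^esub>,
         loc_inverse Q a \<otimes>\<^bsub>loc_algebra Q\<^esub> path_embed (one_plus Q a) \<ominus>\<^bsub>loc_algebra Q\<^esub> \<one>\<^bsub>loc_algebra Q\<^esub>}) \<union>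
     {list_prod (loc_algebra Q)
        (map (\<lambda>a. if arrow_sign a = 1 then path_embed (one_plus Q a) else loc_inverse Q a)
          (ordered_list ord (arcs (double Q))))
      \<ominus>\<^bsub>loc_algebra Q\<^esub> path_embed (vertex_sum Q q)}"

definition mpa_ideal ::
  "('v, 'b) pre_digraph \<Rightarrow> ('b + 'b) rel \<Rightarrow> ('v \<Rightarrow> 'k::field) \<Rightarrow>
    ('v \<times> (('b + 'b) + ('b + 'b)) list \<Rightarrow> 'k) set" where
  "mpa_ideal Q ord q = Idl\<^bsub>loc_algebra Q\<^esub> (mpa_relations Q ord q)"

definition mpa ::
  "('v, 'b) pre_digraph \<Rightarrow> ('b + 'b) rel \<Rightarrow> ('v \<Rightarrow> 'k::field) \<Rightarrow>
    ('k, ('v \<times> (('b + 'b) + ('b + 'b)) list \<Rightarrow> 'k) set) module" where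
  "mpa Q ord q = quotient_algebra (loc_algebra Q) (mpa_ideal Q ord q)"

definition mpa_hom ::
  "('v, 'b) pre_digraph \<Rightarrow> ('b + 'b) rel \<Rightarrow> ('v \<Rightarrow> 'k::field) \<Rightarrow>
    ('v \<times> ('b + 'b) list \<Rightarrow> 'k) \<Rightarrow> ('v \<times> (('b + 'b) + ('b + 'b)) list \<Rightarrow> 'k) set" where
  "mpa_hom Q ord q f = mpa_ideal Q ord q +>\<^bsub>loc_algebra Q\<^esub> path_embed f"

definition dimension_vector ::
  "('v, 'b) pre_digraph \<Rightarrow> ('b + 'b) rel \<Rightarrow> ('v \<Rightarrow> 'k::field) \<Rightarrow>
    (('v \<times> (('b + 'b) + ('b + 'b)) list \<Rightarrow> 'k) set \<Rightarrow> 'x::ab_group_add \<Rightarrow> 'x) \<Rightarrow> 'v \<Rightarrow> nat" where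
  "dimension_vector Q ord q act v =
     (if v \<in> verts Q
      then vector_space.dim (scalar_act (mpa Q ord q) act) (range (act (mpa_hom Q ord q (vertex_elt v))))
      else 0)"


section \<open>Roots of a quiver\<close>

text \<open>Vectors indexed by the vertex set are functions vanishing outside it.\<close>

definition root_lattice :: "('v, 'b) pre_digraph \<Rightarrow> ('v \<Rightarrow> int) set" where
  "root_lattice Q = {\<alpha>. \<forall>v. v \<notin> verts Q \<longrightarrow> \<alpha> v = 0}"

definition coord_vec :: "'v \<Rightarrow> 'v \<Rightarrow> int" where
  "coord_vec v = (\<lambda>w. if w = v then 1 else 0)"

definition sym_form :: "('v, 'b) pre_digraph \<Rightarrow> ('v \<Rightarrow> int) \<Rightarrow> ('v \<Rightarrow> int) \<Rightarrow> int" where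
  "sym_form Q \<alpha> \<beta> = 2 * (\<Sum>v\<in>verts Q. \<alpha> v * \<beta> v)
     - (\<Sum>a\<in>arcs Q. \<alpha> (head Q a) * \<beta> (tail Q a) + \<alpha> (tail Q a) * \<beta> (head Q a))"

definition loopfree_vertex :: "('v, 'b) pre_digraph \<Rightarrow> 'v \<Rightarrow> bool" where
  "loopfree_vertex Q v \<longleftrightarrow> v \<in> verts Q \<and> \<not> (\<exists>a\<in>arcs Q. head Q a = v \<and> tail Q a = v)"

definition reflection :: "('v, 'b) pre_digraph \<Rightarrow> 'v \<Rightarrow> ('v \<Rightarrow> int) \<Rightarrow> ('v \<Rightarrow> int)" where
  "reflection Q v = (\<lambda>\<alpha>\<in>root_lattice Q. \<lambda>w. \<alpha> w - sym_form Q \<alpha> (coord_vec v) * coord_vec v w)"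

definition weyl_group :: "('v, 'b) pre_digraph \<Rightarrow> (('v \<Rightarrow> int) \<Rightarrow> ('v \<Rightarrow> int)) set" where
  "weyl_group Q = generate (BijGroup (root_lattice Q)) (reflection Q ` {v. loopfree_vertex Q v})"

definition real_root :: "('v, 'b) pre_digraph \<Rightarrow> ('v \<Rightarrow> int) \<Rightarrow> bool" where
  "real_root Q \<alpha> \<longleftrightarrow> (\<exists>w\<in>weyl_group Q. \<exists>v. loopfree_vertex Q v \<and> \<alpha> = w (coord_vec v))"

definition fundamental_region :: "('v, 'b) pre_digraph \<Rightarrow> ('v \<Rightarrow> int) set" where
  "fundamental_region Q =
     {\<alpha> \<in> root_lattice Q. (\<forall>v. 0 \<le> \<alpha> v) \<and> \<alpha> \<noteq> (\<lambda>_. 0) \<and>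
        connected (induce_subgraph Q {v \<in> verts Q. \<alpha> v \<noteq> 0}) \<and>
        (\<forall>v\<in>verts Q. sym_form Q \<alpha> (coord_vec v) \<le> 0)}"

inductive imaginary_root :: "('v, 'b) pre_digraph \<Rightarrow> ('v \<Rightarrow> int) \<Rightarrow> bool" for Q where
  fundamental: "\<alpha> \<in> fundamental_region Q \<Longrightarrow> imaginary_root Q \<alpha>"
| weyl: "imaginary_root Q \<alpha> \<Longrightarrow> w \<in> weyl_group Q \<Longrightarrow> imaginary_root Q (w \<alpha>)"
| uminus: "imaginary_root Q \<alpha> \<Longrightarrow> imaginary_root Q (\<lambda>v. - \<alpha> v)"

definition positive_root :: "('v, 'b) pre_digraph \<Rightarrow> ('v \<Rightarrow> int) \<Rightarrow> bool" where
  "positive_root Q \<alpha> \<longleftrightarrow> (real_root Q \<alpha> \<or> imaginary_root Q \<alpha>) \<and> (\<forall>v. 0 \<le> \<alpha> v)"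


section \<open>The universal property of the multiplicative preprojective algebra\<close>

subsection \<open>Path algebras are algebras\<close>

lemma path_algebra_simps [simp]:
  "f \<in> carrier (path_algebra Q) \<longleftrightarrow> finite {p. f p \<noteq> 0} \<and> {p. f p \<noteq> 0} \<subseteq> quiver_paths Q"
  "(f \<otimes>\<^bsub>path_algebra Q\<^esub> g) (v, as) =
     (\<Sum>i\<le>length as. f (v, take i as) * g (path_tail Q v (take i as), drop i as))"
  "\<one>\<^bsub>path_algebra Q\<^esub> (v, as) = (if v \<in> verts Q \<and> as = [] then 1 else 0)"
  "\<zero>\<^bsub>path_algebra Q\<^esub> p = 0"
  "(f \<oplus>\<^bsub>path_algebra Q\<^esub> g) p = f p + g p"
  "(c \<odot>\<^bsub>path_algebra Q\<^esub> f) p = c * f p"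
  by (simp_all add: path_algebra_def)

lemma path_tail_append: "path_tail Q v (as @ bs) = path_tail Q (path_tail Q v as) bs"
  by (induction as arbitrary: v) auto

lemma is_path_append:
  "is_path Q v as \<Longrightarrow> is_path Q (path_tail Q v as) bs \<Longrightarrow> is_path Q v (as @ bs)"
  by (induction as arbitrary: v) auto

lemma (in wf_digraph) is_path_verts: "is_path G v as \<Longrightarrow> v \<in> verts G"
  by (cases as) auto

lemma (in wf_digraph) is_path_tail_verts: "is_path G v as \<Longrightarrow> path_tail G v as \<in> verts G"
  by (induction as arbitrary: v) auto

lemma path_mult_assoc:
  fixes f g h :: "'v \<times> 'b list \<Rightarrow> 'k::field"
  shows "(f \<otimes>\<^bsub>path_algebra Q\<^esub> g) \<otimes>\<^bsub>path_algebra Q\<^esub> h = f \<otimes>\<^bsub>path_algebra Q\<^esub> (g \<otimes>\<^bsub>path_algebra Q\<^esub> h)"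
proof (rule ext, clarify)
  fix v :: 'v and as :: "'b list"
  let ?t = "path_tail Q"
  define n where "n = length as"
  define F where "F i j = f (v, take i as) * g (?t v (take i as), take j (drop i as)) *
    h (?t v (take (i + j) as), drop (i + j) as)" for i j
  have "((f \<otimes>\<^bsub>path_algebra Q\<^esub> g) \<otimes>\<^bsub>path_algebra Q\<^esub> h) (v, as) = (\<Sum>j\<le>n. \<Sum>i\<le>j. F i (j - i))"
    unfolding path_algebra_simps n_def[symmetric] sum_distrib_right
  proof (intro sum.cong)
    fix j i assume "j \<in> {..n}" "i \<in> {..j}"
    then have "i \<le> j" "min i j = i" by auto
    then show "f (v, take i (take j as)) * g (?t v (take i (take j as)), drop i (take j as)) * h (?t v (take j as), drop j as)
      = F i (j - i)"
      by (simp add: F_def drop_take)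
  qed (auto simp: n_def)
  also have "\<dots> = (\<Sum>(i, j) \<in> {(i, j). i + j \<le> n}. F i j)"
    by (rule sum.triangle_reindex_eq[symmetric])
  also have "{(i, j). i + j \<le> n} = (SIGMA i:{..n}. {..n - i})"
    by auto
  also have "(\<Sum>(i, j) \<in> \<dots>. F i j) = (\<Sum>i\<le>n. \<Sum>j\<le>n - i. F i j)"
    by (subst sum.Sigma) auto
  also have "\<dots> = (f \<otimes>\<^bsub>path_algebra Q\<^esub> (g \<otimes>\<^bsub>path_algebra Q\<^esub> h)) (v, as)"
    unfolding path_algebra_simps n_def[symmetric] sum_distrib_left
    by (intro sum.cong) (auto simp: n_def F_def path_tail_append take_add mult.assoc add.commute)
  finally show "((f \<otimes>\<^bsub>path_algebra Q\<^esub> g) \<otimes>\<^bsub>path_algebra Q\<^esub> h) (v, as) = (f \<otimes>\<^bsub>path_algebra Q\<^esub> (g \<otimes>\<^bsub>path_algebra Q\<^esub> h)) (v, as)" .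
qed

lemma path_mult_closed:
  fixes f g :: "'v \<times> 'b list \<Rightarrow> 'k::field"
  assumes f: "f \<in> carrier (path_algebra Q)" and g: "g \<in> carrier (path_algebra Q)"
  shows "f \<otimes>\<^bsub>path_algebra Q\<^esub> g \<in> carrier (path_algebra Q)"
proof -
  let ?c = "\<lambda>((v, as), (w, bs)). (v, as @ bs)"
  let ?fg = "f \<otimes>\<^bsub>path_algebra Q\<^esub> g"
  have *: "(v, as) \<in> ?c ` ({p. f p \<noteq> 0} \<times> {p. g p \<noteq> 0}) \<and> (v, as) \<in> quiver_paths Q"
    if "?fg (v, as) \<noteq> 0" for v as
  proof -
    from that obtain i where i: "f (v, take i as) \<noteq> 0" "g (path_tail Q v (take i as), drop i as) \<noteq> 0"
      by (auto elim!: sum.not_neutral_contains_not_neutral)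
    then have "is_path Q v (take i as)" "is_path Q (path_tail Q v (take i as)) (drop i as)"
      using f g by (auto simp: quiver_paths_def)
    from is_path_append[OF this] have "is_path Q v as" by simp
    moreover have "(v, as) = ?c ((v, take i as), (path_tail Q v (take i as), drop i as))"
      by simp
    ultimately show ?thesis using i unfolding quiver_paths_def by blast
  qed
  have "{p. ?fg p \<noteq> 0} \<subseteq> ?c ` ({p. f p \<noteq> 0} \<times> {p. g p \<noteq> 0})" "{p. ?fg p \<noteq> 0} \<subseteq> quiver_paths Q"
    using * by force+
  moreover have "finite (?c ` ({p. f p \<noteq> 0} \<times> {p. g p \<noteq> 0}))"
    using f g by (intro finite_imageI finite_cartesian_product) auto
  ultimately show ?thesis
    unfolding path_algebra_simps by (meson finite_subset)
qed

lemma path_add_closed: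
  assumes f: "f \<in> carrier (path_algebra Q)" and g: "g \<in> carrier (path_algebra Q)"
  shows "f \<oplus>\<^bsub>path_algebra Q\<^esub> g \<in> carrier (path_algebra Q)"
proof -
  have "{p. (f \<oplus>\<^bsub>path_algebra Q\<^esub> g) p \<noteq> 0} \<subseteq> {p. f p \<noteq> 0} \<union> {p. g p \<noteq> 0}" by auto
  then show ?thesis using f g unfolding path_algebra_simps(1)
    by (meson finite_UnI finite_subset le_supI order_trans)
qed

lemma path_smult_closed:
  assumes f: "f \<in> carrier (path_algebra Q)"
  shows "c \<odot>\<^bsub>path_algebra Q\<^esub> f \<in> carrier (path_algebra Q)"
proof -
  have "{p. (c \<odot>\<^bsub>path_algebra Q\<^esub> f) p \<noteq> 0} \<subseteq> {p. f p \<noteq> 0}" by auto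
  then show ?thesis using f unfolding path_algebra_simps(1)
    by (meson finite_subset order_trans)
qed

lemma path_algebra_one_closed:
  assumes "fin_digraph Q"
  shows "(\<one>\<^bsub>path_algebra Q\<^esub> :: _ \<Rightarrow> 'k::field) \<in> carrier (path_algebra Q)" (is "?one \<in> _")
proof -
  interpret fin_digraph Q by fact
  have "{p. ?one p \<noteq> 0} \<subseteq> (\<lambda>v. (v, [])) ` verts Q"
    by (auto split: if_splits)
  then have "finite {p. ?one p \<noteq> 0}"
    by (rule finite_subset) simp
  moreover have "{p. ?one p \<noteq> 0} \<subseteq> quiver_paths Q"
    by (auto simp: quiver_paths_def split: if_splits)
  ultimately show ?thesis by simp
qed

lemma path_algebra_zero_closed: "\<zero>\<^bsub>path_algebra Q\<^esub> \<in> carrier (path_algebra Q)"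
  by simp

lemma path_mult_one_left:
  assumes "fin_digraph Q" and f: "f \<in> carrier (path_algebra Q)"
  shows "\<one>\<^bsub>path_algebra Q\<^esub> \<otimes>\<^bsub>path_algebra Q\<^esub> f = f"
proof (rule ext, clarify)
  interpret fin_digraph Q by fact
  fix v as
  have "(\<one>\<^bsub>path_algebra Q\<^esub> \<otimes>\<^bsub>path_algebra Q\<^esub> f) (v, as) =
      (\<Sum>i\<le>length as. if i = 0 then (if v \<in> verts Q then f (v, as) else 0) else 0)"
    unfolding path_algebra_simps by (intro sum.cong) auto
  also have "\<dots> = f (v, as)"
    using f is_path_verts[of v as] by (auto simp: quiver_paths_def)
  finally show "(\<one>\<^bsub>path_algebra Q\<^esub> \<otimes>\<^bsub>path_algebra Q\<^esub> f) (v, as) = f (v, as)" .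
qed

lemma path_mult_one_right:
  assumes "fin_digraph Q" and f: "f \<in> carrier (path_algebra Q)"
  shows "f \<otimes>\<^bsub>path_algebra Q\<^esub> \<one>\<^bsub>path_algebra Q\<^esub> = f"
proof (rule ext, clarify)
  interpret fin_digraph Q by fact
  fix v as
  have "(f \<otimes>\<^bsub>path_algebra Q\<^esub> \<one>\<^bsub>path_algebra Q\<^esub>) (v, as) =
      (\<Sum>i\<le>length as. if i = length as then (if path_tail Q v as \<in> verts Q then f (v, as) else 0) else 0)"
    unfolding path_algebra_simps by (intro sum.cong) auto
  also have "\<dots> = f (v, as)"
    using f is_path_tail_verts[of v as] by (auto simp: quiver_paths_def)
  finally show "(f \<otimes>\<^bsub>path_algebra Q\<^esub> \<one>\<^bsub>path_algebra Q\<^esub>) (v, as) = f (v, as)" .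
qed

lemma path_algebra_bilinear:
  fixes f g h :: "'v \<times> 'b list \<Rightarrow> 'k::field"
  shows "(f \<oplus>\<^bsub>path_algebra Q\<^esub> g) \<otimes>\<^bsub>path_algebra Q\<^esub> h =
      f \<otimes>\<^bsub>path_algebra Q\<^esub> h \<oplus>\<^bsub>path_algebra Q\<^esub> g \<otimes>\<^bsub>path_algebra Q\<^esub> h"
    and "h \<otimes>\<^bsub>path_algebra Q\<^esub> (f \<oplus>\<^bsub>path_algebra Q\<^esub> g) =
      h \<otimes>\<^bsub>path_algebra Q\<^esub> f \<oplus>\<^bsub>path_algebra Q\<^esub> h \<otimes>\<^bsub>path_algebra Q\<^esub> g"
    and "(c \<odot>\<^bsub>path_algebra Q\<^esub> f) \<otimes>\<^bsub>path_algebra Q\<^esub> g = c \<odot>\<^bsub>path_algebra Q\<^esub> (f \<otimes>\<^bsub>path_algebra Q\<^esub> g)"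
    and "f \<otimes>\<^bsub>path_algebra Q\<^esub> (c \<odot>\<^bsub>path_algebra Q\<^esub> g) = c \<odot>\<^bsub>path_algebra Q\<^esub> (f \<otimes>\<^bsub>path_algebra Q\<^esub> g)"
  by (rule ext, clarify,
    simp add: sum.distrib distrib_left distrib_right sum_distrib_left mult.left_commute mult.assoc)+

lemma k_algebra_path_algebra:
  fixes Q :: "('v, 'b) pre_digraph"
  assumes Q: "fin_digraph Q"
  shows "k_algebra (path_algebra Q :: ('k::field, 'v \<times> 'b list \<Rightarrow> 'k) module)" (is "k_algebra ?A")
proof -
  have "abelian_group ?A"
  proof (rule abelian_groupI)
    fix x assume x: "x \<in> carrier ?A"
    have "(- 1) \<odot>\<^bsub>?A\<^esub> x \<oplus>\<^bsub>?A\<^esub> x = \<zero>\<^bsub>?A\<^esub>"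
      by (rule ext) simp
    then show "\<exists>y\<in>carrier ?A. y \<oplus>\<^bsub>?A\<^esub> x = \<zero>\<^bsub>?A\<^esub>"
      using path_smult_closed[OF x] by blast
  next
    show "x \<oplus>\<^bsub>?A\<^esub> y \<oplus>\<^bsub>?A\<^esub> z = x \<oplus>\<^bsub>?A\<^esub> (y \<oplus>\<^bsub>?A\<^esub> z)" for x y z
      by (rule ext) simp
    show "x \<oplus>\<^bsub>?A\<^esub> y = y \<oplus>\<^bsub>?A\<^esub> x" for x y
      by (rule ext) simp
    show "\<zero>\<^bsub>?A\<^esub> \<oplus>\<^bsub>?A\<^esub> x = x" for x
      by (rule ext) simp
  qed (assumption | rule path_add_closed path_algebra_zero_closed)+
  moreover have "Group.monoid ?A"
    by (rule monoidI)
      (assumption | rule path_mult_closed path_algebra_one_closed[OF Q] path_mult_assoc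
        path_mult_one_left[OF Q] path_mult_one_right[OF Q])+
  ultimately have "ring ?A"
    by (rule ringI) (assumption | rule path_algebra_bilinear)+
  then show ?thesis
  proof (intro k_algebra.intro k_algebra_axioms.intro)
    show "(c + d) \<odot>\<^bsub>?A\<^esub> x = c \<odot>\<^bsub>?A\<^esub> x \<oplus>\<^bsub>?A\<^esub> d \<odot>\<^bsub>?A\<^esub> x" for c d x
      by (rule ext) (simp add: distrib_right)
    show "c \<odot>\<^bsub>?A\<^esub> (x \<oplus>\<^bsub>?A\<^esub> y) = c \<odot>\<^bsub>?A\<^esub> x \<oplus>\<^bsub>?A\<^esub> c \<odot>\<^bsub>?A\<^esub> y" for c x y
      by (rule ext) (simp add: distrib_left)
    show "(c * d) \<odot>\<^bsub>?A\<^esub> x = c \<odot>\<^bsub>?A\<^esub> (d \<odot>\<^bsub>?A\<^esub> x)" for c d x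
      by (rule ext) (simp add: mult.assoc)
    show "1 \<odot>\<^bsub>?A\<^esub> x = x" for x
      by (rule ext) simp
  qed (assumption | rule path_smult_closed path_algebra_bilinear)+
qed

lemma path_elt_closed: "p \<in> quiver_paths Q \<Longrightarrow> path_elt p \<in> carrier (path_algebra Q)"
  by (simp add: path_elt_def)

lemma path_elt_mult:
  "path_elt (v, as) \<otimes>\<^bsub>path_algebra Q\<^esub> path_elt (w, bs) =
     (if path_tail Q v as = w then path_elt (v, as @ bs) else (\<zero>\<^bsub>path_algebra Q\<^esub> :: _ \<Rightarrow> 'k::field))"
proof (rule ext, clarify)
  fix x cs
  let ?l = "(path_elt (v, as) \<otimes>\<^bsub>path_algebra Q\<^esub> path_elt (w, bs) :: _ \<Rightarrow> 'k) (x, cs)"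
  have "?l = (\<Sum>i\<le>length cs. if i = length as then
      (if x = v \<and> cs = as @ bs \<and> path_tail Q v as = w then 1 else 0) else 0)"
    unfolding path_algebra_simps
  proof (intro sum.cong refl)
    fix i assume "i \<in> {..length cs}"
    then have "take i cs = as \<and> drop i cs = bs \<longleftrightarrow> i = length as \<and> cs = as @ bs"
      by (metis append_eq_conv_conj append_take_drop_id atMost_iff length_take min.absorb2)
    moreover have "path_elt (v, as) (x, take i cs) * path_elt (w, bs) (path_tail Q x (take i cs), drop i cs) =
      (if (take i cs = as \<and> drop i cs = bs) \<and> x = v \<and> path_tail Q v as = w then 1 else (0::'k))"
      unfolding path_elt_def by auto
    ultimately show "path_elt (v, as) (x, take i cs) * path_elt (w, bs) (path_tail Q x (take i cs), drop i cs) =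
      (if i = length as then if x = v \<and> cs = as @ bs \<and> path_tail Q v as = w then 1 else 0 else (0::'k))"
      by (simp only: ) (simp only: conj_ac split: if_split, blast)
  qed
  also have "\<dots> = (if path_tail Q v as = w then path_elt (v, as @ bs) else \<zero>\<^bsub>path_algebra Q\<^esub>) (x, cs)"
    by (auto simp: path_elt_def)
  finally show "?l = (if path_tail Q v as = w then path_elt (v, as @ bs) else \<zero>\<^bsub>path_algebra Q\<^esub>) (x, cs)" .
qed

lemma path_algebra_induct [consumes 1, case_names zero add elt]:
  fixes f :: "'v \<times> 'b list \<Rightarrow> 'k::field"
  assumes f: "f \<in> carrier (path_algebra Q)"
    and zero: "P \<zero>\<^bsub>path_algebra Q\<^esub>"
    and add: "\<And>f g. f \<in> carrier (path_algebra Q) \<Longrightarrow> g \<in> carrier (path_algebra Q) \<Longrightarrow> P f \<Longrightarrow> P g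
      \<Longrightarrow> P (f \<oplus>\<^bsub>path_algebra Q\<^esub> g)"
    and elt: "\<And>c p. p \<in> quiver_paths Q \<Longrightarrow> P (c \<odot>\<^bsub>path_algebra Q\<^esub> path_elt p)"
  shows "P f"
proof -
  have "finite S \<Longrightarrow> S \<subseteq> quiver_paths Q \<Longrightarrow> {p. f p \<noteq> 0} \<subseteq> S \<Longrightarrow> P f" for S f
  proof (induction S arbitrary: f rule: finite_induct)
    case empty
    then have "f = \<zero>\<^bsub>path_algebra Q\<^esub>" by (intro ext) auto
    then show ?case using zero by (simp only:)
  next
    case (insert s S)
    let ?g = "f(s := 0)" and ?h = "f s \<odot>\<^bsub>path_algebra Q\<^esub> path_elt s"
    have "{p. ?g p \<noteq> 0} \<subseteq> S" using insert.prems by auto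
    then have g: "P ?g" "?g \<in> carrier (path_algebra Q)"
      using insert finite_subset[of _ S] by (auto simp del: fun_upd_apply)
    have h: "P ?h" "?h \<in> carrier (path_algebra Q)"
      using insert.prems elt path_smult_closed[OF path_elt_closed] by blast+
    have "f = ?g \<oplus>\<^bsub>path_algebra Q\<^esub> ?h"
      by (rule ext) (auto simp: path_elt_def)
    then show ?case using add[OF g(2) h(2) g(1) h(1)] by simp
  qed
  from this[of "{p. f p \<noteq> 0}" f] f show ?thesis by simp
qed

subsection \<open>Evaluation\<close>

locale path_eval = k_algebra R + fin_digraph Q
  for R :: "('k::field, 'r, 'm) module_scheme" (structure) and Q :: "('v, 'b) pre_digraph" +
  fixes E :: "'v \<Rightarrow> 'r" and F :: "'b \<Rightarrow> 'r"
  assumes E_closed: "v \<in> verts Q \<Longrightarrow> E v \<in> carrier R"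
    and F_closed: "a \<in> arcs Q \<Longrightarrow> F a \<in> carrier R"
    and E_mult: "v \<in> verts Q \<Longrightarrow> w \<in> verts Q \<Longrightarrow> E v \<otimes> E w = (if v = w then E v else \<zero>)"
    and E_sum: "finsum R E (verts Q) = \<one>"
    and F_head: "a \<in> arcs Q \<Longrightarrow> E (head Q a) \<otimes> F a = F a"
    and F_tail: "a \<in> arcs Q \<Longrightarrow> F a \<otimes> E (tail Q a) = F a"
begin

fun ev :: "'v \<Rightarrow> 'b list \<Rightarrow> 'r" where
  "ev v [] = E v"
| "ev v (a # as) = F a \<otimes> ev (tail Q a) as"

definition theta :: "('v \<times> 'b list \<Rightarrow> 'k) \<Rightarrow> 'r" where
  "theta f = (\<Oplus>p\<in>{p. f p \<noteq> 0}. f p \<odot> ev (fst p) (snd p))"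

lemma ev_closed: "is_path Q v as \<Longrightarrow> ev v as \<in> carrier R"
  by (induction as arbitrary: v) (auto intro: E_closed F_closed)

lemma E_ev: "is_path Q v as \<Longrightarrow> E v \<otimes> ev v as = ev v as"
  by (cases as)
    (auto simp: E_mult m_assoc[symmetric] F_head E_closed F_closed ev_closed)

lemma E_ev_other: "is_path Q v as \<Longrightarrow> w \<in> verts Q \<Longrightarrow> w \<noteq> v \<Longrightarrow> E w \<otimes> ev v as = \<zero>"
  using E_ev[of v as] is_path_verts[of v as]
  by (metis E_closed E_mult ev_closed l_null m_assoc)

lemma ev_append:
  "is_path Q v as \<Longrightarrow> is_path Q (path_tail Q v as) bs \<Longrightarrow>
    ev v (as @ bs) = ev v as \<otimes> ev (path_tail Q v as) bs"
  by (induction as arbitrary: v)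
    (auto simp: E_ev m_assoc F_closed ev_closed)

lemma ev_mult_other:
  "is_path Q v as \<Longrightarrow> is_path Q w bs \<Longrightarrow> path_tail Q v as \<noteq> w \<Longrightarrow> ev v as \<otimes> ev w bs = \<zero>"
  by (induction as arbitrary: v)
    (auto simp: E_ev_other m_assoc F_closed ev_closed)

lemma smult_zero_left: "x \<in> carrier R \<Longrightarrow> 0 \<odot> x = \<zero>"
  using smult_l_distr[of x 0 0] smult_closed[of x 0] by (metis add.r_cancel_one' add_0)

lemma smult_zero_right: "c \<odot> \<zero> = \<zero>"
  using smult_r_distr[of \<zero> \<zero> c] smult_closed[of \<zero> c] by (metis add.r_cancel_one' l_zero zero_closed)

lemma ev_closed': "p \<in> quiver_paths Q \<Longrightarrow> ev (fst p) (snd p) \<in> carrier R"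
  by (auto simp: quiver_paths_def ev_closed)

lemma theta_eq:
  assumes "finite S" "S \<subseteq> quiver_paths Q" "{p. f p \<noteq> 0} \<subseteq> S"
  shows "theta f = (\<Oplus>p\<in>S. f p \<odot> ev (fst p) (snd p))"
  unfolding theta_def
proof (rule add.finprod_mono_neutral_cong_left)
  show "\<And>i. i \<in> S - {p. f p \<noteq> 0} \<Longrightarrow> f i \<odot> ev (fst i) (snd i) = \<zero>"
    using assms ev_closed' by (auto simp: smult_zero_left)
  show "(\<lambda>p. f p \<odot> ev (fst p) (snd p)) \<in> S \<rightarrow> carrier R"
    using assms by (intro Pi_I smult_closed ev_closed') auto
qed (use assms in auto)

lemma theta_closed: "f \<in> carrier (path_algebra Q) \<Longrightarrow> theta f \<in> carrier R"
  unfolding theta_def by (intro finsum_closed Pi_I smult_closed ev_closed') auto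

lemma theta_zero: "theta \<zero>\<^bsub>path_algebra Q\<^esub> = \<zero>"
  by (simp add: theta_def)

lemma theta_add:
  assumes "f \<in> carrier (path_algebra Q)" "g \<in> carrier (path_algebra Q)"
  shows "theta (f \<oplus>\<^bsub>path_algebra Q\<^esub> g) = theta f \<oplus> theta g"
proof -
  let ?S = "{p. f p \<noteq> 0} \<union> {p. g p \<noteq> 0}"
  have S: "finite ?S" "?S \<subseteq> quiver_paths Q" using assms by auto
  have "theta (f \<oplus>\<^bsub>path_algebra Q\<^esub> g) = (\<Oplus>p\<in>?S. f p \<odot> ev (fst p) (snd p) \<oplus> g p \<odot> ev (fst p) (snd p))"
  proof (subst theta_eq[OF S])
    show "(\<Oplus>p\<in>?S. (f \<oplus>\<^bsub>path_algebra Q\<^esub> g) p \<odot> ev (fst p) (snd p)) =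
      (\<Oplus>p\<in>?S. f p \<odot> ev (fst p) (snd p) \<oplus> g p \<odot> ev (fst p) (snd p))"
    proof (rule add.finprod_cong'[OF refl])
      show "(\<lambda>p. f p \<odot> ev (fst p) (snd p) \<oplus> g p \<odot> ev (fst p) (snd p)) \<in> ?S \<rightarrow> carrier R"
        using S by (intro Pi_I add.m_closed smult_closed ev_closed') auto
    qed (use S ev_closed' smult_l_distr in auto)
  qed auto
  also have "\<dots> = (\<Oplus>p\<in>?S. f p \<odot> ev (fst p) (snd p)) \<oplus> (\<Oplus>p\<in>?S. g p \<odot> ev (fst p) (snd p))"
    using S by (intro finsum_addf Pi_I smult_closed ev_closed') auto
  also have "\<dots> = theta f \<oplus> theta g"
    using theta_eq[OF S, of f] theta_eq[OF S, of g] by auto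
  finally show ?thesis .
qed

lemma theta_elt:
  assumes "is_path Q v as"
  shows "theta (c \<odot>\<^bsub>path_algebra Q\<^esub> path_elt (v, as)) = c \<odot> ev v as"
  using assms
  by (subst theta_eq[of "{(v, as)}"])
    (auto simp: quiver_paths_def path_elt_def ev_closed smult_closed split: if_splits)

lemma theta_elt':
  assumes "is_path Q v as"
  shows "theta (path_elt (v, as)) = ev v as"
proof -
  have "(1::'k) \<odot>\<^bsub>path_algebra Q\<^esub> path_elt (v, as) = path_elt (v, as)" by (rule ext) simp
  then show ?thesis using theta_elt[OF assms, of 1] assms by (simp add: smult_one ev_closed)
qed

lemma theta_smult:
  assumes "f \<in> carrier (path_algebra Q)"
  shows "theta (c \<odot>\<^bsub>path_algebra Q\<^esub> f) = c \<odot> theta f"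
  using assms
proof (induction rule: path_algebra_induct)
  interpret A: k_algebra "path_algebra Q" by (rule k_algebra_path_algebra) unfold_locales
  { case zero
    have "c \<odot>\<^bsub>path_algebra Q\<^esub> \<zero>\<^bsub>path_algebra Q\<^esub> = \<zero>\<^bsub>path_algebra Q\<^esub>" by (rule ext) simp
    then show ?case by (simp only: theta_zero smult_zero_right)
  next
    case (add f g)
    then show ?case
      by (simp add: A.smult_r_distr A.smult_closed theta_add smult_r_distr theta_closed del: path_algebra_simps)
  next
    case (elt d p)
    obtain v as where p: "p = (v, as)" "is_path Q v as" using elt by (auto simp: quiver_paths_def)
    have "c \<odot>\<^bsub>path_algebra Q\<^esub> (d \<odot>\<^bsub>path_algebra Q\<^esub> path_elt p) = (c * d) \<odot>\<^bsub>path_algebra Q\<^esub> path_elt p"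
      by (rule ext) simp
    then show ?case using p by (simp add: theta_elt smult_assoc ev_closed del: path_algebra_simps)
  }
qed

lemma theta_mult:
  assumes f: "f \<in> carrier (path_algebra Q)" and g: "g \<in> carrier (path_algebra Q)"
  shows "theta (f \<otimes>\<^bsub>path_algebra Q\<^esub> g) = theta f \<otimes> theta g"
proof -
  interpret A: k_algebra "path_algebra Q" by (rule k_algebra_path_algebra) unfold_locales
  have elt_case: "theta (f \<otimes>\<^bsub>path_algebra Q\<^esub> (c \<odot>\<^bsub>path_algebra Q\<^esub> path_elt p)) =
      theta f \<otimes> theta (c \<odot>\<^bsub>path_algebra Q\<^esub> path_elt p)"
    if p: "p \<in> quiver_paths Q" for c p
    using f path_smult_closed[OF path_elt_closed[OF p], of c]
  proof (induction rule: path_algebra_induct)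
    case zero
    then show ?case
      by (simp add: theta_zero theta_closed del: path_algebra_simps)
  next
    case (add f h)
    then show ?case
      by (simp add: theta_add A.l_distr theta_closed l_distr del: path_algebra_simps)
  next
    case (elt d p')
    obtain v as where p': "p' = (v, as)" "is_path Q v as" using elt by (auto simp: quiver_paths_def)
    obtain w bs where pp: "p = (w, bs)" "is_path Q w bs" using p by (auto simp: quiver_paths_def)
    have cl: "(path_elt p :: _ \<Rightarrow> 'k) \<in> carrier (path_algebra Q)" "(path_elt p' :: _ \<Rightarrow> 'k) \<in> carrier (path_algebra Q)"
      using path_elt_closed p elt(1) by blast+
    have "(d \<odot>\<^bsub>path_algebra Q\<^esub> path_elt p') \<otimes>\<^bsub>path_algebra Q\<^esub> (c \<odot>\<^bsub>path_algebra Q\<^esub> path_elt p)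
      = (d * c) \<odot>\<^bsub>path_algebra Q\<^esub> (path_elt p' \<otimes>\<^bsub>path_algebra Q\<^esub> path_elt p)"
      using cl by (simp add: A.smult_mult_l A.smult_mult_r A.smult_closed A.smult_assoc[symmetric] mult.commute del: path_algebra_simps)
    then have "theta ((d \<odot>\<^bsub>path_algebra Q\<^esub> path_elt p') \<otimes>\<^bsub>path_algebra Q\<^esub> (c \<odot>\<^bsub>path_algebra Q\<^esub> path_elt p))
      = (d * c) \<odot> theta (path_elt p' \<otimes>\<^bsub>path_algebra Q\<^esub> path_elt p)"
      using cl by (simp add: theta_smult del: path_algebra_simps)
    also have "theta (path_elt p' \<otimes>\<^bsub>path_algebra Q\<^esub> path_elt p) = ev v as \<otimes> ev w bs"
      using p' pp by (auto simp: path_elt_mult theta_elt' is_path_append ev_append ev_mult_other theta_zero)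
    finally show ?case using p' pp
      by (simp add: theta_elt smult_mult_l smult_mult_r smult_closed smult_assoc[symmetric] mult.commute
        ev_closed del: path_algebra_simps)
  qed
  show ?thesis using g
  proof (induction rule: path_algebra_induct)
    case zero
    then show ?case using f by (simp add: theta_zero theta_closed del: path_algebra_simps)
  next
    case (add g h)
    then show ?case using f by (simp add: theta_add A.r_distr theta_closed r_distr del: path_algebra_simps)
  next
    case (elt c p)
    then show ?case by (rule elt_case)
  qed
qed

lemma theta_one: "theta \<one>\<^bsub>path_algebra Q\<^esub> = \<one>"
proof -
  let ?i = "\<lambda>v. (v, []) :: 'v \<times> 'b list"
  have "theta \<one>\<^bsub>path_algebra Q\<^esub> =
      (\<Oplus>p\<in>?i ` verts Q. \<one>\<^bsub>path_algebra Q\<^esub> p \<odot> ev (fst p) (snd p))"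
    by (rule theta_eq) (auto simp: quiver_paths_def split: if_splits)
  also have "\<dots> = (\<Oplus>v\<in>verts Q. \<one>\<^bsub>path_algebra Q\<^esub> (?i v) \<odot> E v)"
    by (subst add.finprod_reindex) (auto simp: inj_on_def intro!: smult_closed E_closed)
  also have "\<dots> = finsum R E (verts Q)"
    by (rule add.finprod_cong') (auto simp: E_closed smult_one)
  finally show ?thesis by (simp add: E_sum)
qed

lemma theta_alg_hom: "theta \<in> alg_hom (path_algebra Q) R"
  unfolding alg_hom_def ring_hom_def
  using theta_closed theta_add theta_mult theta_one theta_smult by blast

end

declare path_algebra_simps [simp del]

lemma alg_homD:
  assumes "f \<in> alg_hom A B"
  shows "x \<in> carrier A \<Longrightarrow> f x \<in> carrier B"
    and "x \<in> carrier A \<Longrightarrow> y \<in> carrier A \<Longrightarrow> f (x \<otimes>\<^bsub>A\<^esub> y) = f x \<otimes>\<^bsub>B\<^esub> f y"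
    and "x \<in> carrier A \<Longrightarrow> y \<in> carrier A \<Longrightarrow> f (x \<oplus>\<^bsub>A\<^esub> y) = f x \<oplus>\<^bsub>B\<^esub> f y"
    and "f \<one>\<^bsub>A\<^esub> = \<one>\<^bsub>B\<^esub>"
    and "x \<in> carrier A \<Longrightarrow> f (c \<odot>\<^bsub>A\<^esub> x) = c \<odot>\<^bsub>B\<^esub> f x"
    and "f \<in> ring_hom A B"
  using assms by (auto simp: alg_hom_def ring_hom_def)

lemma alg_homI:
  assumes "\<And>x. x \<in> carrier A \<Longrightarrow> f x \<in> carrier B"
    and "\<And>c x. x \<in> carrier A \<Longrightarrow> f (c \<odot>\<^bsub>A\<^esub> x) = c \<odot>\<^bsub>B\<^esub> f x"
    and "\<And>x y. x \<in> carrier A \<Longrightarrow> y \<in> carrier A \<Longrightarrow> f (x \<otimes>\<^bsub>A\<^esub> y) = f x \<otimes>\<^bsub>B\<^esub> f y"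
    and "\<And>x y. x \<in> carrier A \<Longrightarrow> y \<in> carrier A \<Longrightarrow> f (x \<oplus>\<^bsub>A\<^esub> y) = f x \<oplus>\<^bsub>B\<^esub> f y"
    and "f \<one>\<^bsub>A\<^esub> = \<one>\<^bsub>B\<^esub>"
  shows "f \<in> alg_hom A B"
  using assms by (auto simp: alg_hom_def intro!: ring_hom_memI)

lemma alg_hom_ring_hom_ring:
  assumes "k_algebra A" "k_algebra B" "f \<in> alg_hom A B"
  shows "ring_hom_ring A B f"
  using k_algebra.axioms(1)[OF assms(1)] k_algebra.axioms(1)[OF assms(2)] alg_homD(6)[OF assms(3)]
  by (rule ring_hom_ringI2)

lemma alg_hom_zero:
  assumes "k_algebra A" "k_algebra B" "f \<in> alg_hom A B"
  shows "f \<zero>\<^bsub>A\<^esub> = \<zero>\<^bsub>B\<^esub>"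
proof -
  interpret ring_hom_ring A B f using assms by (rule alg_hom_ring_hom_ring)
  show ?thesis by simp
qed

lemma alg_hom_minus:
  assumes "k_algebra A" "k_algebra B" "f \<in> alg_hom A B" "x \<in> carrier A" "y \<in> carrier A"
  shows "f (x \<ominus>\<^bsub>A\<^esub> y) = f x \<ominus>\<^bsub>B\<^esub> f y"
proof -
  interpret ring_hom_ring A B f using assms(1-3) by (rule alg_hom_ring_hom_ring)
  show ?thesis using assms(4,5) by (simp add: a_minus_def)
qed

lemma alg_hom_compose:
  assumes "f \<in> alg_hom A B" "g \<in> alg_hom B C"
  shows "(\<lambda>x. g (f x)) \<in> alg_hom A C"
  using assms by (auto simp: alg_hom_def ring_hom_def Pi_iff)

lemma alg_hom_list_prod:
  assumes "k_algebra A" "k_algebra B" "f \<in> alg_hom A B" "set xs \<subseteq> carrier A"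
  shows "list_prod A xs \<in> carrier A" "f (list_prod A xs) = list_prod B (map f xs)"
proof -
  interpret A: k_algebra A by fact
  have "list_prod A xs \<in> carrier A \<and> f (list_prod A xs) = list_prod B (map f xs)"
    using assms(4) by (induction xs) (auto simp: list_prod_def alg_homD[OF assms(3)])
  then show "list_prod A xs \<in> carrier A" "f (list_prod A xs) = list_prod B (map f xs)" by auto
qed

lemma list_prod_map_cong:
  "(\<And>x. x \<in> set xs \<Longrightarrow> f x = g x) \<Longrightarrow> list_prod R (map f xs) = list_prod R (map g xs)"
  by (metis (no_types, lifting) map_eq_conv)

subsection \<open>Ordered enumerations\<close>

lemma ordered_list_unique:
  assumes "trans r" "irrefl r" "sorted_wrt (\<lambda>a b. (a, b) \<in> r) xs" "sorted_wrt (\<lambda>a b. (a, b) \<in> r) ys"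
    "set xs = set ys"
  shows "xs = ys"
  using assms(3-5)
proof (induction xs arbitrary: ys)
  case Nil
  then show ?case by simp
next
  case (Cons x xs)
  then obtain y ys' where ys: "ys = y # ys'" by (cases ys) auto
  have nr: "(a, a) \<notin> r" for a using assms(2) by (auto simp: irrefl_def)
  have "x = y"
  proof (rule ccontr)
    assume "x \<noteq> y"
    then have "x \<in> set ys'" "y \<in> set xs" using Cons.prems(3) ys by auto
    then have "(y, x) \<in> r" "(x, y) \<in> r" using Cons.prems ys by auto
    then show False using assms(1) nr by (meson transD)
  qed
  moreover have "x \<notin> set xs" "y \<notin> set ys'" using Cons.prems ys nr by auto
  ultimately have "set xs = set ys'" using Cons.prems(3) ys by auto
  then show ?case using Cons ys \<open>x = y\<close> by simp
qed

lemma ordered_list: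
  assumes "strict_linear_order_on S r" "finite S"
  shows "set (ordered_list r S) = S" "sorted_wrt (\<lambda>a b. (a, b) \<in> r) (ordered_list r S)"
    "distinct (ordered_list r S)"
proof -
  have r: "trans r" "irrefl r" "total_on S r" using assms(1) by (auto simp: strict_linear_order_on_def)
  have "\<exists>xs. set xs = S \<and> sorted_wrt (\<lambda>a b. (a, b) \<in> r) xs"
    using assms(2) r(3)
  proof (induction S rule: finite_induct)
    case empty
    then show ?case by simp
  next
    case (insert x S)
    then obtain xs where xs: "set xs = S" "sorted_wrt (\<lambda>a b. (a, b) \<in> r) xs"
      by (auto simp: total_on_def)
    let ?ys = "filter (\<lambda>y. (y, x) \<in> r) xs @ x # filter (\<lambda>y. (x, y) \<in> r) xs"
    have "set ?ys = insert x S"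
      using xs(1) insert.hyps insert.prems by (auto simp: total_on_def)
    moreover have "sorted_wrt (\<lambda>a b. (a, b) \<in> r) ?ys"
      using xs(2) r(1) by (auto simp: sorted_wrt_append sorted_wrt_filter dest: transD)
    ultimately show ?case by blast
  qed
  then have "\<exists>!xs. set xs = S \<and> sorted_wrt (\<lambda>a b. (a, b) \<in> r) xs"
    using ordered_list_unique[OF r(1,2)] by blast
  then have *: "set (ordered_list r S) = S \<and> sorted_wrt (\<lambda>a b. (a, b) \<in> r) (ordered_list r S)"
    unfolding ordered_list_def by (rule theI')
  then show "set (ordered_list r S) = S" "sorted_wrt (\<lambda>a b. (a, b) \<in> r) (ordered_list r S)" by auto
  have "sorted_wrt (\<lambda>a b. (a, b) \<in> r) xs \<Longrightarrow> distinct xs" for xs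
    using r(2) by (induction xs) (auto simp: irrefl_def)
  then show "distinct (ordered_list r S)" using * by blast
qed

subsection \<open>Quotient algebras\<close>

lemma quotient_algebra_simps:
  "carrier (quotient_algebra A I) = carrier (A Quot I)"
  "x \<otimes>\<^bsub>quotient_algebra A I\<^esub> y = x \<otimes>\<^bsub>A Quot I\<^esub> y"
  "\<one>\<^bsub>quotient_algebra A I\<^esub> = \<one>\<^bsub>A Quot I\<^esub>"
  "\<zero>\<^bsub>quotient_algebra A I\<^esub> = \<zero>\<^bsub>A Quot I\<^esub>"
  "x \<oplus>\<^bsub>quotient_algebra A I\<^esub> y = x \<oplus>\<^bsub>A Quot I\<^esub> y"
  "c \<odot>\<^bsub>quotient_algebra A I\<^esub> x = (I +>\<^bsub>A\<^esub> (c \<odot>\<^bsub>A\<^esub> \<one>\<^bsub>A\<^esub>)) \<otimes>\<^bsub>A Quot I\<^esub> x"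
  by (simp_all add: quotient_algebra_def ring.defs module.defs)

lemma quotient_algebra_carrierE:
  assumes "x \<in> carrier (quotient_algebra A I)"
  obtains a where "a \<in> carrier A" "x = I +>\<^bsub>A\<^esub> a"
  using assms unfolding quotient_algebra_simps FactRing_simps by auto

lemma quotient_algebra:
  assumes "k_algebra A" "ideal I A"
  shows "k_algebra (quotient_algebra A I)"
    and "(\<lambda>x. I +>\<^bsub>A\<^esub> x) \<in> alg_hom A (quotient_algebra A I)"
proof -
  interpret A: k_algebra A by fact
  interpret I: ideal I A by fact
  interpret R: ring "A Quot I" by (rule I.quotient_is_ring)
  let ?B = "quotient_algebra A I"
  have "abelian_group ?B"
  proof (rule abelian_groupI)
    fix x assume "x \<in> carrier ?B"
    then show "\<exists>y\<in>carrier ?B. y \<oplus>\<^bsub>?B\<^esub> x = \<zero>\<^bsub>?B\<^esub>"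
      by (intro bexI[of _ "\<ominus>\<^bsub>A Quot I\<^esub> x"]) (auto simp: quotient_algebra_simps R.l_neg)
  qed (auto simp: quotient_algebra_simps R.a_ac)
  moreover have "Group.monoid ?B"
    by (rule monoidI) (auto simp: quotient_algebra_simps R.m_assoc)
  ultimately have ring: "ring ?B"
    by (rule ringI) (auto simp: quotient_algebra_simps R.l_distr R.r_distr)
  interpret B: ring ?B by (rule ring)
  have hom: "(\<lambda>x. I +>\<^bsub>A\<^esub> x) \<in> ring_hom A ?B"
    using I.rcos_ring_hom by (auto simp: ring_hom_def quotient_algebra_simps)
  have smult: "c \<odot>\<^bsub>?B\<^esub> (I +>\<^bsub>A\<^esub> x) = I +>\<^bsub>A\<^esub> (c \<odot>\<^bsub>A\<^esub> x)" if "x \<in> carrier A" for c x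
  proof -
    have "c \<odot>\<^bsub>?B\<^esub> (I +>\<^bsub>A\<^esub> x) = I +>\<^bsub>A\<^esub> ((c \<odot>\<^bsub>A\<^esub> \<one>\<^bsub>A\<^esub>) \<otimes>\<^bsub>A\<^esub> x)"
      using that ring_hom_mult[OF I.rcos_ring_hom, of "c \<odot>\<^bsub>A\<^esub> \<one>\<^bsub>A\<^esub>" x]
      by (simp add: quotient_algebra_simps A.smult_closed)
    then show ?thesis using that by (simp add: A.smult_mult_l)
  qed
  show "(\<lambda>x. I +>\<^bsub>A\<^esub> x) \<in> alg_hom A ?B"
    using hom smult by (auto simp: alg_hom_def)
  note h = ring_hom_closed[OF hom] ring_hom_mult[OF hom, symmetric] ring_hom_add[OF hom, symmetric]
  show "k_algebra ?B"
  proof (intro k_algebra.intro k_algebra_axioms.intro ring)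
    fix x y c d assume "x \<in> carrier ?B"
    then obtain a where a: "a \<in> carrier A" "x = I +>\<^bsub>A\<^esub> a" by (rule quotient_algebra_carrierE)
    show "c \<odot>\<^bsub>?B\<^esub> x \<in> carrier ?B" "(c + d) \<odot>\<^bsub>?B\<^esub> x = c \<odot>\<^bsub>?B\<^esub> x \<oplus>\<^bsub>?B\<^esub> d \<odot>\<^bsub>?B\<^esub> x"
      "(c * d) \<odot>\<^bsub>?B\<^esub> x = c \<odot>\<^bsub>?B\<^esub> (d \<odot>\<^bsub>?B\<^esub> x)" "1 \<odot>\<^bsub>?B\<^esub> x = x"
      using a by (simp_all add: smult h A.smult_closed A.smult_l_distr A.smult_assoc A.smult_one)
    assume "y \<in> carrier ?B"
    then obtain b where b: "b \<in> carrier A" "y = I +>\<^bsub>A\<^esub> b" by (rule quotient_algebra_carrierE)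
    show "c \<odot>\<^bsub>?B\<^esub> (x \<oplus>\<^bsub>?B\<^esub> y) = c \<odot>\<^bsub>?B\<^esub> x \<oplus>\<^bsub>?B\<^esub> c \<odot>\<^bsub>?B\<^esub> y"
      "(c \<odot>\<^bsub>?B\<^esub> x) \<otimes>\<^bsub>?B\<^esub> y = c \<odot>\<^bsub>?B\<^esub> (x \<otimes>\<^bsub>?B\<^esub> y)"
      "x \<otimes>\<^bsub>?B\<^esub> (c \<odot>\<^bsub>?B\<^esub> y) = c \<odot>\<^bsub>?B\<^esub> (x \<otimes>\<^bsub>?B\<^esub> y)"
      using a b by (simp_all add: smult h A.smult_closed A.smult_r_distr A.smult_mult_l A.smult_mult_r)
  qed
qed

text \<open>The universal property of the quotient.\<close>

lemma quotient_algebra_lift: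
  assumes A: "k_algebra A" and R: "k_algebra R" and f: "f \<in> alg_hom A R"
    and I: "ideal I A" and ker: "\<And>x. x \<in> I \<Longrightarrow> f x = \<zero>\<^bsub>R\<^esub>"
  obtains g where "g \<in> alg_hom (quotient_algebra A I) R"
    "\<And>x. x \<in> carrier A \<Longrightarrow> g (I +>\<^bsub>A\<^esub> x) = f x"
proof -
  interpret A: k_algebra A by fact
  interpret R: k_algebra R by fact
  interpret I: ideal I A by fact
  define g where "g X = the_elem (f ` X)" for X
  have g: "g (I +>\<^bsub>A\<^esub> x) = f x" if x: "x \<in> carrier A" for x
  proof -
    have "f ` (I +>\<^bsub>A\<^esub> x) = (\<lambda>i. f (i \<oplus>\<^bsub>A\<^esub> x)) ` I"
      by (auto simp: a_r_coset_def')
    also have "\<dots> = (\<lambda>i. f x) ` I"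
      using x by (intro image_cong refl) (simp add: alg_homD[OF f] ker I.Icarr)
    also have "\<dots> = {f x}" using additive_subgroup.zero_closed[OF I.additive_subgroup_axioms] by (rule image_constant)
    finally show ?thesis by (simp add: g_def)
  qed
  note h = quotient_algebra(2)[OF A I]
  have "g \<in> alg_hom (quotient_algebra A I) R"
  proof (rule alg_homI)
    fix x assume "x \<in> carrier (quotient_algebra A I)"
    then obtain a where a: "a \<in> carrier A" "x = I +>\<^bsub>A\<^esub> a" by (rule quotient_algebra_carrierE)
    then show "g x \<in> carrier R" by (simp add: g alg_homD[OF f])
    show "g (c \<odot>\<^bsub>quotient_algebra A I\<^esub> x) = c \<odot>\<^bsub>R\<^esub> g x" for c
      using a by (simp add: g A.smult_closed alg_homD[OF f] alg_homD(5)[OF h, symmetric])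
    fix y assume "y \<in> carrier (quotient_algebra A I)"
    then obtain b where b: "b \<in> carrier A" "y = I +>\<^bsub>A\<^esub> b" by (rule quotient_algebra_carrierE)
    show "g (x \<otimes>\<^bsub>quotient_algebra A I\<^esub> y) = g x \<otimes>\<^bsub>R\<^esub> g y"
      "g (x \<oplus>\<^bsub>quotient_algebra A I\<^esub> y) = g x \<oplus>\<^bsub>R\<^esub> g y"
      using a b by (simp_all add: g alg_homD[OF f] alg_homD(2,3)[OF h, symmetric])
  next
    show "g \<one>\<^bsub>quotient_algebra A I\<^esub> = \<one>\<^bsub>R\<^esub>"
      using g[of "\<one>\<^bsub>A\<^esub>"] by (simp add: alg_homD[OF f] alg_homD(4)[OF h])
  qed
  then show thesis using g by (rule that)
qed

subsection \<open>Generators of path algebras\<close>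

lemma vertex_elt_closed: "v \<in> verts Q \<Longrightarrow> vertex_elt v \<in> carrier (path_algebra Q)"
  by (auto simp: vertex_elt_def quiver_paths_def intro!: path_elt_closed)

lemma (in wf_digraph) arrow_elt_closed: "a \<in> arcs G \<Longrightarrow> arrow_elt G a \<in> carrier (path_algebra G)"
  by (auto simp: arrow_elt_def quiver_paths_def intro!: path_elt_closed)

lemma vertex_elt_mult:
  "vertex_elt v \<otimes>\<^bsub>path_algebra Q\<^esub> vertex_elt w =
     (if v = w then vertex_elt v else \<zero>\<^bsub>path_algebra Q\<^esub>)"
  by (simp add: vertex_elt_def path_elt_mult)

lemma arrow_elt_head: "vertex_elt (head Q a) \<otimes>\<^bsub>path_algebra Q\<^esub> arrow_elt Q a = arrow_elt Q a"
  by (simp add: vertex_elt_def arrow_elt_def path_elt_mult)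

lemma arrow_elt_tail: "arrow_elt Q a \<otimes>\<^bsub>path_algebra Q\<^esub> vertex_elt (tail Q a) = arrow_elt Q a"
  by (simp add: vertex_elt_def arrow_elt_def path_elt_mult)

lemma path_elt_Cons:
  "head Q a = v \<Longrightarrow>
    path_elt (v, a # as) = arrow_elt Q a \<otimes>\<^bsub>path_algebra Q\<^esub> path_elt (tail Q a, as)"
  by (simp add: arrow_elt_def path_elt_mult)

lemma path_one_eq_sum:
  assumes "fin_digraph Q"
  shows "finsum (path_algebra Q) vertex_elt (verts Q) = (\<one>\<^bsub>path_algebra Q\<^esub> :: _ \<Rightarrow> 'k::field)"
proof (rule ext, clarify)
  interpret fin_digraph Q by fact
  interpret A: k_algebra "path_algebra Q :: ('k, _) module" by (rule k_algebra_path_algebra) fact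
  fix v as
  have "finite S \<Longrightarrow> S \<subseteq> verts Q \<Longrightarrow> finsum (path_algebra Q) vertex_elt S (v, as) =
      (if v \<in> S \<and> as = [] then 1 else (0::'k))" for S
  proof (induction S rule: finite_induct)
    case empty
    then show ?case by (simp add: path_algebra_simps)
  next
    case (insert x S)
    have "finsum (path_algebra Q) vertex_elt (insert x S) =
        (vertex_elt x :: _ \<Rightarrow> 'k) \<oplus>\<^bsub>path_algebra Q\<^esub> finsum (path_algebra Q) vertex_elt S"
      using insert by (intro A.finsum_insert) (auto intro!: vertex_elt_closed)
    then show ?case using insert
      by (simp add: path_algebra_simps(5)) (auto simp: vertex_elt_def path_elt_def)
  qed
  from this[OF finite_verts subset_refl]
  show "finsum (path_algebra Q) vertex_elt (verts Q) (v, as) = (\<one>\<^bsub>path_algebra Q\<^esub> (v, as) :: 'k)"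
    by (simp add: path_algebra_simps(3))
qed

lemma path_alg_hom_eqI:
  fixes Q :: "('v, 'b) pre_digraph" and f g :: "('v \<times> 'b list \<Rightarrow> 'k::field) \<Rightarrow> 'r"
  assumes Q: "fin_digraph Q" and R: "k_algebra R"
    and f: "f \<in> alg_hom (path_algebra Q) R" and g: "g \<in> alg_hom (path_algebra Q) R"
    and v: "\<And>v. v \<in> verts Q \<Longrightarrow> f (vertex_elt v) = g (vertex_elt v)"
    and a: "\<And>a. a \<in> arcs Q \<Longrightarrow> f (arrow_elt Q a) = g (arrow_elt Q a)"
    and x: "x \<in> carrier (path_algebra Q)"
  shows "f x = g x"
proof -
  interpret fin_digraph Q by fact
  have A: "k_algebra (path_algebra Q :: ('k, _) module)" by (rule k_algebra_path_algebra) fact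
  interpret A: k_algebra "path_algebra Q :: ('k, _) module" by (rule A)
  note h = alg_homD[OF f] alg_homD[OF g]
  have cl: "(path_elt (v, as) :: _ \<Rightarrow> 'k) \<in> carrier (path_algebra Q)" if "is_path Q v as" for v as
    using that by (intro path_elt_closed) (simp add: quiver_paths_def)
  have *: "f (path_elt (v, as)) = g (path_elt (v, as))" if "is_path Q v as" for v as
    using that
  proof (induction as arbitrary: v)
    case Nil
    then show ?case using v[of v] by (simp add: vertex_elt_def)
  next
    case (Cons b as)
    then have b: "head Q b = v" "b \<in> arcs Q" "is_path Q (tail Q b) as" by auto
    show ?case using b a[OF b(2)] Cons.IH[OF b(3)]
      by (simp add: path_elt_Cons[OF b(1)] h arrow_elt_closed cl)
  qed
  show ?thesis using x
  proof (induction rule: path_algebra_induct)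
    case zero
    then show ?case using alg_hom_zero[OF A R f] alg_hom_zero[OF A R g] by simp
  next
    case (add x y)
    then show ?case by (simp add: h)
  next
    case (elt c p)
    then obtain v as where "p = (v, as)" "is_path Q v as" by (auto simp: quiver_paths_def)
    then show ?case by (simp add: h cl *)
  qed
qed

subsection \<open>Adjoining loops\<close>

lemma double_simps [simp]:
  "verts (double Q) = verts Q"
  "Inl a \<in> arcs (double Q) \<longleftrightarrow> a \<in> arcs Q" "Inr a \<in> arcs (double Q) \<longleftrightarrow> a \<in> arcs Q"
  "tail (double Q) (Inl a) = tail Q a" "tail (double Q) (Inr a) = head Q a"
  "head (double Q) (Inl a) = head Q a" "head (double Q) (Inr a) = tail Q a"
  by (auto simp: double_def)

lemma adjoin_loops_simps [simp]:
  "verts (adjoin_loops G) = verts G"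
  "Inl a \<in> arcs (adjoin_loops G) \<longleftrightarrow> a \<in> arcs G" "Inr a \<in> arcs (adjoin_loops G) \<longleftrightarrow> a \<in> arcs G"
  "tail (adjoin_loops G) (Inl a) = tail G a" "tail (adjoin_loops G) (Inr a) = head G a"
  "head (adjoin_loops G) (Inl a) = head G a" "head (adjoin_loops G) (Inr a) = head G a"
  by (auto simp: adjoin_loops_def)

lemma fin_digraph_double: "fin_digraph Q \<Longrightarrow> fin_digraph (double Q)"
  by (auto simp: fin_digraph_def fin_digraph_axioms_def wf_digraph_def double_def)

lemma fin_digraph_adjoin_loops: "fin_digraph Q \<Longrightarrow> fin_digraph (adjoin_loops Q)"
  by (auto simp: fin_digraph_def fin_digraph_axioms_def wf_digraph_def adjoin_loops_def)

lemma rev_arrow_simps [simp]: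
  "rev_arrow a \<in> arcs (double Q) \<longleftrightarrow> a \<in> arcs (double Q)"
  "tail (double Q) (rev_arrow a) = head (double Q) a"
  "head (double Q) (rev_arrow a) = tail (double Q) a"
  by (cases a; simp)+

lemma is_path_embed: "is_path (adjoin_loops G) v (map Inl as) \<longleftrightarrow> is_path G v as"
  by (induction as arbitrary: v) auto

lemma path_tail_embed: "path_tail (adjoin_loops G) v (map Inl as) = path_tail G v as"
  by (induction as arbitrary: v) auto

lemma path_embed_Inl [simp]: "path_embed f (v, map Inl as) = f (v, as)"
  by (auto simp: path_embed_def comp_def)

lemma path_embed_other: "\<not> set bs \<subseteq> range Inl \<Longrightarrow> path_embed f (v, bs) = 0"
  by (simp add: path_embed_def)

lemma range_Inl_cases:
  obtains as where "bs = map Inl as" | "\<not> set bs \<subseteq> range Inl"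
  by (metis ex_map_conv image_iff subsetD)

lemma path_embed_path_elt:
  fixes as :: "'b list"
  shows "path_embed (path_elt (v, as)) = (path_elt (v, map Inl as) :: 'v \<times> ('b + 'c) list \<Rightarrow> 'k::field)"
proof (rule ext, clarify)
  fix w and bs :: "('b + 'c) list"
  show "path_embed (path_elt (v, as)) (w, bs) = (path_elt (v, map Inl as) (w, bs) :: 'k)"
  proof (cases bs rule: range_Inl_cases)
    case (1 cs)
    then show ?thesis by (simp add: path_elt_def inj_map_eq_map)
  next
    case 2
    then show ?thesis by (auto simp: path_embed_other path_elt_def)
  qed
qed

lemma path_embed_vertex_elt [simp]: "path_embed (vertex_elt v) = vertex_elt v"
  by (simp add: vertex_elt_def path_embed_path_elt)

lemma path_embed_arrow_elt [simp]: "path_embed (arrow_elt G a) = arrow_elt (adjoin_loops G) (Inl a)"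
  by (simp add: arrow_elt_def path_embed_path_elt)

lemma path_embed_mult:
  "path_embed (f \<otimes>\<^bsub>path_algebra G\<^esub> g) = path_embed f \<otimes>\<^bsub>path_algebra (adjoin_loops G)\<^esub> path_embed g"
proof (rule ext, clarify)
  fix v and bs :: "('b + 'b) list"
  show "path_embed (f \<otimes>\<^bsub>path_algebra G\<^esub> g) (v, bs) =
    (path_embed f \<otimes>\<^bsub>path_algebra (adjoin_loops G)\<^esub> path_embed g) (v, bs)"
  proof (cases bs rule: range_Inl_cases)
    case (1 as)
    then show ?thesis
      by (simp add: path_algebra_simps take_map drop_map path_tail_embed)
  next
    case 2
    have "path_embed f (v, take i bs) * path_embed g (path_tail (adjoin_loops G) v (take i bs), drop i bs) = 0" for i
    proof -
      have "set bs = set (take i bs) \<union> set (drop i bs)"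
        by (metis append_take_drop_id set_append)
      then have "\<not> set (take i bs) \<subseteq> range Inl \<or> \<not> set (drop i bs) \<subseteq> range Inl"
        using 2 by auto
      then show ?thesis by (metis path_embed_other mult_zero_left mult_zero_right)
    qed
    then show ?thesis by (simp only: path_algebra_simps path_embed_other[OF 2] sum.neutral_const)
  qed
qed

lemma path_embed_alg_hom:
  fixes G :: "('v, 'b) pre_digraph"
  shows "path_embed \<in> alg_hom (path_algebra G) (path_algebra (adjoin_loops G) :: ('k::field, _) module)"
proof (rule alg_homI)
  fix f :: "'v \<times> 'b list \<Rightarrow> 'k" assume f: "f \<in> carrier (path_algebra G)"
  have *: "{p. path_embed f p \<noteq> 0} \<subseteq> (\<lambda>(v, as). (v, map Inl as)) ` {p. f p \<noteq> 0}"
  proof clarify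
    fix v bs assume nz: "path_embed f (v, bs) \<noteq> 0"
    then obtain as where "bs = map Inl as" by (cases bs rule: range_Inl_cases) (auto simp: path_embed_other)
    then show "(v, bs) \<in> (\<lambda>(v, as). (v, map Inl as)) ` {p. f p \<noteq> 0}" using nz by auto
  qed
  moreover have "(\<lambda>(v, as). (v, map Inl as)) ` {p. f p \<noteq> 0} \<subseteq> quiver_paths (adjoin_loops G)"
    using f by (auto simp: path_algebra_simps quiver_paths_def is_path_embed)
  ultimately show "path_embed f \<in> carrier (path_algebra (adjoin_loops G))"
    using f finite_subset[OF *] by (auto simp: path_algebra_simps)
  fix c :: 'k
  show "path_embed (c \<odot>\<^bsub>path_algebra G\<^esub> f) = c \<odot>\<^bsub>path_algebra (adjoin_loops G)\<^esub> path_embed f"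
    by (rule ext) (auto simp: path_embed_def path_algebra_simps)
next
  fix f g :: "'v \<times> 'b list \<Rightarrow> 'k"
  assume "f \<in> carrier (path_algebra G)" "g \<in> carrier (path_algebra G)"
  show "path_embed (f \<oplus>\<^bsub>path_algebra G\<^esub> g) = path_embed f \<oplus>\<^bsub>path_algebra (adjoin_loops G)\<^esub> path_embed g"
    by (rule ext) (auto simp: path_embed_def path_algebra_simps)
  show "path_embed (f \<otimes>\<^bsub>path_algebra G\<^esub> g) = path_embed f \<otimes>\<^bsub>path_algebra (adjoin_loops G)\<^esub> path_embed g"
    by (rule path_embed_mult)
next
  show "path_embed \<one>\<^bsub>path_algebra G\<^esub> = (\<one>\<^bsub>path_algebra (adjoin_loops G)\<^esub> :: _ \<Rightarrow> 'k)"
    by (rule ext) (auto simp: path_embed_def path_algebra_simps)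
qed

subsection \<open>Existence and uniqueness of the induced homomorphisms\<close>

lemma (in ring) corner_inverse:
  assumes "E \<in> carrier R" "P \<in> carrier R" "V \<in> carrier R" "E \<otimes> P = P" "(\<one> \<oplus> P) \<otimes> V = \<one>"
  shows "(\<one> \<ominus> E) \<oplus> E \<otimes> V = V"
proof -
  have 1: "V \<oplus> P \<otimes> V = \<one>" using assms by (simp add: l_distr)
  have "E \<otimes> V \<oplus> P \<otimes> V = E \<otimes> (V \<oplus> P \<otimes> V)"
    using assms by (simp add: r_distr m_assoc[symmetric])
  then have "E \<otimes> V \<oplus> P \<otimes> V = E" using 1 assms by simp
  then have "(\<one> \<ominus> E) \<oplus> E \<otimes> V = ((V \<oplus> P \<otimes> V) \<ominus> (E \<otimes> V \<oplus> P \<otimes> V)) \<oplus> E \<otimes> V"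
    using 1 by simp
  also have "\<dots> = V"
    using assms by (simp add: a_minus_def minus_add a_ac r_neg r_neg2 r_neg1)
  finally show ?thesis .
qed

lemma (in ring) corner_inverse_commute:
  assumes "E \<in> carrier R" "P \<in> carrier R" "V \<in> carrier R" "E \<otimes> P = P" "P \<otimes> E = P"
    "(\<one> \<oplus> P) \<otimes> V = \<one>" "V \<otimes> (\<one> \<oplus> P) = \<one>"
  shows "V \<otimes> E = E \<otimes> V"
proof -
  define D where "D = \<one> \<oplus> P"
  have D: "D \<in> carrier R" "D \<otimes> V = \<one>" "V \<otimes> D = \<one>" "D \<otimes> E = E \<otimes> D"
    using assms by (simp_all add: D_def l_distr r_distr)
  have "V \<otimes> E = V \<otimes> E \<otimes> (D \<otimes> V)" using D assms by simp
  also have "\<dots> = V \<otimes> (E \<otimes> D) \<otimes> V" by (simp only: m_assoc m_closed assms(1,3) D(1))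
  also have "\<dots> = V \<otimes> (D \<otimes> E) \<otimes> V" by (simp only: D(4))
  also have "\<dots> = (V \<otimes> D) \<otimes> (E \<otimes> V)" by (simp only: m_assoc m_closed assms(1,3) D(1))
  also have "\<dots> = E \<otimes> V" using D assms by simp
  finally show ?thesis .
qed

lemma (in ring) add_minus_cancel:
  assumes "x \<in> carrier R" "y \<in> carrier R"
  shows "(x \<oplus> y) \<ominus> x = y"
  using assms by (simp only: a_minus_def a_comm[of x y] a_assoc a_inv_closed r_neg r_zero)

lemma (in k_algebra) path_evalI:
  fixes Q :: "('v, 'b) pre_digraph" and \<psi> :: "('v \<times> 'b list \<Rightarrow> 'k) \<Rightarrow> 'a"
  assumes Q: "fin_digraph Q" and psi: "\<psi> \<in> alg_hom (path_algebra Q) A"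
  shows "(\<Oplus>v\<in>verts Q. \<psi> (vertex_elt v)) = \<one>"
proof -
  interpret fin_digraph Q by fact
  interpret P: k_algebra "path_algebra Q :: ('k, _) module" by (rule k_algebra_path_algebra) fact
  note h = alg_homD[OF psi]
  have "finite S \<Longrightarrow> S \<subseteq> verts Q \<Longrightarrow>
      \<psi> (finsum (path_algebra Q) vertex_elt S) = (\<Oplus>v\<in>S. \<psi> (vertex_elt v))" for S
  proof (induction S rule: finite_induct)
    case empty
    show ?case using alg_hom_zero[OF P.k_algebra_axioms k_algebra_axioms psi] by simp
  next
    case (insert x S)
    then have "vertex_elt \<in> insert x S \<rightarrow> carrier (path_algebra Q :: ('k, _) module)"
      by (auto intro!: vertex_elt_closed)
    then show ?case using insert
      by (simp add: h Pi_iff)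
  qed
  from this[OF finite_verts subset_refl] show ?thesis
    by (simp add: path_one_eq_sum[OF Q] h)
qed

lemma one_plus_closed:
  assumes "fin_digraph Q" "a \<in> arcs (double Q)"
  shows "(one_plus Q a :: _ \<Rightarrow> 'k::field) \<in> carrier (path_algebra (double Q))"
proof -
  interpret D: fin_digraph "double Q" using assms(1) by (rule fin_digraph_double)
  interpret A: k_algebra "path_algebra (double Q) :: ('k, _) module"
    by (rule k_algebra_path_algebra) unfold_locales
  show ?thesis using assms(2) by (simp add: one_plus_def D.arrow_elt_closed)
qed

lemma vertex_sum_closed:
  fixes q :: "'v \<Rightarrow> 'k::field"
  assumes "fin_digraph Q"
  shows "vertex_sum Q q \<in> carrier (path_algebra (double Q))"
proof -
  interpret D: fin_digraph "double Q" using assms(1) by (rule fin_digraph_double)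
  interpret A: k_algebra "path_algebra (double Q) :: ('k, _) module"
    by (rule k_algebra_path_algebra) unfold_locales
  show ?thesis unfolding vertex_sum_def
    by (intro A.finsum_closed Pi_I A.smult_closed vertex_elt_closed) simp
qed

lemma loc_inverse_closed:
  assumes "fin_digraph Q" "a \<in> arcs (double Q)"
  shows "(loc_inverse Q a :: _ \<Rightarrow> 'k::field) \<in> carrier (loc_algebra Q)"
proof -
  interpret D: fin_digraph "double Q" using assms(1) by (rule fin_digraph_double)
  interpret L: fin_digraph "adjoin_loops (double Q)"
    by (rule fin_digraph_adjoin_loops) unfold_locales
  interpret B: k_algebra "loc_algebra Q :: ('k, _) module"
    by (rule k_algebra_path_algebra) unfold_locales
  have "head (double Q) a \<in> verts (adjoin_loops (double Q))"
    using D.head_in_verts[OF assms(2)] by simp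
  then show ?thesis using assms(2)
    unfolding loc_inverse_def by (intro B.a_closed B.minus_closed B.one_closed vertex_elt_closed L.arrow_elt_closed) simp_all
qed

lemma sign_cases: "arrow_sign a = 1 \<or> arrow_sign a = -1"
  by (cases a) auto

context
  fixes Q :: "('v, 'b) pre_digraph" and ord :: "('b + 'b) rel" and q :: "'v \<Rightarrow> 'k::field"
  assumes Q: "fin_digraph Q" and ord: "strict_linear_order_on (arcs (double Q)) ord"
begin

interpretation D: fin_digraph "double Q" using Q by (rule fin_digraph_double)
interpretation L: fin_digraph "adjoin_loops (double Q)"
  by (rule fin_digraph_adjoin_loops) unfold_locales
interpretation A: k_algebra "path_algebra (double Q) :: ('k, 'v \<times> ('b + 'b) list \<Rightarrow> 'k) module"
  by (rule k_algebra_path_algebra) unfold_locales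
interpretation B: k_algebra "loc_algebra Q :: ('k, 'v \<times> (('b + 'b) + ('b + 'b)) list \<Rightarrow> 'k) module"
  by (rule k_algebra_path_algebra) unfold_locales

lemma set_arrow_list: "set (ordered_list ord (arcs (double Q))) = arcs (double Q)"
  using ordered_list(1)[OF ord] by simp

lemma embed_closed:
  "f \<in> carrier (path_algebra (double Q)) \<Longrightarrow> path_embed f \<in> carrier (loc_algebra Q :: ('k, _) module)"
  by (rule alg_homD(1)[OF path_embed_alg_hom])

abbreviation (input) "mpa_factors \<equiv>
  map (\<lambda>a. if arrow_sign a = 1 then path_embed (one_plus Q a) else (loc_inverse Q a :: _ \<Rightarrow> 'k))
    (ordered_list ord (arcs (double Q)))"

lemma factors_closed: "set mpa_factors \<subseteq> carrier (loc_algebra Q)"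
  using set_arrow_list by (auto intro!: embed_closed one_plus_closed[OF Q] loc_inverse_closed[OF Q])

lemma list_prod_factors_closed: "list_prod (loc_algebra Q) mpa_factors \<in> carrier (loc_algebra Q)"
proof -
  have "id \<in> alg_hom (loc_algebra Q :: ('k, _) module) (loc_algebra Q)" by (rule alg_homI) auto
  from alg_hom_list_prod(1)[OF B.k_algebra_axioms B.k_algebra_axioms this factors_closed]
  show ?thesis .
qed

lemma mpa_relations_closed: "mpa_relations Q ord q \<subseteq> carrier (loc_algebra Q)"
  unfolding mpa_relations_def
  using list_prod_factors_closed
  by (auto intro!: B.minus_closed B.m_closed embed_closed one_plus_closed[OF Q] loc_inverse_closed[OF Q]
      vertex_sum_closed[OF Q])

lemma mpa_ideal: "ideal (mpa_ideal Q ord q) (loc_algebra Q)"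
  unfolding mpa_ideal_def by (rule B.genideal_ideal[OF mpa_relations_closed])

lemma k_algebra_mpa: "k_algebra (mpa Q ord q)"
  unfolding mpa_def by (rule quotient_algebra(1)[OF B.k_algebra_axioms mpa_ideal])

lemma mpa_proj: "(\<lambda>x. mpa_ideal Q ord q +>\<^bsub>loc_algebra Q\<^esub> x) \<in> alg_hom (loc_algebra Q) (mpa Q ord q)"
  unfolding mpa_def by (rule quotient_algebra(2)[OF B.k_algebra_axioms mpa_ideal])

interpretation M: k_algebra "mpa Q ord q" by (rule k_algebra_mpa)

lemma mpa_hom: "mpa_hom Q ord q \<in> alg_hom (path_algebra (double Q)) (mpa Q ord q)"
  using alg_hom_compose[OF path_embed_alg_hom mpa_proj] by (simp add: mpa_hom_def[abs_def])

lemma mpa_relation: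
  assumes "x \<ominus>\<^bsub>loc_algebra Q\<^esub> y \<in> mpa_relations Q ord q"
    "x \<in> carrier (loc_algebra Q)" "y \<in> carrier (loc_algebra Q)"
  shows "mpa_ideal Q ord q +>\<^bsub>loc_algebra Q\<^esub> x = mpa_ideal Q ord q +>\<^bsub>loc_algebra Q\<^esub> y"
  using assms B.genideal_self[OF mpa_relations_closed] B.quotient_eq_iff_same_a_r_cos[OF mpa_ideal]
  unfolding mpa_ideal_def by blast

lemma mpa_inverse:
  assumes "a \<in> arcs (double Q)"
  defines "w \<equiv> mpa_ideal Q ord q +>\<^bsub>loc_algebra Q\<^esub> loc_inverse Q a"
  shows "mpa_hom Q ord q (one_plus Q a) \<otimes>\<^bsub>mpa Q ord q\<^esub> w = \<one>\<^bsub>mpa Q ord q\<^esub>"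
    "w \<otimes>\<^bsub>mpa Q ord q\<^esub> mpa_hom Q ord q (one_plus Q a) = \<one>\<^bsub>mpa Q ord q\<^esub>"
    "w \<in> carrier (mpa Q ord q)" "mpa_hom Q ord q (one_plus Q a) \<in> carrier (mpa Q ord q)"
proof -
  note cl = embed_closed[OF one_plus_closed[OF Q assms(1)]] loc_inverse_closed[OF Q assms(1), where 'k = 'k]
  show "mpa_hom Q ord q (one_plus Q a) \<otimes>\<^bsub>mpa Q ord q\<^esub> w = \<one>\<^bsub>mpa Q ord q\<^esub>"
    unfolding mpa_hom_def w_def alg_homD(2)[OF mpa_proj cl, symmetric] alg_homD(4)[OF mpa_proj, symmetric]
    using assms(1) cl by (intro mpa_relation) (auto simp: mpa_relations_def)
  show "w \<otimes>\<^bsub>mpa Q ord q\<^esub> mpa_hom Q ord q (one_plus Q a) = \<one>\<^bsub>mpa Q ord q\<^esub>"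
    unfolding mpa_hom_def w_def alg_homD(2)[OF mpa_proj cl(2,1), symmetric] alg_homD(4)[OF mpa_proj, symmetric]
    using assms(1) cl by (intro mpa_relation) (auto simp: mpa_relations_def)
  show "w \<in> carrier (mpa Q ord q)" "mpa_hom Q ord q (one_plus Q a) \<in> carrier (mpa Q ord q)"
    unfolding w_def mpa_hom_def using cl by (auto intro: alg_homD(1)[OF mpa_proj])
qed

lemma mpa_satisfies_condition: "mpa_condition Q ord q (mpa Q ord q) (mpa_hom Q ord q)"
  unfolding mpa_condition_def
proof (intro conjI ballI)
  let ?p = "\<lambda>x. mpa_ideal Q ord q +>\<^bsub>loc_algebra Q\<^esub> x"
  show "mpa_hom Q ord q (one_plus Q a) \<in> Units (mpa Q ord q)" if "a \<in> arcs (double Q)" for a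
    using mpa_inverse[OF that] unfolding Units_def by blast
  have "list_prod (mpa Q ord q) (map (\<lambda>a. mpa_hom Q ord q (one_plus Q a) [^]\<^bsub>mpa Q ord q\<^esub> arrow_sign a)
       (ordered_list ord (arcs (double Q)))) = list_prod (mpa Q ord q) (map ?p mpa_factors)"
    unfolding map_map comp_def
  proof (rule list_prod_map_cong)
    fix a assume "a \<in> set (ordered_list ord (arcs (double Q)))"
    then have a: "a \<in> arcs (double Q)" using set_arrow_list by simp
    show "mpa_hom Q ord q (one_plus Q a) [^]\<^bsub>mpa Q ord q\<^esub> arrow_sign a =
      ?p (if arrow_sign a = 1 then path_embed (one_plus Q a) else loc_inverse Q a)"
    proof (cases "arrow_sign a = 1")
      case True
      then show ?thesis using mpa_inverse(4)[OF a] by (simp add: int_pow_def2 mpa_hom_def)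
    next
      case False
      then have "arrow_sign a = -1" using sign_cases by blast
      then show ?thesis using mpa_inverse[OF a] M.inv_unique'[OF mpa_inverse(4,3)[OF a] mpa_inverse(1,2)[OF a]]
        by (simp add: int_pow_def2)
    qed
  qed
  also have "\<dots> = ?p (list_prod (loc_algebra Q) mpa_factors)"
    by (rule alg_hom_list_prod(2)[OF B.k_algebra_axioms M.k_algebra_axioms mpa_proj factors_closed, symmetric])
  also have "\<dots> = ?p (path_embed (vertex_sum Q q))"
    by (rule mpa_relation)
      (auto simp: mpa_relations_def intro!: list_prod_factors_closed embed_closed vertex_sum_closed[OF Q])
  finally show "list_prod (mpa Q ord q) (map (\<lambda>a. mpa_hom Q ord q (one_plus Q a) [^]\<^bsub>mpa Q ord q\<^esub> arrow_sign a)
       (ordered_list ord (arcs (double Q)))) = mpa_hom Q ord q (vertex_sum Q q)"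
    by (simp add: mpa_hom_def)
qed

lemma mpa_hom_unique:
  fixes R :: "('k, 'r, 'm) module_scheme"
  assumes R: "k_algebra R" and g: "g \<in> alg_hom (mpa Q ord q) R" and h: "h \<in> alg_hom (mpa Q ord q) R"
    and eq: "\<And>f. f \<in> carrier (path_algebra (double Q)) \<Longrightarrow> g (mpa_hom Q ord q f) = h (mpa_hom Q ord q f)"
    and x: "x \<in> carrier (mpa Q ord q)"
  shows "g x = h x"
proof -
  interpret R: k_algebra R by fact
  let ?p = "\<lambda>x. mpa_ideal Q ord q +>\<^bsub>loc_algebra Q\<^esub> x"
  note gp = alg_hom_compose[OF mpa_proj g] and hp = alg_hom_compose[OF mpa_proj h]
  have embed: "g (?p (path_embed f)) = h (?p (path_embed f))" if "f \<in> carrier (path_algebra (double Q))" for f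
    using eq[OF that] by (simp add: mpa_hom_def)
  have vert: "g (?p (vertex_elt v)) = h (?p (vertex_elt v))" if "v \<in> verts Q" for v
    using embed[of "vertex_elt v"] that vertex_elt_closed[of v "double Q"] by simp
  have gen: "g (?p y) = h (?p y)" if "y \<in> carrier (loc_algebra Q)" for y
  proof (rule path_alg_hom_eqI[OF _ R gp hp _ _ that])
    show "fin_digraph (adjoin_loops (double Q))" by unfold_locales
    show "g (?p (vertex_elt v)) = h (?p (vertex_elt v))" if "v \<in> verts (adjoin_loops (double Q))" for v
      using vert that by simp
    fix b assume b: "b \<in> arcs (adjoin_loops (double Q))"
    show "g (?p (arrow_elt (adjoin_loops (double Q)) b)) = h (?p (arrow_elt (adjoin_loops (double Q)) b))"
    proof (cases b)
      case (Inl a)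
      then show ?thesis using b embed[OF D.arrow_elt_closed[of a]] by simp
    next
      case (Inr a)
      then have a: "a \<in> arcs (double Q)" using b by simp
      let ?l = "arrow_elt (adjoin_loops (double Q)) b :: _ \<Rightarrow> 'k"
      let ?e = "vertex_elt (head (double Q) a) :: 'v \<times> (('b + 'b) + ('b + 'b)) list \<Rightarrow> 'k"
      have cl: "?l \<in> carrier (loc_algebra Q)" "?e \<in> carrier (loc_algebra Q)"
        using L.arrow_elt_closed[OF b] vertex_elt_closed[of _ "adjoin_loops (double Q)"] D.head_in_verts[OF a]
        by auto
      have w: "loc_inverse Q a = (\<one>\<^bsub>loc_algebra Q\<^esub> \<ominus>\<^bsub>loc_algebra Q\<^esub> ?e) \<oplus>\<^bsub>loc_algebra Q\<^esub> ?l"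
        by (simp add: loc_inverse_def Inr)
      have l: "?l = loc_inverse Q a \<ominus>\<^bsub>loc_algebra Q\<^esub> (\<one>\<^bsub>loc_algebra Q\<^esub> \<ominus>\<^bsub>loc_algebra Q\<^esub> ?e)"
        unfolding w using cl by (simp add: B.add_minus_cancel)
      note wi = mpa_inverse[OF a]
      have "g (?p (loc_inverse Q a)) = h (?p (loc_inverse Q a))"
      proof (rule R.inv_unique)
        show "g (?p (loc_inverse Q a)) \<otimes>\<^bsub>R\<^esub> g (mpa_hom Q ord q (one_plus Q a)) = \<one>\<^bsub>R\<^esub>"
          using wi alg_homD[OF g] by (simp flip: alg_homD(2)[OF g])
        show "g (mpa_hom Q ord q (one_plus Q a)) \<otimes>\<^bsub>R\<^esub> h (?p (loc_inverse Q a)) = \<one>\<^bsub>R\<^esub>"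
          using wi alg_homD[OF h] eq[OF one_plus_closed[OF Q a]] by (simp flip: alg_homD(2)[OF h])
      qed (use wi alg_homD(1)[OF g] alg_homD(1)[OF h] in auto)
      moreover have "g (?p ?e) = h (?p ?e)" using vert D.head_in_verts[OF a] by simp
      ultimately show ?thesis
        unfolding l using cl loc_inverse_closed[OF Q a, where 'k = 'k]
        by (simp add: alg_hom_minus[OF B.k_algebra_axioms R gp] alg_hom_minus[OF B.k_algebra_axioms R hp]
            alg_homD(4)[OF gp] alg_homD(4)[OF hp])
    qed
  qed
  obtain y where "y \<in> carrier (loc_algebra Q)" "x = ?p y"
    using x unfolding mpa_def by (rule quotient_algebra_carrierE)
  then show ?thesis using gen by simp
qed

lemma mpa_lift:
  fixes R :: "('k, 'r, 'm) module_scheme"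
  assumes R: "k_algebra R" and psi: "\<psi> \<in> alg_hom (path_algebra (double Q)) R"
    and cond: "mpa_condition Q ord q R \<psi>"
  obtains g where "g \<in> alg_hom (mpa Q ord q) R"
    "\<And>f. f \<in> carrier (path_algebra (double Q)) \<Longrightarrow> g (mpa_hom Q ord q f) = \<psi> f"
proof -
  interpret R: k_algebra R by fact
  note h = alg_homD[OF psi]
  let ?U = "\<lambda>a. \<psi> (one_plus Q a)" and ?V = "\<lambda>a. inv\<^bsub>R\<^esub> \<psi> (one_plus Q a)"
  define E where "E v = \<psi> (vertex_elt v)" for v
  define P where "P a = \<psi> (arrow_elt (double Q) a) \<otimes>\<^bsub>R\<^esub> \<psi> (arrow_elt (double Q) (rev_arrow a))" for a
  define F where "F = case_sum (\<lambda>a. \<psi> (arrow_elt (double Q) a)) (\<lambda>a. E (head (double Q) a) \<otimes>\<^bsub>R\<^esub> ?V a)"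
  have ve: "(vertex_elt v :: _ \<Rightarrow> 'k) \<in> carrier (path_algebra (double Q))" if "v \<in> verts Q" for v
    using that vertex_elt_closed[of v "double Q"] by simp
  have ar: "(arrow_elt (double Q) a :: _ \<Rightarrow> 'k) \<in> carrier (path_algebra (double Q))"
    if "a \<in> arcs (double Q)" for a
    using that by (rule D.arrow_elt_closed)
  have hv: "head (double Q) a \<in> verts Q" "tail (double Q) a \<in> verts Q" if "a \<in> arcs (double Q)" for a
    using D.head_in_verts[OF that] D.tail_in_verts[OF that] by auto
  have E_closed: "E v \<in> carrier R" if "v \<in> verts Q" for v
    unfolding E_def using ve[OF that] by (rule h)
  have head: "E (head (double Q) a) \<otimes>\<^bsub>R\<^esub> \<psi> (arrow_elt (double Q) a) = \<psi> (arrow_elt (double Q) a)"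
    if "a \<in> arcs (double Q)" for a
    unfolding E_def using that by (simp add: h(2)[symmetric] ve hv ar arrow_elt_head)
  have tail: "\<psi> (arrow_elt (double Q) a) \<otimes>\<^bsub>R\<^esub> E (tail (double Q) a) = \<psi> (arrow_elt (double Q) a)"
    if "a \<in> arcs (double Q)" for a
    unfolding E_def using that by (simp add: h(2)[symmetric] ve hv ar arrow_elt_tail)
  have E_mult: "E v \<otimes>\<^bsub>R\<^esub> E w = (if v = w then E v else \<zero>\<^bsub>R\<^esub>)" if "v \<in> verts Q" "w \<in> verts Q" for v w
    unfolding E_def using that alg_hom_zero[OF A.k_algebra_axioms R psi]
    by (simp add: h(2)[symmetric] ve vertex_elt_mult)
  have U: "?U a = \<one>\<^bsub>R\<^esub> \<oplus>\<^bsub>R\<^esub> P a" if "a \<in> arcs (double Q)" for a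
    using that by (simp add: one_plus_def P_def h ar)
  have P_closed: "P a \<in> carrier R" if "a \<in> arcs (double Q)" for a
    using that by (simp add: P_def h ar)
  have EP: "E (head (double Q) a) \<otimes>\<^bsub>R\<^esub> P a = P a" if "a \<in> arcs (double Q)" for a
    using that head[OF that] by (simp add: P_def h ar R.m_assoc[symmetric] E_closed hv)
  have PE: "P a \<otimes>\<^bsub>R\<^esub> E (head (double Q) a) = P a" if "a \<in> arcs (double Q)" for a
    using that tail[of "rev_arrow a"] by (simp add: P_def h ar R.m_assoc E_closed hv)
  have unit: "?U a \<in> Units R" if "a \<in> arcs (double Q)" for a
    using cond that by (simp add: mpa_condition_def)
  have V_closed: "?V a \<in> carrier R" and UV: "?U a \<otimes>\<^bsub>R\<^esub> ?V a = \<one>\<^bsub>R\<^esub>" and VU: "?V a \<otimes>\<^bsub>R\<^esub> ?U a = \<one>\<^bsub>R\<^esub>"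
    if "a \<in> arcs (double Q)" for a
    using unit[OF that] by auto
  have VE: "?V a \<otimes>\<^bsub>R\<^esub> E (head (double Q) a) = E (head (double Q) a) \<otimes>\<^bsub>R\<^esub> ?V a"
    if "a \<in> arcs (double Q)" for a
    using R.corner_inverse_commute[OF E_closed[OF hv(1)[OF that]] P_closed[OF that] V_closed[OF that]
        EP[OF that] PE[OF that]] UV[OF that] VU[OF that] U[OF that] by simp
  interpret Th: path_eval R "adjoin_loops (double Q)" E F
  proof
    show "E v \<in> carrier R" if "v \<in> verts (adjoin_loops (double Q))" for v
      using that E_closed by simp
    show "E v \<otimes>\<^bsub>R\<^esub> E w = (if v = w then E v else \<zero>\<^bsub>R\<^esub>)"
      if "v \<in> verts (adjoin_loops (double Q))" "w \<in> verts (adjoin_loops (double Q))" for v w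
      using that E_mult by simp
    show "finsum R E (verts (adjoin_loops (double Q))) = \<one>\<^bsub>R\<^esub>"
      using R.path_evalI[OF D.fin_digraph_axioms psi] by (simp add: E_def[abs_def])
    fix b assume b: "b \<in> arcs (adjoin_loops (double Q))"
    show "F b \<in> carrier R"
      using b by (cases b) (auto simp: F_def h ar E_closed V_closed hv)
    show "E (head (adjoin_loops (double Q)) b) \<otimes>\<^bsub>R\<^esub> F b = F b"
      using b by (cases b) (auto simp: F_def head R.m_assoc[symmetric] E_closed V_closed hv E_mult)
    show "F b \<otimes>\<^bsub>R\<^esub> E (tail (adjoin_loops (double Q)) b) = F b"
    proof (cases b)
      case (Inl a)
      then show ?thesis using b tail by (simp add: F_def)
    next
      case (Inr a)
      then have a: "a \<in> arcs (double Q)" using b by simp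
      note cl = E_closed[OF hv(1)[OF a]] V_closed[OF a]
      have "F b \<otimes>\<^bsub>R\<^esub> E (head (double Q) a) =
          E (head (double Q) a) \<otimes>\<^bsub>R\<^esub> (?V a \<otimes>\<^bsub>R\<^esub> E (head (double Q) a))"
        using cl by (simp add: F_def Inr R.m_assoc)
      also have "\<dots> = (E (head (double Q) a) \<otimes>\<^bsub>R\<^esub> E (head (double Q) a)) \<otimes>\<^bsub>R\<^esub> ?V a"
        using cl by (simp add: VE[OF a] R.m_assoc)
      also have "\<dots> = F b" using hv[OF a] by (simp add: E_mult F_def Inr)
      finally show ?thesis by (simp add: Inr)
    qed
  qed
  note th = Th.theta_alg_hom
  have th_vert: "Th.theta (vertex_elt v) = E v" if "v \<in> verts Q" for v
    using that Th.theta_elt'[of v "[]"] by (simp add: vertex_elt_def)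
  have th_arrow: "Th.theta (arrow_elt (adjoin_loops (double Q)) b) = F b" if "b \<in> arcs (adjoin_loops (double Q))" for b
    using that Th.theta_elt'[of "head (adjoin_loops (double Q)) b" "[b]"] Th.F_tail[OF that] L.tail_in_verts[OF that]
    by (simp add: arrow_elt_def)
  have th_embed: "Th.theta (path_embed f) = \<psi> f" if "f \<in> carrier (path_algebra (double Q))" for f
    by (rule path_alg_hom_eqI[OF D.fin_digraph_axioms R alg_hom_compose[OF path_embed_alg_hom th] psi _ _ that])
      (simp_all add: th_vert th_arrow, simp_all add: E_def F_def)
  have th_inv: "Th.theta (loc_inverse Q a) = ?V a" if a: "a \<in> arcs (double Q)" for a
  proof -
    have cl: "(vertex_elt (head (double Q) a) :: _ \<Rightarrow> 'k) \<in> carrier (loc_algebra Q)"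
      using hv[OF a] vertex_elt_closed[of _ "adjoin_loops (double Q)"] by simp
    have cl': "(arrow_elt (adjoin_loops (double Q)) (Inr a) :: _ \<Rightarrow> 'k) \<in> carrier (loc_algebra Q)"
      using a by (intro L.arrow_elt_closed) simp
    have FI: "F (Inr a) = E (head (double Q) a) \<otimes>\<^bsub>R\<^esub> ?V a" by (simp add: F_def)
    have "Th.theta (loc_inverse Q a) =
        (\<one>\<^bsub>R\<^esub> \<ominus>\<^bsub>R\<^esub> E (head (double Q) a)) \<oplus>\<^bsub>R\<^esub> E (head (double Q) a) \<otimes>\<^bsub>R\<^esub> ?V a"
      unfolding loc_inverse_def
      using a cl cl'
      by (simp add: alg_homD[OF th] alg_hom_minus[OF B.k_algebra_axioms R th] th_vert th_arrow hv FI)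
    then show ?thesis
      using R.corner_inverse[OF E_closed[OF hv(1)[OF a]] P_closed[OF a] V_closed[OF a] EP[OF a]]
        UV[OF a] U[OF a] by simp
  qed
  have Z: "x \<ominus>\<^bsub>R\<^esub> x = \<zero>\<^bsub>R\<^esub>" if "x \<in> carrier R" for x
    using that by (simp add: a_minus_def R.r_neg)
  have mul_th: "Th.theta (x \<otimes>\<^bsub>loc_algebra Q\<^esub> y \<ominus>\<^bsub>loc_algebra Q\<^esub> \<one>\<^bsub>loc_algebra Q\<^esub>) = \<zero>\<^bsub>R\<^esub>"
    if "x \<in> carrier (loc_algebra Q)" "y \<in> carrier (loc_algebra Q)" "Th.theta x \<otimes>\<^bsub>R\<^esub> Th.theta y = \<one>\<^bsub>R\<^esub>" for x y
    using that by (simp add: alg_homD[OF th] alg_hom_minus[OF B.k_algebra_axioms R th] Z)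
  have "Th.theta (list_prod (loc_algebra Q) mpa_factors) = list_prod R (map Th.theta mpa_factors)"
    by (rule alg_hom_list_prod(2)[OF B.k_algebra_axioms R th factors_closed])
  also have "\<dots> = list_prod R (map (\<lambda>a. ?U a [^]\<^bsub>R\<^esub> arrow_sign a) (ordered_list ord (arcs (double Q))))"
    unfolding map_map comp_def
  proof (rule list_prod_map_cong)
    fix a assume "a \<in> set (ordered_list ord (arcs (double Q)))"
    then have a: "a \<in> arcs (double Q)" using set_arrow_list by simp
    have "?U a \<in> carrier R" using unit[OF a] by auto
    show "Th.theta (if arrow_sign a = 1 then path_embed (one_plus Q a) else loc_inverse Q a) =
        ?U a [^]\<^bsub>R\<^esub> arrow_sign a"
    proof (cases "arrow_sign a = 1")
      case True
      then show ?thesis using \<open>?U a \<in> carrier R\<close>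
        by (simp add: int_pow_def2 th_embed[OF one_plus_closed[OF Q a]])
    next
      case False
      then have "arrow_sign a = -1" using sign_cases by blast
      then show ?thesis using \<open>?U a \<in> carrier R\<close>
        by (simp add: int_pow_def2 th_inv[OF a])
    qed
  qed
  also have "\<dots> = \<psi> (vertex_sum Q q)"
    using cond by (simp add: mpa_condition_def)
  finally have prod: "Th.theta (list_prod (loc_algebra Q) mpa_factors) = Th.theta (path_embed (vertex_sum Q q))"
    by (simp add: th_embed vertex_sum_closed[OF Q])
  have rel: "Th.theta x = \<zero>\<^bsub>R\<^esub>" if "x \<in> mpa_relations Q ord q" for x
    using that unfolding mpa_relations_def
  proof (elim UnE UN_E insertE emptyE)
    assume "x = list_prod (loc_algebra Q) mpa_factors \<ominus>\<^bsub>loc_algebra Q\<^esub> path_embed (vertex_sum Q q)"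
    then show ?thesis
      using prod list_prod_factors_closed embed_closed[OF vertex_sum_closed[OF Q, of q]]
        alg_homD(1)[OF th embed_closed[OF vertex_sum_closed[OF Q, of q]]]
      by (simp add: alg_hom_minus[OF B.k_algebra_axioms R th] Z)
  next
    fix a assume a: "a \<in> arcs (double Q)"
    note cl = embed_closed[OF one_plus_closed[OF Q a]] loc_inverse_closed[OF Q a, where 'k = 'k]
    note eq = th_embed[OF one_plus_closed[OF Q a]] th_inv[OF a] UV[OF a] VU[OF a]
    { assume "x = path_embed (one_plus Q a) \<otimes>\<^bsub>loc_algebra Q\<^esub> loc_inverse Q a \<ominus>\<^bsub>loc_algebra Q\<^esub> \<one>\<^bsub>loc_algebra Q\<^esub>"
      then show ?thesis using mul_th[OF cl] eq by simp }
    { assume "x = loc_inverse Q a \<otimes>\<^bsub>loc_algebra Q\<^esub> path_embed (one_plus Q a) \<ominus>\<^bsub>loc_algebra Q\<^esub> \<one>\<^bsub>loc_algebra Q\<^esub>"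
      then show ?thesis using mul_th[OF cl(2,1)] eq by simp }
  qed
  have TH: "ring_hom_ring (loc_algebra Q) R Th.theta"
    by (rule alg_hom_ring_hom_ring[OF B.k_algebra_axioms R th])
  have "mpa_ideal Q ord q \<subseteq> a_kernel (loc_algebra Q) R Th.theta"
    unfolding mpa_ideal_def
  proof (rule B.genideal_minimal)
    show "ideal (a_kernel (loc_algebra Q) R Th.theta) (loc_algebra Q)"
      by (rule ring_hom_ring.kernel_is_ideal[OF TH])
    show "mpa_relations Q ord q \<subseteq> a_kernel (loc_algebra Q) R Th.theta"
      unfolding a_kernel_def' using rel mpa_relations_closed by blast
  qed
  then have ker: "Th.theta x = \<zero>\<^bsub>R\<^esub>" if "x \<in> mpa_ideal Q ord q" for x
    using that unfolding a_kernel_def' by blast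
  obtain g where g: "g \<in> alg_hom (quotient_algebra (loc_algebra Q) (mpa_ideal Q ord q)) R"
    "\<And>x. x \<in> carrier (loc_algebra Q) \<Longrightarrow> g (mpa_ideal Q ord q +>\<^bsub>loc_algebra Q\<^esub> x) = Th.theta x"
    using quotient_algebra_lift[OF B.k_algebra_axioms R th mpa_ideal ker] by blast
  show thesis
  proof (rule that)
    show "g \<in> alg_hom (mpa Q ord q) R" using g(1) by (simp add: mpa_def)
    show "g (mpa_hom Q ord q f) = \<psi> f" if "f \<in> carrier (path_algebra (double Q))" for f
      using that by (simp add: mpa_hom_def g(2) embed_closed th_embed)
  qed
qed

theorem mpa_universal:
  fixes R :: "('k, 'r, 'm) module_scheme"
  shows "k_algebra (mpa Q ord q)"
    and "mpa_hom Q ord q \<in> alg_hom (path_algebra (double Q)) (mpa Q ord q)"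
    and "mpa_condition Q ord q (mpa Q ord q) (mpa_hom Q ord q)"
    and "k_algebra R \<Longrightarrow> \<psi> \<in> alg_hom (path_algebra (double Q)) R \<Longrightarrow> mpa_condition Q ord q R \<psi> \<Longrightarrow>
      \<exists>!g. g \<in> alg_hom (mpa Q ord q) R \<and> g \<in> extensional (carrier (mpa Q ord q)) \<and>
        (\<forall>f \<in> carrier (path_algebra (double Q)). g (mpa_hom Q ord q f) = \<psi> f)"
proof -
  assume R: "k_algebra R" and psi: "\<psi> \<in> alg_hom (path_algebra (double Q)) R" and "mpa_condition Q ord q R \<psi>"
  then obtain g where g: "g \<in> alg_hom (mpa Q ord q) R"
    "\<And>f. f \<in> carrier (path_algebra (double Q)) \<Longrightarrow> g (mpa_hom Q ord q f) = \<psi> f"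
    by (rule mpa_lift) blast
  let ?g = "restrict g (carrier (mpa Q ord q))"
  show "\<exists>!g. g \<in> alg_hom (mpa Q ord q) R \<and> g \<in> extensional (carrier (mpa Q ord q)) \<and>
        (\<forall>f \<in> carrier (path_algebra (double Q)). g (mpa_hom Q ord q f) = \<psi> f)"
  proof (rule ex1I[of _ ?g])
    have "?g \<in> alg_hom (mpa Q ord q) R"
      by (rule alg_homI) (simp_all add: alg_homD[OF g(1)] M.smult_closed)
    then show "?g \<in> alg_hom (mpa Q ord q) R \<and> ?g \<in> extensional (carrier (mpa Q ord q)) \<and>
        (\<forall>f \<in> carrier (path_algebra (double Q)). ?g (mpa_hom Q ord q f) = \<psi> f)"
      using g(2) alg_homD(1)[OF mpa_hom] by simp
    fix h assume h: "h \<in> alg_hom (mpa Q ord q) R \<and> h \<in> extensional (carrier (mpa Q ord q)) \<and>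
        (\<forall>f \<in> carrier (path_algebra (double Q)). h (mpa_hom Q ord q f) = \<psi> f)"
    then have "h x = g x" if "x \<in> carrier (mpa Q ord q)" for x
      using that g by (intro mpa_hom_unique[OF R, of h g x]) auto
    then show "h = ?g" using h by (auto simp: extensional_def restrict_def)
  qed
qed (fact k_algebra_mpa mpa_hom mpa_satisfies_condition)+

end

end

theory Submission
  imports Defs "HOL-Library.Function_Algebras"
begin

text \<open>The proof is by induction on the total dimension, using reflection functors in the manner of
  Crawley-Boevey and Shaw. At a vertex \<open>v\<close> the defining relation only involves the arrows with head
  \<open>v\<close>, each contributing a factor \<open>1 + a a\<^sup>*\<close> after a change of orientation, so the orders of the
  factors at different vertices are independent of each other. If \<open>\<alpha>\<close> pairs nonpositively with all
  \<open>\<epsilon>\<^sub>v\<close>, then it lies in the fundamental region, as the support of a simple module is connected.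
  Otherwise \<open>(\<alpha>, \<epsilon>\<^sub>v) > 0\<close> for some vertex \<open>v\<close>, which must be loopfree. With \<open>X'\<close> the sum of the spaces
  at the tails of the arrows into \<open>v\<close>, there are maps \<open>\<pi> : X\<^sub>v \<rightarrow> X'\<close> and \<open>\<mu> : X' \<rightarrow> X\<^sub>v\<close> with
  \<open>\<mu> \<pi> = q\<^sub>v - 1\<close>. If \<open>q\<^sub>v = 1\<close>, simplicity forces \<open>\<alpha> = \<epsilon>\<^sub>v\<close>, or else \<open>\<pi>\<close> is injective and \<open>\<mu>\<close>
  surjective, whence \<open>(\<alpha>, \<epsilon>\<^sub>v) \<le> 0\<close>. If \<open>q\<^sub>v \<noteq> 1\<close>, replacing \<open>X\<^sub>v\<close> by the kernel of \<open>\<mu>\<close> gives a simple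
  representation, for other parameters, of the smaller dimension vector \<open>s\<^sub>v \<alpha>\<close>; if all its
  endomorphisms are scalar, then so are those of \<open>X\<close>. Real roots satisfy \<open>(\<alpha>, \<alpha>) = 2\<close> and imaginary ones
  \<open>(\<alpha>, \<alpha>) \<le> 0\<close>, so for a real root the descent ends at a one-dimensional representation.\<close>

text \<open>Inverses of \<open>1 + a b\<close>, with \<open>b\<close> the reverse of the arrow
  \<open>a\<close>, are not words in the arrows, so \<open>T\<close> and \<open>R\<close> are kept
  as data beside \<open>A\<close>: a change of orientation then alters only some arrows, and the
  relation at each vertex stays as it is. The reflected arrows come from a lifting property. Since
  \<open>mu\<close> carries prefix products of the \<open>T\<close>, each arrow into
  \<open>v\<close> factors through it as \<open>A h = mu (L v) o nu h\<close>; projecting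
  \<open>nu h\<close> to the kernel of \<open>mu\<close> and multiplying by
  \<open>inverse (q v) - 1\<close> gives the new arrow, and that multiple makes the new product at
  \<open>v\<close> equal to \<open>inverse (q v)\<close>. At the far end of such an arrow
  \<open>1 + b a\<close> is multiplied by \<open>inverse (q v)\<close>, which moves the parameters
  of the neighbouring vertices; hence the induction runs over all parameters at once. The obstacle
  of a typed setting is that the kernel lives in a direct sum of spaces, while the induction needs
  it in the type it started from; the ambient space is therefore chosen with room for sums of copies
  of itself.\<close>

section \<open>Dimensions of subspaces\<close>

text \<open>Working in copies of the locales of the library keeps the new names apart from their
  instances for real vector spaces.\<close>

locale vec_space = vector_space scale for scale :: "'a::field \<Rightarrow> 'b::ab_group_add \<Rightarrow> 'b"
begin

text \<open>Also records that \<open>U\<close> is a subspace of finite dimension, which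
  \<open>dim\<close> alone does not: it is 0 on infinite-dimensional spaces.\<close>

definition has_dim :: "'b set \<Rightarrow> nat \<Rightarrow> bool" where
  "has_dim U n \<longleftrightarrow> (\<exists>B. finite B \<and> independent B \<and> span B = U \<and> card B = n)"

lemma has_dim_dim: "has_dim U n \<Longrightarrow> dim U = n"
  unfolding has_dim_def by (metis dim_span dim_eq_card_independent)

lemma has_dim_0: "has_dim {0} 0"
  unfolding has_dim_def by (rule exI[of _ "{}"]) (simp add: independent_empty)

lemma has_dim_0_iff: "has_dim U 0 \<longleftrightarrow> U = {0}"
proof
  assume "has_dim U 0"
  then obtain B where "finite B" "span B = U" "card B = 0" unfolding has_dim_def by blast
  then show "U = {0}" by (auto simp: span_empty)
qed (simp add: has_dim_0)

lemma has_dim_1: "x \<noteq> 0 \<Longrightarrow> has_dim (span {x}) 1"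
  unfolding has_dim_def by (rule exI[of _ "{x}"]) auto

lemma has_dim_subspace: "has_dim U n \<Longrightarrow> subspace U"
  unfolding has_dim_def by (auto intro: subspace_span)

lemma has_dim_finite_span:
  assumes "finite C" "span C = U"
  shows "has_dim U (dim U)"
proof -
  obtain B where B: "B \<subseteq> C" "independent B" "C \<subseteq> span B"
    using maximal_independent_subset by blast
  moreover have "finite B" using B(1) assms(1) by (rule finite_subset)
  moreover have "span B = U"
    using B assms(2) by (metis span_eq span_mono span_span span_superset subset_antisym)
  ultimately have "has_dim U (card B)" unfolding has_dim_def by blast
  then show ?thesis by (simp add: has_dim_dim)
qed

lemma has_dim_subset:
  assumes "has_dim V n" "subspace U" "U \<subseteq> V"
  obtains m where "m \<le> n" "has_dim U m"
proof -
  obtain C where C: "finite C" "independent C" "span C = V" "card C = n"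
    using assms(1) unfolding has_dim_def by blast
  obtain B where B: "B \<subseteq> U" "independent B" "U \<subseteq> span B"
    using maximal_independent_subset by blast
  have "finite B \<and> card B \<le> card C"
    using independent_span_bound[OF C(1) B(2)] B(1) assms(3) C(3) by blast
  moreover have "span B = U" using B assms(2) by (simp add: span_minimal subset_antisym)
  ultimately have "has_dim U (card B)" "card B \<le> n" using B(2) C(4) unfolding has_dim_def by blast+
  then show thesis using that by blast
qed

text \<open>If \<open>c = b + d\<close> with \<open>b\<close> in \<open>span B\<close> and
  \<open>d\<close> in \<open>span C\<close>, then \<open>b = c - d\<close> lies in both spans, so it
  vanishes and \<open>c\<close> would already be in \<open>span C\<close>.\<close>

lemma independent_Un_disjoint_spans:
  assumes "finite C" "independent B" "independent C" "span B \<inter> span C = {0}"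
  shows "independent (B \<union> C)"
  using assms(1,3,4)
proof (induction C rule: finite_induct)
  case empty
  then show ?case using assms(2) by simp
next
  case (insert c C)
  have sub: "span C \<subseteq> span (insert c C)" by (rule span_mono) auto
  have c: "c \<in> span (insert c C)" by (rule span_base) simp
  have ind: "independent C" "c \<notin> span C" using insert.prems(1) insert.hyps by (auto simp: independent_insert)
  have "span B \<inter> span C = {0}" using insert.prems(2) sub span_zero by blast
  then have IH: "independent (B \<union> C)" using insert.IH ind(1) by blast
  have "c \<notin> span (B \<union> C)"
  proof
    assume "c \<in> span (B \<union> C)"
    then obtain b d where bd: "c = b + d" "b \<in> span B" "d \<in> span C" unfolding span_Un by blast
    have "b = c - d" using bd(1) by simp
    then have "b \<in> span (insert c C)" using span_diff[OF c, of d] bd(3) sub by auto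
    then have "b = 0" using bd(2) insert.prems(2) by blast
    then show False using bd ind(2) by simp
  qed
  then show ?case using IH by (simp add: independent_insertI)
qed

lemma has_dim_sum:
  assumes U: "has_dim U m" and V: "has_dim V n" and "U \<inter> V = {0}"
  shows "has_dim {u + v |u v. u \<in> U \<and> v \<in> V} (m + n)"
proof -
  obtain B where B: "finite B" "independent B" "span B = U" "card B = m"
    using U unfolding has_dim_def by blast
  obtain C where C: "finite C" "independent C" "span C = V" "card C = n"
    using V unfolding has_dim_def by blast
  have "independent (B \<union> C)"
    using B C assms(3) by (intro independent_Un_disjoint_spans) auto
  moreover have "span (B \<union> C) = {u + v |u v. u \<in> U \<and> v \<in> V}"
    unfolding span_Un B(3) C(3) by auto
  moreover have "B \<inter> C = {}"
  proof (rule ccontr)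
    assume "B \<inter> C \<noteq> {}"
    then obtain x where "x \<in> B" "x \<in> C" by blast
    then have "x \<in> U \<inter> V" using B(3) C(3) span_base by blast
    then have "x = 0" using assms(3) by blast
    then show False using \<open>x \<in> B\<close> B(2) dependent_zero by blast
  qed
  then have "card (B \<union> C) = m + n" using B C by (simp add: card_Un_disjoint)
  ultimately show ?thesis using B(1) C(1) unfolding has_dim_def by blast
qed

lemma one_dim_scalar:
  assumes "Vector_Spaces.linear scale scale f" "x \<noteq> 0" "f x \<in> span {x}"
  obtains c where "\<And>y. y \<in> span {x} \<Longrightarrow> f y = scale c y"
proof -
  obtain c where c: "f x = scale c x" using assms(3) by (auto simp: span_singleton)
  interpret f: Vector_Spaces.linear scale scale f by fact
  have "f y = scale c y" if "y \<in> span {x}" for y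
    using that c by (auto simp: span_singleton f.scale mult.commute)
  then show thesis using that by blast
qed

end

locale vec_space_pair = vector_space_pair s1 s2
  for s1 :: "'a::field \<Rightarrow> 'b::ab_group_add \<Rightarrow> 'b" and s2 :: "'a \<Rightarrow> 'c::ab_group_add \<Rightarrow> 'c"
begin

sublocale vs1: vec_space s1 by unfold_locales
sublocale vs2: vec_space s2 by unfold_locales

lemma has_dim_image:
  assumes f: "Vector_Spaces.linear s1 s2 f" and inj: "inj_on f U" and U: "vs1.has_dim U n"
  shows "vs2.has_dim (f ` U) n"
proof -
  obtain B where B: "finite B" "vs1.independent B" "vs1.span B = U" "card B = n"
    using U unfolding vs1.has_dim_def by blast
  have "vs2.independent (f ` B)"
    using linear_independent_injective_image[OF f B(2)] inj B(3) by simp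
  moreover have "vs2.span (f ` B) = f ` U"
    using linear_span_image[OF f] B(3) by simp
  moreover have "card (f ` B) = n"
    using card_image[of f B] inj_on_subset[OF inj] B(3,4) vs1.span_superset[of B] by auto
  ultimately show ?thesis using B(1) unfolding vs2.has_dim_def by blast
qed

end

context vec_space
begin

text \<open>A linear section \<open>s\<close> of \<open>g\<close> embeds \<open>U\<close> into
  \<open>D\<close> a second time. The two copies meet only in 0, because \<open>g\<close> kills the
  image of \<open>f\<close> and inverts \<open>s\<close>; so \<open>D\<close> contains a direct sum
  of two copies of \<open>U\<close>.\<close>

lemma has_dim_complex:
  assumes f: "Vector_Spaces.linear scale scale f" and g: "Vector_Spaces.linear scale scale g"
    and U: "has_dim U n" and D: "has_dim D d"
    and fU: "f ` U \<subseteq> D" and inj: "inj_on f U" and gD: "g ` D = U"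
    and gf: "\<And>x. x \<in> U \<Longrightarrow> g (f x) = 0"
  shows "2 * n \<le> d"
proof -
  interpret P: vec_space_pair scale scale by unfold_locales
  interpret g: Vector_Spaces.linear scale scale g by fact
  have D': "subspace D" using D by (rule has_dim_subspace)
  obtain s where s: "s ` UNIV \<subseteq> D" "Vector_Spaces.linear scale scale s" "\<And>v. v \<in> U \<Longrightarrow> g (s v) = v"
    using P.linear_exists_right_inverse_on[OF g D'] gD by metis
  have "has_dim (f ` U) n" by (rule P.has_dim_image[OF f inj U])
  moreover have "has_dim (s ` U) n"
    by (rule P.has_dim_image[OF s(2) _ U]) (metis inj_onI s(3))
  moreover have "f ` U \<inter> s ` U = {0}"
  proof -
    have "0 \<in> U" using has_dim_subspace[OF U] by (rule subspace_0)
    then have "f 0 \<in> f ` U" "s 0 \<in> s ` U" by blast+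
    then have "0 \<in> f ` U \<inter> s ` U" using P.linear_0[OF s(2)] P.linear_0[OF f] by simp
    moreover have "y = 0" if y: "y \<in> f ` U" "y \<in> s ` U" for y
    proof -
      obtain a where a: "y = f a" "a \<in> U" using y(1) by (elim imageE)
      obtain b where b: "y = s b" "b \<in> U" using y(2) by (elim imageE)
      have "b = g y" using s(3)[OF b(2)] b(1) by simp
      also have "\<dots> = 0" using gf[OF a(2)] a(1) by simp
      finally show "y = 0" using b(1) P.linear_0[OF s(2)] by simp
    qed
    ultimately show ?thesis by blast
  qed
  ultimately have sum: "has_dim {u + v |u v. u \<in> f ` U \<and> v \<in> s ` U} (n + n)" (is "has_dim ?S _")
    by (rule has_dim_sum)
  have sub: "?S \<subseteq> D"
  proof clarify
    fix u v assume "u \<in> U" "v \<in> U"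
    then show "f u + s v \<in> D" using fU s(1) by (intro subspace_add[OF D']) auto
  qed
  obtain m where m: "m \<le> d" "has_dim ?S m"
    using has_dim_subset[OF D has_dim_subspace[OF sum] sub] .
  have "m = n + n" using has_dim_dim[OF m(2)] has_dim_dim[OF sum] by simp
  then show ?thesis using m(1) by simp
qed

end

section \<open>Reflections and roots\<close>

lemma coord_vec_in_lattice: "v \<in> verts Q \<Longrightarrow> coord_vec v \<in> root_lattice Q"
  by (auto simp: root_lattice_def coord_vec_def)

lemma sym_form_commute: "sym_form Q \<alpha> \<beta> = sym_form Q \<beta> \<alpha>"
  unfolding sym_form_def by (simp add: mult.commute add.commute)

lemma sym_form_diff_scaled:
  "sym_form Q (\<lambda>w. \<alpha> w - c * \<beta> w) \<gamma> = sym_form Q \<alpha> \<gamma> - c * sym_form Q \<beta> \<gamma>"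
  unfolding sym_form_def
  by (simp add: left_diff_distrib right_diff_distrib distrib_left sum_subtractf sum.distrib sum_distrib_left mult_ac)

context fin_digraph
begin

lemma finite_arcs_double: "finite (arcs (double G))"
  using fin_digraph.finite_arcs[OF fin_digraph_double] fin_digraph_axioms by blast

lemma sum_arcs_double:
  fixes f :: "'b + 'b \<Rightarrow> int"
  shows "(\<Sum>h\<in>arcs (double G). f h) = (\<Sum>a\<in>arcs G. f (Inl a) + f (Inr a))"
proof -
  have "(\<Sum>h\<in>arcs (double G). f h) = (\<Sum>h\<in>Inl ` arcs G. f h) + (\<Sum>h\<in>Inr ` arcs G. f h)"
    unfolding double_def by (simp, rule sum.union_disjoint) auto
  then show ?thesis by (simp add: sum.reindex sum.distrib)
qed

text \<open>Every arrow appears in the double with both orientations, so a loop at \<open>v\<close>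
  is counted twice. In this form the pairing compares the dimension at \<open>v\<close> with those
  at the tails of the arrows into \<open>v\<close>.\<close>

lemma sym_form_coord_vec:
  assumes "v \<in> verts G"
  shows "sym_form G \<alpha> (coord_vec v) =
    2 * \<alpha> v - (\<Sum>h | h \<in> arcs (double G) \<and> head (double G) h = v. \<alpha> (tail (double G) h))"
proof -
  have "(\<Sum>h | h \<in> arcs (double G) \<and> head (double G) h = v. \<alpha> (tail (double G) h)) =
      (\<Sum>h\<in>arcs (double G). if head (double G) h = v then \<alpha> (tail (double G) h) else 0)"
    using finite_arcs_double by (simp add: sum.If_cases Int_def)
  also have "\<dots> = (\<Sum>a\<in>arcs G. \<alpha> (head G a) * coord_vec v (tail G a) + \<alpha> (tail G a) * coord_vec v (head G a))"
    unfolding sum_arcs_double by (rule sum.cong) (auto simp: coord_vec_def)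
  finally show ?thesis
    using assms by (simp add: sym_form_def coord_vec_def if_distrib cong: if_cong)
qed

lemma sym_form_coord_vec_self:
  assumes "loopfree_vertex G v"
  shows "sym_form G (coord_vec v) (coord_vec v) = 2"
proof -
  have "tail (double G) h \<noteq> v" if "h \<in> arcs (double G)" "head (double G) h = v" for h
    using assms that by (cases h) (auto simp: loopfree_vertex_def)
  then have "(\<Sum>h | h \<in> arcs (double G) \<and> head (double G) h = v. coord_vec v (tail (double G) h)) = 0"
    by (intro sum.neutral) (auto simp: coord_vec_def)
  then show ?thesis
    using assms by (simp add: sym_form_coord_vec loopfree_vertex_def) (simp add: coord_vec_def)
qed

text \<open>Groups the arrows of the double by their heads. On the fundamental region every summand
  is then visibly at most 0.\<close>

lemma sym_form_self:
  "sym_form G \<alpha> \<alpha> = (\<Sum>v\<in>verts G. \<alpha> v * sym_form G \<alpha> (coord_vec v))"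
proof -
  let ?H = "arcs (double G)" and ?h = "head (double G)" and ?t = "tail (double G)"
  have "(\<Sum>v\<in>verts G. \<alpha> v * sym_form G \<alpha> (coord_vec v)) =
      2 * (\<Sum>v\<in>verts G. \<alpha> v * \<alpha> v) - (\<Sum>v\<in>verts G. \<Sum>h | h \<in> ?H \<and> ?h h = v. \<alpha> (?h h) * \<alpha> (?t h))"
    by (simp add: sym_form_coord_vec right_diff_distrib sum_subtractf sum_distrib_left mult_ac)
  also have "(\<Sum>v\<in>verts G. \<Sum>h | h \<in> ?H \<and> ?h h = v. \<alpha> (?h h) * \<alpha> (?t h)) = (\<Sum>h\<in>?H. \<alpha> (?h h) * \<alpha> (?t h))"
  proof (rule sum.group[OF finite_arcs_double])
    show "?h ` ?H \<subseteq> verts G"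
    proof (clarify)
      fix h assume "h \<in> ?H"
      then show "?h h \<in> verts G" by (cases h) auto
    qed
  qed simp
  also have "\<dots> = (\<Sum>a\<in>arcs G. \<alpha> (head G a) * \<alpha> (tail G a) + \<alpha> (tail G a) * \<alpha> (head G a))"
    by (rule trans[OF sum_arcs_double]) simp
  finally show ?thesis by (simp add: sym_form_def)
qed

section \<open>Reflections, the Weyl group, and the value of the form on roots\<close>

lemma reflection_closed:
  assumes "v \<in> verts G" "\<alpha> \<in> root_lattice G"
  shows "reflection G v \<alpha> \<in> root_lattice G"
  using assms by (auto simp: reflection_def root_lattice_def coord_vec_def)

lemma reflection_apply:
  "\<alpha> \<in> root_lattice G \<Longrightarrow> reflection G v \<alpha> = (\<lambda>w. \<alpha> w - sym_form G \<alpha> (coord_vec v) * coord_vec v w)"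
  by (simp add: reflection_def)

lemma sym_form_reflection_coord_vec:
  assumes "loopfree_vertex G v" "\<alpha> \<in> root_lattice G"
  shows "sym_form G (reflection G v \<alpha>) (coord_vec v) = - sym_form G \<alpha> (coord_vec v)"
  using assms by (simp add: reflection_apply sym_form_diff_scaled sym_form_coord_vec_self)

lemma reflection_involutive:
  assumes v: "loopfree_vertex G v" and a: "\<alpha> \<in> root_lattice G"
  shows "reflection G v (reflection G v \<alpha>) = \<alpha>"
proof -
  have "reflection G v \<alpha> \<in> root_lattice G"
    using v a by (intro reflection_closed) (auto simp: loopfree_vertex_def)
  then show ?thesis
    using sym_form_reflection_coord_vec[OF v a] a by (simp add: reflection_apply)
qed

lemma sym_form_reflection:
  assumes v: "loopfree_vertex G v" and a: "\<alpha> \<in> root_lattice G"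
  shows "sym_form G (reflection G v \<alpha>) (reflection G v \<alpha>) = sym_form G \<alpha> \<alpha>"
proof -
  let ?s = "sym_form G" and ?\<beta> = "reflection G v \<alpha>"
  have "?s ?\<beta> ?\<beta> = ?s \<alpha> ?\<beta> - ?s \<alpha> (coord_vec v) * ?s (coord_vec v) ?\<beta>"
    using a by (subst (1) reflection_apply) (simp_all add: sym_form_diff_scaled)
  also have "?s \<alpha> ?\<beta> = ?s \<alpha> \<alpha> - ?s \<alpha> (coord_vec v) * ?s (coord_vec v) \<alpha>"
    using a by (subst sym_form_commute) (simp add: reflection_apply sym_form_diff_scaled)
  also have "?s (coord_vec v) ?\<beta> = - ?s \<alpha> (coord_vec v)"
    by (subst sym_form_commute) (rule sym_form_reflection_coord_vec[OF v a])
  finally show ?thesis by (simp add: sym_form_commute[of G "coord_vec v"])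
qed

lemma reflection_in_BijGroup:
  assumes "loopfree_vertex G v"
  shows "reflection G v \<in> carrier (BijGroup (root_lattice G))"
proof -
  have "bij_betw (reflection G v) (root_lattice G) (root_lattice G)"
    using assms reflection_involutive
    by (intro bij_betw_byWitness[where f' = "reflection G v"])
      (auto simp: loopfree_vertex_def intro: reflection_closed)
  then show ?thesis
    by (simp add: BijGroup_def Bij_def reflection_def)
qed

lemma BijGroup_mult_apply:
  assumes "f \<in> carrier (BijGroup S)" "g \<in> carrier (BijGroup S)" "x \<in> S"
  shows "(f \<otimes>\<^bsub>BijGroup S\<^esub> g) x = f (g x)"
  using assms by (simp add: BijGroup_def compose_def)

lemma inv_reflection:
  assumes v: "loopfree_vertex G v"
  shows "inv\<^bsub>BijGroup (root_lattice G)\<^esub> (reflection G v) = reflection G v"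
proof -
  let ?B = "BijGroup (root_lattice G)"
  have "reflection G v \<otimes>\<^bsub>?B\<^esub> reflection G v = \<one>\<^bsub>?B\<^esub>"
    using reflection_in_BijGroup[OF v] reflection_involutive[OF v]
    by (auto simp: BijGroup_def compose_def restrict_def)
  then show ?thesis
    using group.inv_equality[OF group_BijGroup] reflection_in_BijGroup[OF v] by blast
qed

lemma weyl_group_subset: "weyl_group G \<subseteq> carrier (BijGroup (root_lattice G))"
  unfolding weyl_group_def
  by (rule group.generate_incl[OF group_BijGroup]) (auto intro: reflection_in_BijGroup)

lemma reflection_in_weyl_group: "loopfree_vertex G v \<Longrightarrow> reflection G v \<in> weyl_group G"
  unfolding weyl_group_def by (rule generate.incl) simp

lemma id_in_weyl_group: "(\<lambda>x\<in>root_lattice G. x) \<in> weyl_group G"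
  using generate.one[of "BijGroup (root_lattice G)"] by (simp add: weyl_group_def BijGroup_def)

text \<open>Invariance is checked on the generators; as reflections are involutions, their inverses
  require no separate computation.\<close>

lemma weyl_group_apply:
  assumes "w \<in> weyl_group G" "\<alpha> \<in> root_lattice G"
  shows "w \<alpha> \<in> root_lattice G \<and> sym_form G (w \<alpha>) (w \<alpha>) = sym_form G \<alpha> \<alpha>"
  using assms unfolding weyl_group_def
proof (induction w arbitrary: \<alpha> rule: generate.induct)
  case one
  then show ?case by (simp add: BijGroup_def)
next
  case (incl h)
  then show ?case using reflection_closed sym_form_reflection by (auto simp: loopfree_vertex_def)
next
  case (inv h)
  then obtain v where v: "h = reflection G v" "loopfree_vertex G v" by blast
  show ?case unfolding v(1) inv_reflection[OF v(2)]
    using v(2) inv.prems reflection_closed sym_form_reflection by (auto simp: loopfree_vertex_def)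
next
  case (eng h1 h2)
  have "h1 \<in> carrier (BijGroup (root_lattice G))" "h2 \<in> carrier (BijGroup (root_lattice G))"
    using eng.hyps weyl_group_subset unfolding weyl_group_def by blast+
  then show ?case using eng by (simp add: BijGroup_mult_apply)
qed

lemma real_root_coord_vec:
  assumes "loopfree_vertex G v"
  shows "real_root G (coord_vec v)"
  unfolding real_root_def using id_in_weyl_group assms coord_vec_in_lattice[of v G]
  by (intro bexI[of _ "\<lambda>x\<in>root_lattice G. x"] exI[of _ v]) (auto simp: loopfree_vertex_def)

lemma real_root_reflection:
  assumes "real_root G \<alpha>" and v: "loopfree_vertex G v"
  shows "real_root G (reflection G v \<alpha>)"
proof -
  obtain w u where w: "w \<in> weyl_group G" "loopfree_vertex G u" "\<alpha> = w (coord_vec u)"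
    using assms(1) by (auto simp: real_root_def)
  let ?w = "reflection G v \<otimes>\<^bsub>BijGroup (root_lattice G)\<^esub> w"
  have "?w \<in> weyl_group G"
    using w(1) reflection_in_weyl_group[OF v] unfolding weyl_group_def by (intro generate.eng)
  moreover have "?w (coord_vec u) = reflection G v \<alpha>"
    using w reflection_in_BijGroup[OF v] weyl_group_subset coord_vec_in_lattice[of u G]
    by (subst BijGroup_mult_apply) (auto simp: loopfree_vertex_def)
  ultimately show ?thesis using w(2) unfolding real_root_def by metis
qed

lemma sym_form_real_root: "real_root G \<alpha> \<Longrightarrow> sym_form G \<alpha> \<alpha> = 2"
  using weyl_group_apply coord_vec_in_lattice sym_form_coord_vec_self
  unfolding real_root_def loopfree_vertex_def by metis

text \<open>Membership in the lattice is carried along because the elements of the Weyl group are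
  controlled only there.\<close>

lemma sym_form_imaginary_root:
  assumes "imaginary_root G \<alpha>"
  shows "\<alpha> \<in> root_lattice G \<and> sym_form G \<alpha> \<alpha> \<le> 0"
  using assms
proof (induction rule: imaginary_root.induct)
  case (fundamental \<alpha>)
  then have "\<alpha> v * sym_form G \<alpha> (coord_vec v) \<le> 0" if "v \<in> verts G" for v
    using that by (auto simp: fundamental_region_def intro: mult_nonneg_nonpos)
  then show ?case using fundamental
    by (auto simp: sym_form_self fundamental_region_def intro: sum_nonpos)
next
  case (weyl \<alpha> w)
  then show ?case using weyl_group_apply by simp
next
  case (uminus \<alpha>)
  then show ?case by (simp add: root_lattice_def sym_form_def)
qed

end

section \<open>Representations\<close>

lemma rev_arrow_rev_arrow [simp]: "rev_arrow (rev_arrow a) = a"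
  by (cases a) auto

context vec_space
begin

abbreviation lin :: "('b \<Rightarrow> 'b) \<Rightarrow> bool" where
  "lin \<equiv> Vector_Spaces.linear scale scale"

lemma linI: "(\<And>x y. f (x + y) = f x + f y) \<Longrightarrow> (\<And>c x. f (scale c x) = scale c (f x)) \<Longrightarrow> lin f"
  unfolding Vector_Spaces.linear_iff using vector_space_axioms by blast

lemma lin_simps:
  assumes "lin f"
  shows "f (x + y) = f x + f y" "f (scale c x) = scale c (f x)" "f 0 = 0" "f (x - y) = f x - f y"
    "f (- x) = - f x" "f (sum g I) = (\<Sum>i\<in>I. f (g i))"
proof -
  interpret f: Vector_Spaces.linear scale scale f by fact
  show "f (x + y) = f x + f y" "f (scale c x) = scale c (f x)" "f 0 = 0" "f (x - y) = f x - f y"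
    "f (- x) = - f x" "f (sum g I) = (\<Sum>i\<in>I. f (g i))"
    by (simp_all add: f.add f.scale f.diff f.neg f.sum)
qed

lemma lin_intros:
  "lin f \<Longrightarrow> lin g \<Longrightarrow> lin (\<lambda>x. f x + g x)"
  "lin f \<Longrightarrow> lin g \<Longrightarrow> lin (\<lambda>x. f x - g x)"
  "lin f \<Longrightarrow> lin (\<lambda>x. - f x)"
  "lin f \<Longrightarrow> lin (\<lambda>x. scale c (f x))"
  "(\<And>i. i \<in> I \<Longrightarrow> lin (\<phi> i)) \<Longrightarrow> lin (\<lambda>x. \<Sum>i\<in>I. \<phi> i x)"
  "lin (\<lambda>x. x)"
  "lin (\<lambda>x. 0)"
  by (auto intro!: linI simp: lin_simps scale_right_distrib scale_right_diff_distrib scale_left_commute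
      sum.distrib scale_sum_right)

lemma lin_compose: "lin f \<Longrightarrow> lin g \<Longrightarrow> lin (\<lambda>x. f (g x))"
  by (auto intro!: linI simp: lin_simps)

end

text \<open>A representation consists of subspaces \<open>S v\<close> of one ambient space, of the maps \<open>A h\<close> of the
  arrows of the double, and of the automorphisms \<open>T h\<close> (with inverse \<open>R h\<close>) at their heads that stand
  for \<open>(1 + a a\<^sup>*)\<^bsup>\<epsilon>(a)\<^esup>\<close>. All maps are defined and linear on the ambient space, but satisfy the
  relations only on the subspaces. The orientation \<open>pos\<close> and the order \<open>L v\<close> of the factors at each
  vertex are arbitrary.\<close>

locale mult_rep = vec_space scale + fin_digraph Q
  for scale :: "'k::field \<Rightarrow> 'w::ab_group_add \<Rightarrow> 'w" and Q :: "('v, 'b) pre_digraph" +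
  fixes pos :: "('b + 'b) set" and L :: "'v \<Rightarrow> ('b + 'b) list" and q :: "'v \<Rightarrow> 'k"
    and S :: "'v \<Rightarrow> 'w set" and A T R :: "'b + 'b \<Rightarrow> 'w \<Rightarrow> 'w"
  assumes pos: "h \<in> arcs (double Q) \<Longrightarrow> h \<in> pos \<longleftrightarrow> rev_arrow h \<notin> pos"
    and set_L: "v \<in> verts Q \<Longrightarrow> set (L v) = {h \<in> arcs (double Q). head (double Q) h = v}"
    and distinct_L: "v \<in> verts Q \<Longrightarrow> distinct (L v)"
    and q_nonzero: "v \<in> verts Q \<Longrightarrow> q v \<noteq> 0"
    and S_dim: "v \<in> verts Q \<Longrightarrow> \<exists>n. has_dim (S v) n"
    and lin_A: "h \<in> arcs (double Q) \<Longrightarrow> lin (A h)"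
    and lin_T: "h \<in> arcs (double Q) \<Longrightarrow> lin (T h)"
    and lin_R: "h \<in> arcs (double Q) \<Longrightarrow> lin (R h)"
    and A_in: "h \<in> arcs (double Q) \<Longrightarrow> x \<in> S (tail (double Q) h) \<Longrightarrow> A h x \<in> S (head (double Q) h)"
    and T_in: "h \<in> arcs (double Q) \<Longrightarrow> x \<in> S (head (double Q) h) \<Longrightarrow> T h x \<in> S (head (double Q) h)"
    and R_in: "h \<in> arcs (double Q) \<Longrightarrow> x \<in> S (head (double Q) h) \<Longrightarrow> R h x \<in> S (head (double Q) h)"
    and TR: "h \<in> arcs (double Q) \<Longrightarrow> x \<in> S (head (double Q) h) \<Longrightarrow> T h (R h x) = x"
    and RT: "h \<in> arcs (double Q) \<Longrightarrow> x \<in> S (head (double Q) h) \<Longrightarrow> R h (T h x) = x"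
    and T_pos: "h \<in> arcs (double Q) \<Longrightarrow> h \<in> pos \<Longrightarrow> x \<in> S (head (double Q) h) \<Longrightarrow>
      T h x = x + A h (A (rev_arrow h) x)"
    and R_neg: "h \<in> arcs (double Q) \<Longrightarrow> h \<notin> pos \<Longrightarrow> x \<in> S (head (double Q) h) \<Longrightarrow>
      R h x = x + A h (A (rev_arrow h) x)"
    and rel: "v \<in> verts Q \<Longrightarrow> x \<in> S v \<Longrightarrow> foldr T (L v) x = scale (q v) x"

text \<open>Stability under both \<open>T\<close> and \<open>R\<close> is demanded outright:
  inverses then need no dimension count, and the old arrows can be recovered from the new ones after
  a change of orientation or a reflection.\<close>

definition rep_stable ::
  "('v, 'b) pre_digraph \<Rightarrow> ('k::field \<Rightarrow> 'w::ab_group_add \<Rightarrow> 'w) \<Rightarrow> ('v \<Rightarrow> 'w set) \<Rightarrow> ('b + 'b \<Rightarrow> 'w \<Rightarrow> 'w) \<Rightarrow>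
    ('b + 'b \<Rightarrow> 'w \<Rightarrow> 'w) \<Rightarrow> ('b + 'b \<Rightarrow> 'w \<Rightarrow> 'w) \<Rightarrow> ('v \<Rightarrow> 'w set) \<Rightarrow> bool" where
  "rep_stable Q scale S A T R Y \<longleftrightarrow>
     (\<forall>v\<in>verts Q. Modules.module.subspace scale (Y v) \<and> Y v \<subseteq> S v) \<and>
     (\<forall>h\<in>arcs (double Q). (\<forall>x\<in>Y (tail (double Q) h). A h x \<in> Y (head (double Q) h)) \<and>
        (\<forall>x\<in>Y (head (double Q) h). T h x \<in> Y (head (double Q) h) \<and> R h x \<in> Y (head (double Q) h)))"

definition rep_simple ::
  "('v, 'b) pre_digraph \<Rightarrow> ('k::field \<Rightarrow> 'w::ab_group_add \<Rightarrow> 'w) \<Rightarrow> ('v \<Rightarrow> 'w set) \<Rightarrow> ('b + 'b \<Rightarrow> 'w \<Rightarrow> 'w) \<Rightarrow>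
    ('b + 'b \<Rightarrow> 'w \<Rightarrow> 'w) \<Rightarrow> ('b + 'b \<Rightarrow> 'w \<Rightarrow> 'w) \<Rightarrow> bool" where
  "rep_simple Q scale S A T R \<longleftrightarrow> (\<exists>v\<in>verts Q. S v \<noteq> {0}) \<and>
     (\<forall>Y. rep_stable Q scale S A T R Y \<longrightarrow> (\<forall>v\<in>verts Q. Y v = {0}) \<or> (\<forall>v\<in>verts Q. Y v = S v))"

definition rep_endo ::
  "('v, 'b) pre_digraph \<Rightarrow> ('k::field \<Rightarrow> 'w::ab_group_add \<Rightarrow> 'w) \<Rightarrow> ('v \<Rightarrow> 'w set) \<Rightarrow> ('b + 'b \<Rightarrow> 'w \<Rightarrow> 'w) \<Rightarrow>
    ('v \<Rightarrow> 'w \<Rightarrow> 'w) \<Rightarrow> bool" where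
  "rep_endo Q scale S A \<phi> \<longleftrightarrow>
     (\<forall>v\<in>verts Q. Vector_Spaces.linear scale scale (\<phi> v) \<and> \<phi> v ` S v \<subseteq> S v) \<and>
     (\<forall>h\<in>arcs (double Q). \<forall>x\<in>S (tail (double Q) h).
        \<phi> (head (double Q) h) (A h x) = A h (\<phi> (tail (double Q) h) x))"

text \<open>The maps of an endomorphism are defined on the whole ambient space but constrained only
  on the subspaces \<open>S v\<close>, so being a scalar is asserted only there.\<close>

definition rep_brick ::
  "('v, 'b) pre_digraph \<Rightarrow> ('k::field \<Rightarrow> 'w::ab_group_add \<Rightarrow> 'w) \<Rightarrow> ('v \<Rightarrow> 'w set) \<Rightarrow> ('b + 'b \<Rightarrow> 'w \<Rightarrow> 'w) \<Rightarrow> bool" where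
  "rep_brick Q scale S A \<longleftrightarrow>
     (\<forall>\<phi>. rep_endo Q scale S A \<phi> \<longrightarrow> (\<exists>c. \<forall>v\<in>verts Q. \<forall>x\<in>S v. \<phi> v x = scale c x))"

context mult_rep
begin

lemma head_tail_verts [simp]:
  "h \<in> arcs (double Q) \<Longrightarrow> head (double Q) h \<in> verts Q"
  "h \<in> arcs (double Q) \<Longrightarrow> tail (double Q) h \<in> verts Q"
  by (cases h; simp)+

lemma S_subspace: "v \<in> verts Q \<Longrightarrow> subspace (S v)"
  using S_dim has_dim_subspace by blast

lemma S_closed:
  assumes "v \<in> verts Q"
  shows "0 \<in> S v" "x \<in> S v \<Longrightarrow> y \<in> S v \<Longrightarrow> x + y \<in> S v" "x \<in> S v \<Longrightarrow> y \<in> S v \<Longrightarrow> x - y \<in> S v"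
    "x \<in> S v \<Longrightarrow> - x \<in> S v" "x \<in> S v \<Longrightarrow> scale c x \<in> S v"
  using S_subspace[OF assms] by (auto intro: subspace_0 subspace_add subspace_diff subspace_neg subspace_scale)

lemma A_rev_in:
  "h \<in> arcs (double Q) \<Longrightarrow> x \<in> S (head (double Q) h) \<Longrightarrow> A (rev_arrow h) x \<in> S (tail (double Q) h)"
  using A_in[of "rev_arrow h" x] by simp

lemma R_rev:
  assumes "h \<in> arcs (double Q)" "h \<in> pos" "x \<in> S (tail (double Q) h)"
  shows "R (rev_arrow h) x = x + A (rev_arrow h) (A h x)"
  using R_neg[of "rev_arrow h" x] assms pos[of h] by simp

text \<open>\<open>(1 + a b)\<^sup>-\<^sup>1 = 1 - a (1 + b a)\<^sup>-\<^sup>1 b\<close>\<close>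

lemma R_pos:
  assumes h: "h \<in> arcs (double Q)" "h \<in> pos" and x: "x \<in> S (head (double Q) h)"
  shows "R h x = x - A h (T (rev_arrow h) (A (rev_arrow h) x))"
proof -
  let ?z = "R h x" and ?b = "A (rev_arrow h)"
  have z: "?z \<in> S (head (double Q) h)" and bz: "?b ?z \<in> S (tail (double Q) h)"
    using R_in A_rev_in h x by auto
  have xz: "x = ?z + A h (?b ?z)" using TR[OF h(1) x] T_pos[OF h z] by simp
  \<comment> \<open>Applying the reverse arrow \<open>b\<close> to \<open>x = z + a b z\<close>
    gives \<open>b x = (1 + b a) (b z)\<close>, and \<open>T (rev_arrow h)\<close> inverts the
    factor \<open>1 + b a\<close>.\<close>
  then have "?b x = ?b ?z + ?b (A h (?b ?z))"
    using h by (metis lin_A lin_simps(1) rev_arrow_simps(1))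
  also have "\<dots> = R (rev_arrow h) (?b ?z)" using R_rev[OF h bz] by simp
  finally have "T (rev_arrow h) (?b x) = ?b ?z" using TR[of "rev_arrow h" "?b ?z"] h(1) bz by simp
  then show ?thesis using xz by (metis add_diff_cancel_right')
qed

text \<open>Either \<open>T h\<close> or its inverse \<open>R h\<close> is 1 plus a composite of two
  arrows, so it commutes with every endomorphism; in the second case the commutation passes to the
  inverse.\<close>

lemma endo_T:
  assumes endo: "rep_endo Q scale S A \<phi>" and h: "h \<in> arcs (double Q)" and x: "x \<in> S (head (double Q) h)"
  shows "\<phi> (head (double Q) h) (T h x) = T h (\<phi> (head (double Q) h) x)"
proof -
  let ?v = "head (double Q) h"
  have lin: "lin (\<phi> ?v)" using endo h by (simp add: rep_endo_def)
  have mem: "\<phi> ?v y \<in> S ?v" if "y \<in> S ?v" for y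
    using endo h that unfolding rep_endo_def by (meson head_tail_verts(1) image_subset_iff)
  have comm: "\<phi> ?v (A h (A (rev_arrow h) y)) = A h (A (rev_arrow h) (\<phi> ?v y))" if y: "y \<in> S ?v" for y
  proof -
    have "\<phi> ?v (A h (A (rev_arrow h) y)) = A h (\<phi> (tail (double Q) h) (A (rev_arrow h) y))"
      using endo h A_rev_in[OF h y] unfolding rep_endo_def by blast
    also have "\<phi> (tail (double Q) h) (A (rev_arrow h) y) = A (rev_arrow h) (\<phi> ?v y)"
      using endo h y unfolding rep_endo_def by (metis rev_arrow_simps)
    finally show ?thesis .
  qed
  show ?thesis
  proof (cases "h \<in> pos")
    case True
    then show ?thesis using T_pos[OF h] x mem comm lin_simps(1)[OF lin] by simp
  next
    case False
    have *: "\<phi> ?v (R h y) = R h (\<phi> ?v y)" if "y \<in> S ?v" for y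
      using R_neg[OF h False] that mem comm lin_simps(1)[OF lin] by simp
    have "\<phi> ?v x = R h (\<phi> ?v (T h x))" using *[OF T_in[OF h x]] RT[OF h x] by simp
    then show ?thesis using TR[OF h mem[OF T_in[OF h x]]] by simp
  qed
qed

subsection \<open>Change of orientation\<close>

text \<open>Replaces \<open>a\<^sup>*\<close> by \<open>- a\<^sup>* (1 + a a\<^sup>*)\<^sup>-\<^sup>1\<close>, which inverts both \<open>1 + a a\<^sup>*\<close> and \<open>1 + a\<^sup>* a\<close>.\<close>

lemma reorient:
  assumes v: "loopfree_vertex Q v"
  obtains pos' A' where "mult_rep scale Q pos' L q S A' T R"
    "\<And>h. h \<in> arcs (double Q) \<Longrightarrow> head (double Q) h = v \<Longrightarrow> h \<in> pos'"
    "rep_simple Q scale S A T R \<Longrightarrow> rep_simple Q scale S A' T R"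
    "rep_brick Q scale S A' \<Longrightarrow> rep_brick Q scale S A"
proof
  let ?H = "arcs (double Q)"
  define F where "F = {h \<in> ?H. head (double Q) h = v}"
  define pos' where "pos' = pos \<union> F - rev_arrow ` F"
  \<comment> \<open>The arrows out of \<open>v\<close> whose reverse is still negative; only these
    receive new maps. As \<open>v\<close> carries no loop, an arrow and its reverse are never both
    changed.\<close>
  define C where "C k \<longleftrightarrow> rev_arrow k \<in> F \<and> rev_arrow k \<notin> pos" for k
  define A' where "A' k = (if C k then (\<lambda>x. - A k (T (rev_arrow k) x)) else A k)" for k
  have loop: "tail (double Q) h \<noteq> v" if "h \<in> F" for h
    using v that unfolding F_def loopfree_vertex_def by (cases h) auto
  have F_rev: "rev_arrow h \<notin> F" if "h \<in> F" for h
    using loop[OF that] that by (auto simp: F_def)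
  have rev_F: "h \<in> rev_arrow ` F \<longleftrightarrow> rev_arrow h \<in> F" for h
    by (metis image_iff rev_arrow_rev_arrow)
  have FH: "h \<in> ?H" if "h \<in> F" for h using that by (simp add: F_def)
  show "h \<in> pos'" if "h \<in> ?H" "head (double Q) h = v" for h
    using that F_rev[of h] by (auto simp: pos'_def rev_F F_def)
  show rep': "mult_rep scale Q pos' L q S A' T R"
  proof (intro mult_rep.intro mult_rep_axioms.intro vec_space_axioms fin_digraph_axioms;
      (fact set_L distinct_L q_nonzero S_dim lin_T lin_R T_in R_in TR RT rel)?)
    fix h x assume h: "h \<in> ?H"
    show "h \<in> pos' \<longleftrightarrow> rev_arrow h \<notin> pos'"
      using pos[OF h] F_rev[of h] F_rev[of "rev_arrow h"] by (auto simp: pos'_def rev_F)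
    show "lin (A' h)"
      using h lin_intros(3)[OF lin_compose[OF lin_A lin_T]] lin_A by (simp add: A'_def)
    show "A' h x \<in> S (head (double Q) h)" if "x \<in> S (tail (double Q) h)"
      using h that T_in[of "rev_arrow h" x] unfolding A'_def by (auto intro!: S_closed A_in)
    assume x: "x \<in> S (head (double Q) h)"
    let ?b = "A (rev_arrow h)"
    show "T h x = x + A' h (A' (rev_arrow h) x)" if hp: "h \<in> pos'"
    proof (cases "h \<in> F \<and> h \<notin> pos")
      case True
      then have A': "A' h = A h" "A' (rev_arrow h) = (\<lambda>x. - ?b (T h x))"
        using F_rev[of h] by (auto simp: A'_def C_def)
      \<comment> \<open>Here \<open>R h\<close> was \<open>1 + a b\<close>. Evaluated at
        \<open>T h x\<close> this can be solved for \<open>T h x\<close>, and the solution is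
        \<open>1 + a b'\<close> with the new reverse map \<open>b' = - b (T h)\<close>.\<close>
      have "x = T h x + A h (?b (T h x))"
        using R_neg[OF h _ T_in[OF h x]] True RT[OF h x] by simp
      then show ?thesis using A' lin_simps(5)[OF lin_A[OF h]] by (simp add: algebra_simps)
    next
      case False
      then have "h \<in> pos" "A' h = A h" "A' (rev_arrow h) = ?b"
        using hp by (auto simp: A'_def C_def pos'_def rev_F)
      then show ?thesis using T_pos h x by simp
    qed
    show "R h x = x + A' h (A' (rev_arrow h) x)" if hp: "h \<notin> pos'"
    proof (cases "C h")
      case True
      then have "h \<in> pos" using pos[OF h] by (auto simp: C_def)
      moreover have "A' h = (\<lambda>x. - A h (T (rev_arrow h) x))" "A' (rev_arrow h) = ?b"
        using True F_rev[of "rev_arrow h"] by (auto simp: A'_def C_def)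
      \<comment> \<open>The new arrow is defined so that the inverse formula \<open>R_pos\<close>
        reads as the relation of a negative arrow.\<close>
      ultimately show ?thesis using R_pos[OF h _ x] by simp
    next
      case False
      then have "h \<notin> pos" using hp pos[OF h] by (auto simp: C_def pos'_def rev_F)
      moreover have "A' h = A h" "A' (rev_arrow h) = ?b"
        using False hp F_rev[of h] by (auto simp: A'_def C_def pos'_def rev_F)
      ultimately show ?thesis using R_neg h x by simp
    qed
  qed
  show "rep_simple Q scale S A' T R" if simple: "rep_simple Q scale S A T R"
  proof -
    have "rep_stable Q scale S A T R Y" if Y: "rep_stable Q scale S A' T R Y" for Y
    proof -
      have "A h x \<in> Y (head (double Q) h)" if h: "h \<in> ?H" and x: "x \<in> Y (tail (double Q) h)" for h x
      proof (cases "C h")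
        case True
        \<comment> \<open>The new arrow is the old one after \<open>T (rev_arrow h)\<close>, up to
          sign; stability under \<open>R\<close> undoes that factor.\<close>
        have Rx: "R (rev_arrow h) x \<in> Y (tail (double Q) h)"
          using Y h x unfolding rep_stable_def by (metis rev_arrow_simps)
        have "x \<in> S (tail (double Q) h)" using Y h x unfolding rep_stable_def by auto
        then have "A h x = - A' h (R (rev_arrow h) x)"
          using True TR[of "rev_arrow h" x] h by (simp add: A'_def)
        moreover have "A' h (R (rev_arrow h) x) \<in> Y (head (double Q) h)"
          using Y h Rx unfolding rep_stable_def by blast
        moreover have "subspace (Y (head (double Q) h))" using Y h unfolding rep_stable_def by simp
        ultimately show ?thesis by (simp add: subspace_neg)
      next
        case False
        then show ?thesis using Y h x unfolding rep_stable_def by (metis A'_def)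
      qed
      then show ?thesis using Y unfolding rep_stable_def by blast
    qed
    then show ?thesis using simple unfolding rep_simple_def by blast
  qed
  show "rep_brick Q scale S A" if brick: "rep_brick Q scale S A'"
  proof -
    have "rep_endo Q scale S A' \<phi>" if endo: "rep_endo Q scale S A \<phi>" for \<phi>
    proof -
      have "\<phi> (head (double Q) h) (A' h x) = A' h (\<phi> (tail (double Q) h) x)"
        if h: "h \<in> ?H" and x: "x \<in> S (tail (double Q) h)" for h x
      proof (cases "C h")
        case True
        have "\<phi> (tail (double Q) h) (T (rev_arrow h) x) = T (rev_arrow h) (\<phi> (tail (double Q) h) x)"
          using endo_T[OF endo, of "rev_arrow h" x] h x by simp
        moreover have "T (rev_arrow h) x \<in> S (tail (double Q) h)"
          using T_in[of "rev_arrow h" x] h x by simp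
        then have "\<phi> (head (double Q) h) (A h (T (rev_arrow h) x)) = A h (\<phi> (tail (double Q) h) (T (rev_arrow h) x))"
          using endo h unfolding rep_endo_def by blast
        moreover have "lin (\<phi> (head (double Q) h))" using endo h unfolding rep_endo_def by simp
        ultimately show ?thesis using True by (simp add: A'_def lin_simps(5))
      next
        case False
        then show ?thesis using endo h x unfolding rep_endo_def A'_def by simp
      qed
      then show ?thesis using endo unfolding rep_endo_def by blast
    qed
    then show ?thesis using brick unfolding rep_brick_def by blast
  qed
qed

end

section \<open>Reflections of representations\<close>

text \<open>The injections need not fill the ambient space; the set \<open>D\<close> below singles
  out the part that they do fill.\<close>

locale self_sum = vec_space scale for scale :: "'k::field \<Rightarrow> 'w::ab_group_add \<Rightarrow> 'w" +
  fixes inc proj :: "'h \<Rightarrow> 'w \<Rightarrow> 'w"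
  assumes lin_inc: "lin (inc h)" and lin_proj: "lin (proj h)"
    and proj_inc: "proj h (inc k x) = (if h = k then x else 0)"

locale mult_rep_at = mult_rep scale Q pos L q S A T R + self_sum scale inc proj
  for scale :: "'k::field \<Rightarrow> 'w::ab_group_add \<Rightarrow> 'w" and Q :: "('v, 'b) pre_digraph"
    and pos L q S A T R and inc proj :: "'b + 'b \<Rightarrow> 'w \<Rightarrow> 'w" +
  fixes v :: 'v
  assumes loopfree: "loopfree_vertex Q v"
    and into_pos: "h \<in> arcs (double Q) \<Longrightarrow> head (double Q) h = v \<Longrightarrow> h \<in> pos"
begin

section \<open>The direct sum over the arrows into a loopfree vertex, and its maps to and from the
  space there\<close>

abbreviation hd :: "'b + 'b \<Rightarrow> 'v" where "hd \<equiv> head (double Q)"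
abbreviation tl :: "'b + 'b \<Rightarrow> 'v" where "tl \<equiv> tail (double Q)"

definition bef :: "'b + 'b \<Rightarrow> ('b + 'b) list" where
  "bef h = takeWhile (\<lambda>k. k \<noteq> h) (L v)"

text \<open>The direct sum of the spaces at the tails of the arrows into \<open>v\<close>, inside
  the ambient space. The first condition excludes whatever lies outside the copies indexed by
  \<open>L v\<close>.\<close>

definition D :: "'w set" where
  "D = {z. (\<Sum>h\<in>set (L v). inc h (proj h z)) = z \<and> (\<forall>h\<in>set (L v). proj h z \<in> S (tl h))}"

definition pi :: "('b + 'b) list \<Rightarrow> 'w \<Rightarrow> 'w" where
  "pi ks x = (\<Sum>k\<in>set ks. inc k (A (rev_arrow k) x))"

text \<open>The sum of the maps \<open>P\<^sub>k A\<^sub>k proj\<^sub>k\<close>, where \<open>P\<^sub>k\<close> is the product of the \<open>T\<close> preceding \<open>k\<close>. With these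
  factors \<open>\<mu> \<circ> \<pi>\<close> telescopes to the full product minus 1.\<close>

primrec mu :: "('b + 'b) list \<Rightarrow> 'w \<Rightarrow> 'w" where
  "mu [] z = 0"
| "mu (h # hs) z = A h (proj h z) + T h (mu hs z)"

text \<open>A lift of the arrow \<open>A h\<close> through \<open>mu\<close>, as
  \<open>mu_nu\<close> shows; the reflected arrow is obtained from it. The correction involves
  exactly the arrows preceding \<open>h\<close>, whose product \<open>mu\<close> puts in front of
  \<open>A h\<close>.\<close>

definition nu :: "'b + 'b \<Rightarrow> 'w \<Rightarrow> 'w" where
  "nu h x = inc h x - pi (bef h) (A h x)"

lemma v: "v \<in> verts Q"
  using loopfree by (simp add: loopfree_vertex_def)

lemma in_L: "h \<in> set (L v) \<longleftrightarrow> h \<in> arcs (double Q) \<and> hd h = v"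
  using set_L[OF v] by simp

lemma L_D: "h \<in> set (L v) \<Longrightarrow> h \<in> arcs (double Q)" "h \<in> set (L v) \<Longrightarrow> hd h = v"
  by (auto simp: in_L)

lemma no_loop: "h \<in> arcs (double Q) \<Longrightarrow> hd h = v \<Longrightarrow> tl h \<noteq> v"
  using loopfree by (cases h) (auto simp: loopfree_vertex_def)

lemma A_rev_L: "h \<in> set (L v) \<Longrightarrow> x \<in> S v \<Longrightarrow> A (rev_arrow h) x \<in> S (tl h)"
  using A_rev_in[of h x] by (simp add: in_L)

lemma A_L: "h \<in> set (L v) \<Longrightarrow> x \<in> S (tl h) \<Longrightarrow> A h x \<in> S v"
  using A_in[of h x] by (simp add: in_L)

lemma T_L: "h \<in> set (L v) \<Longrightarrow> x \<in> S v \<Longrightarrow> T h x = x + A h (A (rev_arrow h) x)"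
  using T_pos[of h x] into_pos[of h] by (simp add: in_L)

lemma R_L: "h \<in> set (L v) \<Longrightarrow> x \<in> S v \<Longrightarrow> R h x = x - A h (T (rev_arrow h) (A (rev_arrow h) x))"
  using R_pos[of h x] into_pos[of h] by (simp add: in_L)

lemma R_rev_L: "h \<in> set (L v) \<Longrightarrow> x \<in> S (tl h) \<Longrightarrow> R (rev_arrow h) x = x + A (rev_arrow h) (A h x)"
  using R_rev[of h x] into_pos[of h] by (simp add: in_L)

lemma lin_pi: "set ks \<subseteq> set (L v) \<Longrightarrow> lin (pi ks)"
  unfolding pi_def[abs_def]
  by (rule lin_intros(5), rule lin_compose[OF lin_inc lin_A]) (auto simp: in_L)

lemma lin_mu: "set ks \<subseteq> set (L v) \<Longrightarrow> lin (mu ks)"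
proof (induction ks)
  case Nil
  have "mu [] = (\<lambda>z. 0)" by (rule ext) simp
  then show ?case using lin_intros(7) by simp
next
  case (Cons h ks)
  then have "h \<in> arcs (double Q)" by (simp add: in_L)
  then have "lin (\<lambda>z. A h (proj h z) + T h (mu ks z))"
    using Cons by (intro lin_intros(1) lin_compose[OF lin_A] lin_compose[OF lin_T] lin_proj) auto
  moreover have "mu (h # ks) = (\<lambda>z. A h (proj h z) + T h (mu ks z))" by (rule ext) simp
  ultimately show ?case by simp
qed

lemma split_L:
  assumes "h \<in> set (L v)"
  obtains ls where "L v = bef h @ h # ls" "h \<notin> set (bef h)" "h \<notin> set ls" "set (bef h) \<inter> set ls = {}"
    "set (bef h) \<subseteq> set (L v)" "set ls \<subseteq> set (L v)"
proof -
  obtain ks ls where L: "L v = ks @ h # ls" "h \<notin> set ks"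
    using split_list_first[OF assms] by blast
  have "bef h = ks" unfolding bef_def L(1) using L(2) by (induction ks) auto
  then show thesis using that[of ls] L distinct_L[OF v] by auto
qed

lemma bef_prefix: "L v = ks @ h # ls \<Longrightarrow> bef h = ks"
proof -
  assume L: "L v = ks @ h # ls"
  then have "h \<notin> set ks" using distinct_L[OF v] by auto
  then show ?thesis unfolding bef_def L by (induction ks) auto
qed

lemma proj_sum: "finite I \<Longrightarrow> proj h (\<Sum>k\<in>I. inc k (f k)) = (if h \<in> I then f h else 0)"
  by (simp add: lin_simps(6)[OF lin_proj] proj_inc)

lemma proj_pi: "proj h (pi ks x) = (if h \<in> set ks then A (rev_arrow h) x else 0)"
  unfolding pi_def by (subst proj_sum) auto

lemma set_bef: "set (bef h) \<subseteq> set (L v)"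
  unfolding bef_def by (auto dest: set_takeWhileD)

lemma lin_nu: "h \<in> set (L v) \<Longrightarrow> lin (nu h)"
  unfolding nu_def[abs_def]
  by (intro lin_intros(2) lin_inc lin_compose[OF lin_pi[OF set_bef] lin_A] L_D)

lemma D_sumI:
  assumes "\<And>h. h \<in> set (L v) \<Longrightarrow> f h \<in> S (tl h)"
  shows "(\<Sum>h\<in>set (L v). inc h (f h)) \<in> D"
  unfolding D_def using assms by (simp add: proj_sum)

lemma D_eqI:
  assumes "z \<in> D" "w \<in> D" "\<And>h. h \<in> set (L v) \<Longrightarrow> proj h z = proj h w"
  shows "z = w"
proof -
  have "z = (\<Sum>h\<in>set (L v). inc h (proj h z))" using assms(1) by (simp add: D_def)
  also have "\<dots> = (\<Sum>h\<in>set (L v). inc h (proj h w))" using assms(3) by simp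
  also have "\<dots> = w" using assms(2) by (simp add: D_def)
  finally show ?thesis .
qed

lemma D_proj: "z \<in> D \<Longrightarrow> h \<in> set (L v) \<Longrightarrow> proj h z \<in> S (tl h)"
  by (simp add: D_def)

lemma subspace_D: "subspace D"
proof (rule subspaceI)
  show "0 \<in> D"
    using L_D S_closed(1) by (auto simp: D_def lin_simps(3)[OF lin_proj] lin_simps(3)[OF lin_inc])
  show "x + y \<in> D" if "x \<in> D" "y \<in> D" for x y
    using that L_D S_closed(2)
    by (auto simp: D_def lin_simps(1)[OF lin_proj] lin_simps(1)[OF lin_inc] sum.distrib)
  show "scale c x \<in> D" if "x \<in> D" for c x
    using that L_D S_closed(5)
    by (auto simp: D_def lin_simps(2)[OF lin_proj] lin_simps(2)[OF lin_inc] scale_sum_right[symmetric])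
qed

lemma inc_D:
  assumes "h \<in> set (L v)" "x \<in> S (tl h)"
  shows "inc h x \<in> D"
proof -
  have "(\<Sum>k\<in>set (L v). inc k (if k = h then x else 0)) \<in> D"
    using assms L_D by (intro D_sumI) (auto intro: S_closed(1))
  moreover have "(\<Sum>k\<in>set (L v). inc k (if k = h then x else 0)) =
      (\<Sum>k\<in>set (L v). if k = h then inc h x else 0)"
    by (rule sum.cong) (auto simp: lin_simps(3)[OF lin_inc])
  ultimately show ?thesis using assms by simp
qed

lemma pi_D:
  assumes "set ks \<subseteq> set (L v)" "x \<in> S v"
  shows "pi ks x \<in> D"
  unfolding pi_def
  using assms by (intro subspace_sum[OF subspace_D] inc_D A_rev_L) auto

lemma nu_D:
  assumes "h \<in> set (L v)" "x \<in> S (tl h)"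
  shows "nu h x \<in> D"
  unfolding nu_def
  using assms by (intro subspace_diff[OF subspace_D] inc_D pi_D[OF set_bef] A_L)

text \<open>Adds one summand at a time, for partial sums \<open>Z I\<close>; \<open>proj h\<close>
  separates the new copy from the earlier ones.\<close>

lemma has_dim_D: "has_dim D (\<Sum>h\<in>set (L v). dim (S (tl h)))"
proof -
  define Z where "Z I = {z. (\<Sum>h\<in>I. inc h (proj h z)) = z \<and> (\<forall>h\<in>I. proj h z \<in> S (tl h))}" for I
  interpret P: vec_space_pair scale scale by unfold_locales
  have "finite I \<Longrightarrow> I \<subseteq> set (L v) \<Longrightarrow> has_dim (Z I) (\<Sum>h\<in>I. dim (S (tl h)))" for I
  proof (induction I rule: finite_induct)
    case empty
    have "Z {} = {0}" by (auto simp: Z_def)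
    then show ?case using has_dim_0 by simp
  next
    case (insert h I)
    then have h: "h \<in> arcs (double Q)" and IH: "has_dim (Z I) (\<Sum>h\<in>I. dim (S (tl h)))"
      by (auto simp: in_L)
    have S: "has_dim (S (tl h)) (dim (S (tl h)))"
      using S_dim[OF head_tail_verts(2)[OF h]] has_dim_dim by metis
    have "inj_on (inc h) (S (tl h))" by (rule inj_on_inverseI[of _ "proj h"]) (simp add: proj_inc)
    then have inc: "has_dim (inc h ` S (tl h)) (dim (S (tl h)))"
      using P.has_dim_image[OF lin_inc _ S] by blast
    have h0: "proj h z = 0" if "z \<in> Z I" for z
    proof -
      have "proj h z = proj h (\<Sum>h\<in>I. inc h (proj h z))" using that by (simp add: Z_def)
      also have "\<dots> = 0" using insert.hyps by (simp add: proj_sum)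
      finally show ?thesis .
    qed
    have int: "inc h ` S (tl h) \<inter> Z I = {0}"
    proof -
      have "0 \<in> inc h ` S (tl h)"
        using S_closed(1)[OF head_tail_verts(2)[OF h]] lin_simps(3)[OF lin_inc] by (metis image_eqI)
      moreover have "0 \<in> Z I" using has_dim_subspace[OF IH] by (rule subspace_0)
      moreover have "z = 0" if z: "z \<in> inc h ` S (tl h)" "z \<in> Z I" for z
      proof -
        obtain x where x: "z = inc h x" using z(1) by blast
        then have "x = 0" using h0[OF z(2)] by (simp add: proj_inc)
        then show ?thesis using x by (simp add: lin_simps(3)[OF lin_inc])
      qed
      ultimately show ?thesis by blast
    qed
    have "Z (insert h I) = {u + w |u w. u \<in> inc h ` S (tl h) \<and> w \<in> Z I}"
    proof (intro equalityI subsetI)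
      fix z assume z: "z \<in> Z (insert h I)"
      let ?w = "\<Sum>k\<in>I. inc k (proj k z)"
      have "z = inc h (proj h z) + ?w" using z insert.hyps unfolding Z_def by simp
      moreover have "inc h (proj h z) \<in> inc h ` S (tl h)" using z unfolding Z_def by blast
      moreover have "?w \<in> Z I"
        using z insert.hyps(1) unfolding Z_def by (simp add: proj_sum)
      ultimately show "z \<in> {u + w |u w. u \<in> inc h ` S (tl h) \<and> w \<in> Z I}" by blast
    next
      fix z assume "z \<in> {u + w |u w. u \<in> inc h ` S (tl h) \<and> w \<in> Z I}"
      then obtain x w where z: "z = inc h x + w" "x \<in> S (tl h)" "w \<in> Z I" by blast
      have p: "proj h z = x" "\<And>k. k \<in> I \<Longrightarrow> proj k z = proj k w"
        using insert.hyps(2) h0[OF z(3)] unfolding z(1) lin_simps(1)[OF lin_proj] proj_inc by auto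
      have "(\<Sum>k\<in>I. inc k (proj k z)) = w" using z(3) p(2) unfolding Z_def by simp
      then show "z \<in> Z (insert h I)"
        using p z insert.hyps unfolding Z_def by simp
    qed
    then show ?case using has_dim_sum[OF inc IH int] insert.hyps by simp
  qed
  moreover have "Z (set (L v)) = D" unfolding Z_def D_def ..
  ultimately show ?thesis by (metis List.finite_set subset_refl)
qed

lemma lin_foldr_T: "set ks \<subseteq> set (L v) \<Longrightarrow> lin (foldr T ks)"
proof (induction ks)
  case Nil
  then show ?case using lin_intros(6) by (simp add: id_def)
next
  case (Cons h ks)
  then show ?case using lin_compose[OF lin_T, of h "foldr T ks"] by (auto simp: in_L comp_def)
qed

lemma mu_in: "set ks \<subseteq> set (L v) \<Longrightarrow> z \<in> D \<Longrightarrow> mu ks z \<in> S v"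
proof (induction ks)
  case (Cons h ks)
  then show ?case using T_in[of h "mu ks z"] A_in[of h "proj h z"] D_proj[of z h]
    by (auto simp: in_L intro: S_closed)
qed (simp add: S_closed v)

lemma mu_zero: "set ks \<subseteq> set (L v) \<Longrightarrow> (\<And>k. k \<in> set ks \<Longrightarrow> proj k z = 0) \<Longrightarrow> mu ks z = 0"
  by (induction ks) (auto simp: in_L lin_simps(3)[OF lin_A] lin_simps(3)[OF lin_T])

lemma mu_append: "set ks \<subseteq> set (L v) \<Longrightarrow> mu (ks @ ls) z = mu ks z + foldr T ks (mu ls z)"
  by (induction ks) (auto simp: in_L lin_simps(1)[OF lin_T] add.assoc)

text \<open>Telescoping: the first factor contributes \<open>T h x - x\<close>, and the remaining
  ones, moved by \<open>T h\<close>, contribute the full product minus \<open>T h x\<close>. The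
  list \<open>ls\<close> is separate from \<open>ks\<close> so that the induction can shorten
  \<open>ks\<close> alone.\<close>

lemma mu_pi:
  "set ks \<subseteq> set ls \<Longrightarrow> set ls \<subseteq> set (L v) \<Longrightarrow> x \<in> S v \<Longrightarrow> mu ks (pi ls x) = foldr T ks x - x"
proof (induction ks)
  case (Cons h ks)
  then have h: "h \<in> set (L v)" "h \<in> arcs (double Q)" by (auto simp: in_L)
  have "mu (h # ks) (pi ls x) = A h (A (rev_arrow h) x) + T h (foldr T ks x - x)"
    using Cons by (simp add: proj_pi)
  also have "\<dots> = (T h x - x) + (T h (foldr T ks x) - T h x)"
    using T_L[OF h(1) Cons.prems(3)] lin_simps(4)[OF lin_T[OF h(2)]] by simp
  finally show ?case by simp
qed simp

lemma mu_pi_L: "x \<in> S v \<Longrightarrow> mu (L v) (pi (L v) x) = scale (q v - 1) x"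
  using mu_pi[of "L v" "L v" x] rel[OF v] by (simp add: scale_left_diff_distrib)

text \<open>Let \<open>P\<close> be the product of the \<open>T\<close> preceding \<open>h\<close>.
  Then \<open>mu\<close> sends \<open>inc h x\<close> to \<open>P (A h x)\<close> and the correction
  term to \<open>P (A h x) - A h x\<close>, the latter by telescoping, since the correction has no
  coordinates from \<open>h\<close> onwards.\<close>

lemma mu_nu:
  assumes h: "h \<in> set (L v)" and x: "x \<in> S (tl h)"
  shows "mu (L v) (nu h x) = A h x"
proof -
  obtain ls where L: "L v = bef h @ h # ls" "h \<notin> set (bef h)" "h \<notin> set ls" "set (bef h) \<inter> set ls = {}"
    "set (bef h) \<subseteq> set (L v)" "set ls \<subseteq> set (L v)"
    using split_L[OF h] .
  note hH = L_D(1)[OF h]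
  have Ah: "A h x \<in> S v" using A_L h x by simp
  have hls: "set (h # ls) \<subseteq> set (L v)" using L(6) h by simp
  have mL: "mu (L v) z = mu (bef h) z + foldr T (bef h) (mu (h # ls) z)" for z
    using mu_append[OF L(5), of "h # ls"] L(1) by simp
  have "mu (bef h) (inc h x) = 0"
    using L(2) by (intro mu_zero[OF L(5)]) (auto simp: proj_inc)
  moreover have "mu (h # ls) (inc h x) = A h x"
  proof -
    have "mu ls (inc h x) = 0" using L(3) by (intro mu_zero[OF L(6)]) (auto simp: proj_inc)
    then show ?thesis using lin_simps(3)[OF lin_T[OF hH]] by (simp add: proj_inc)
  qed
  moreover have "mu (bef h) (pi (bef h) (A h x)) = foldr T (bef h) (A h x) - A h x"
    by (rule mu_pi[OF subset_refl L(5) Ah])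
  moreover have "mu (h # ls) (pi (bef h) (A h x)) = 0"
    using L(2,4) by (intro mu_zero[OF hls]) (auto simp: proj_pi)
  ultimately have "mu (L v) (inc h x) = foldr T (bef h) (A h x)"
    "mu (L v) (pi (bef h) (A h x)) = foldr T (bef h) (A h x) - A h x"
    using mL[of "inc h x"] mL[of "pi (bef h) (A h x)"] lin_simps(3)[OF lin_foldr_T[OF L(5)]]
    by (simp_all del: mu.simps)
  then show ?thesis
    unfolding nu_def lin_simps(4)[OF lin_mu[OF subset_refl]] by simp
qed

subsection \<open>Vertices with trivial parameter\<close>

text \<open>A vector of \<open>S v\<close> killed by all arrows out of \<open>v\<close> spans a
  stable line, on which each \<open>T\<close> into \<open>v\<close> is the identity; this is the
  one-dimensional alternative. If there is none, \<open>pi\<close> is injective and simplicity makes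
  \<open>mu\<close> surjective, while their composite is 0, so \<open>has_dim_complex\<close>
  applies.\<close>

lemma trivial_parameter:
  assumes q1: "q v = 1" and simple: "rep_simple Q scale S A T R"
  shows "(\<exists>x. x \<noteq> 0 \<and> S v = span {x} \<and> (\<forall>w\<in>verts Q. w \<noteq> v \<longrightarrow> S w = {0})) \<or>
    2 * dim (S v) \<le> (\<Sum>h\<in>set (L v). dim (S (tl h)))"
proof (cases "\<exists>x\<in>S v. x \<noteq> 0 \<and> (\<forall>h\<in>set (L v). A (rev_arrow h) x = 0)")
  case True
  then obtain x where x: "x \<in> S v" "x \<noteq> 0" "\<And>h. h \<in> set (L v) \<Longrightarrow> A (rev_arrow h) x = 0" by blast
  define Y where "Y w = (if w = v then span {x} else {0})" for w
  have sub: "span {x} \<subseteq> S v" using x(1) S_subspace[OF v] by (simp add: span_minimal)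
  have kill: "A (rev_arrow h) y = 0" if "h \<in> set (L v)" "y \<in> span {x}" for h y
    using that x(3)[of h] lin_simps(2)[OF lin_A, of "rev_arrow h"] by (auto simp: span_singleton in_L)
  have Y0: "0 \<in> Y w" for w by (simp add: Y_def span_zero)
  have "rep_stable Q scale S A T R Y"
    unfolding rep_stable_def
  proof (intro conjI ballI)
    fix w assume "w \<in> verts Q"
    then show "subspace (Y w)" "Y w \<subseteq> S w" using sub by (auto simp: Y_def subspace_0 S_closed)
  next
    fix h y assume h: "h \<in> arcs (double Q)" and y: "y \<in> Y (tl h)"
    have "A h y = 0"
    proof (cases "tl h = v")
      case True
      then show ?thesis using kill[of "rev_arrow h" y] h y by (auto simp: in_L Y_def)
    next
      case False
      then show ?thesis using y lin_simps(3)[OF lin_A[OF h]] by (simp add: Y_def)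
    qed
    then show "A h y \<in> Y (hd h)" using Y0 by simp
  next
    fix h y assume h: "h \<in> arcs (double Q)" and y: "y \<in> Y (hd h)"
    have "T h y = y \<and> R h y = y"
    proof (cases "hd h = v")
      case True
      then have hL: "h \<in> set (L v)" and yx: "y \<in> span {x}" and yS: "y \<in> S v"
        using h y sub by (auto simp: in_L Y_def)
      then have "T h y = y"
        using T_L[OF hL yS] kill[OF hL yx] lin_simps(3)[OF lin_A[OF h]] by simp
      then show ?thesis using RT[OF h, of y] True yS by simp
    next
      case False
      then show ?thesis using y lin_simps(3)[OF lin_T[OF h]] lin_simps(3)[OF lin_R[OF h]] by (simp add: Y_def)
    qed
    then show "T h y \<in> Y (hd h)" "R h y \<in> Y (hd h)" using y by auto
  qed
  then have "(\<forall>w\<in>verts Q. Y w = {0}) \<or> (\<forall>w\<in>verts Q. Y w = S w)"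
    using simple unfolding rep_simple_def by blast
  moreover have "Y v \<noteq> {0}" using x(2) span_base[of x "{x}"] by (auto simp: Y_def)
  ultimately have "\<forall>w\<in>verts Q. Y w = S w" using v by blast
  then show ?thesis using x(2) v unfolding Y_def by metis
next
  case False
  \<comment> \<open>Shrinking \<open>S v\<close> to the image of \<open>mu\<close> keeps stability,
    since by \<open>mu_nu\<close> every arrow into \<open>v\<close> takes its values there.\<close>
  define Y where "Y = S(v := mu (L v) ` D)"
  have sub: "mu (L v) ` D \<subseteq> S v" using mu_in by blast
  have YS: "Y w \<subseteq> S w" for w using sub by (simp add: Y_def)
  interpret P: vec_space_pair scale scale by unfold_locales
  have subsp: "subspace (mu (L v) ` D)"
    by (rule P.linear_subspace_image[OF lin_mu[OF subset_refl] subspace_D])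
  have A_Y: "A h y \<in> mu (L v) ` D" if "h \<in> set (L v)" "y \<in> S (tl h)" for h y
    using mu_nu[OF that] nu_D[OF that] by (metis image_eqI)
  have "rep_stable Q scale S A T R Y"
    unfolding rep_stable_def
  proof (intro conjI ballI)
    fix w assume "w \<in> verts Q"
    then show "subspace (Y w)" "Y w \<subseteq> S w" using subsp YS S_subspace by (auto simp: Y_def)
  next
    fix h y assume h: "h \<in> arcs (double Q)" and y: "y \<in> Y (tl h)"
    then have yS: "y \<in> S (tl h)" using YS by blast
    show "A h y \<in> Y (hd h)"
      using A_in[OF h yS] A_Y[of h y] yS h by (auto simp: Y_def in_L)
  next
    fix h y assume h: "h \<in> arcs (double Q)" and y: "y \<in> Y (hd h)"
    then have yS: "y \<in> S (hd h)" using YS by blast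
    have "T h y \<in> Y (hd h) \<and> R h y \<in> Y (hd h)"
    proof (cases "hd h = v")
      case True
      then have hL: "h \<in> set (L v)" using h by (simp add: in_L)
      have b: "A (rev_arrow h) y \<in> S (tl h)" using A_rev_in[OF h yS] .
      then have "T (rev_arrow h) (A (rev_arrow h) y) \<in> S (tl h)" using T_in[of "rev_arrow h"] h by simp
      then have "A h (A (rev_arrow h) y) \<in> mu (L v) ` D" "A h (T (rev_arrow h) (A (rev_arrow h) y)) \<in> mu (L v) ` D"
        using A_Y[OF hL] b by auto
      moreover have "y \<in> mu (L v) ` D" using y True by (simp add: Y_def)
      ultimately have "T h y \<in> mu (L v) ` D" "R h y \<in> mu (L v) ` D"
        using T_L[OF hL] R_L[OF hL] yS True subspace_add[OF subsp] subspace_diff[OF subsp] by simp_all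
      then show ?thesis using True by (simp add: Y_def)
    next
      case False
      then show ?thesis using T_in[OF h yS] R_in[OF h yS] by (simp add: Y_def)
    qed
    then show "T h y \<in> Y (hd h)" "R h y \<in> Y (hd h)" by auto
  qed
  then have "(\<forall>w\<in>verts Q. Y w = {0}) \<or> (\<forall>w\<in>verts Q. Y w = S w)"
    using simple unfolding rep_simple_def by blast
  \<comment> \<open>Otherwise all spaces away from \<open>v\<close> vanish. As \<open>v\<close> has
    no loop, the arrows out of \<open>v\<close> then kill all of \<open>S v\<close>, against the
    case assumption.\<close>
  moreover have "\<not> (\<forall>w\<in>verts Q. Y w = {0})"
  proof
    assume "\<forall>w\<in>verts Q. Y w = {0}"
    then have z: "S w = {0}" if "w \<in> verts Q" "w \<noteq> v" for w using that by (auto simp: Y_def)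
    then have "S v \<noteq> {0}" using simple unfolding rep_simple_def by blast
    then obtain x where x: "x \<in> S v" "x \<noteq> 0" using S_closed(1)[OF v] by blast
    have "A (rev_arrow h) x = 0" if "h \<in> set (L v)" for h
      using A_rev_L[OF that x(1)] z[of "tl h"] that no_loop[of h] by (auto simp: in_L)
    then show False using False x by blast
  qed
  ultimately have "Y v = S v" using v by blast
  then have img: "mu (L v) ` D = S v" by (simp add: Y_def)
  have "has_dim (S v) (dim (S v))" using S_dim[OF v] has_dim_dim by metis
  then have "2 * dim (S v) \<le> (\<Sum>h\<in>set (L v). dim (S (tl h)))"
  proof (rule has_dim_complex[OF lin_pi[OF subset_refl] lin_mu[OF subset_refl] _ has_dim_D _ _ img])
    show "pi (L v) ` S v \<subseteq> D" using pi_D by blast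
    show "inj_on (pi (L v)) (S v)"
    proof (rule inj_onI)
      fix x y assume xy: "x \<in> S v" "y \<in> S v" "pi (L v) x = pi (L v) y"
      have "A (rev_arrow h) (x - y) = 0" if h: "h \<in> set (L v)" for h
        using arg_cong[OF xy(3), of "proj h"] h lin_simps(4)[OF lin_A, of "rev_arrow h"]
        by (simp add: proj_pi in_L)
      then show "x = y" using False S_closed(3)[OF v xy(1,2)] by auto
    qed
    show "mu (L v) (pi (L v) x) = 0" if "x \<in> S v" for x
      using mu_pi_L[OF that] q1 by simp
  qed
  then show ?thesis by blast
qed

end

subsection \<open>Vertices with nontrivial parameter\<close>

locale mult_rep_reflect = mult_rep_at scale Q pos L q S A T R inc proj v
  for scale :: "'k::field \<Rightarrow> 'w::ab_group_add \<Rightarrow> 'w" and Q :: "('v, 'b) pre_digraph"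
    and pos L q S A T R and inc proj :: "'b + 'b \<Rightarrow> 'w \<Rightarrow> 'w" and v :: 'v +
  assumes q_ne: "q v \<noteq> 1"
begin

abbreviation qi :: 'k where "qi \<equiv> inverse (q v)"

lemma q_v_nonzero: "q v \<noteq> 0"
  using q_nonzero v by simp

text \<open>As \<open>\<mu> \<circ> \<pi> = q - 1\<close>, this is \<open>q\<^sup>-\<^sup>1 - 1\<close> times the projection onto the kernel of \<open>\<mu>\<close> along the image
  of \<open>\<pi>\<close>. Writing \<open>M = \<pi> \<circ> \<mu>\<close> as a block matrix, \<open>1 + M\<close> factors as a lower triangular matrix with
  diagonal blocks \<open>1 + a\<^sup>* a\<close> times an upper unitriangular one; the reflected representation belongs to
  \<open>q\<^sup>-\<^sup>1 (1 + M)\<close>.\<close>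

definition E :: "'w \<Rightarrow> 'w" where
  "E z = scale qi (scale (1 - q v) z + pi (L v) (mu (L v) z))"

definition S' :: "'v \<Rightarrow> 'w set" where
  "S' = S(v := {z \<in> D. mu (L v) z = 0})"

text \<open>As in the classical reflection functors, the arrows out of \<open>v\<close> are the
  coordinates of the inclusion of the kernel. The arrows into \<open>v\<close> are the lifts of the
  old ones, brought into the kernel by \<open>E\<close>.\<close>

definition A' :: "'b + 'b \<Rightarrow> 'w \<Rightarrow> 'w" where
  "A' h = (if hd h = v then (\<lambda>x. E (nu h x)) else if tl h = v then proj (rev_arrow h) else A h)"

text \<open>All arrows into \<open>v\<close> are positive, so there \<open>T'\<close> is
  \<open>1 + a b\<close> itself. At the opposite ends \<open>1 + b a\<close> acquires the factor
  \<open>qi\<close> (see \<open>far_factor\<close>), and \<open>T\<close>, being its inverse, the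
  factor \<open>q v\<close>.\<close>

definition T' :: "'b + 'b \<Rightarrow> 'w \<Rightarrow> 'w" where
  "T' h = (if hd h = v then (\<lambda>z. z + A' h (proj h z))
    else if tl h = v then (\<lambda>x. scale (q v) (T h x)) else T h)"

text \<open>For the arrows into \<open>v\<close> this is again the inverse formula of
  \<open>R_pos\<close>, with the rescaled \<open>T (rev_arrow h)\<close> as the inverse at the
  opposite end.\<close>

definition R' :: "'b + 'b \<Rightarrow> 'w \<Rightarrow> 'w" where
  "R' h = (if hd h = v then (\<lambda>z. z - A' h (scale (q v) (T (rev_arrow h) (proj h z))))
    else if tl h = v then (\<lambda>x. scale qi (R h x)) else R h)"

text \<open>Each arrow of the double from \<open>v\<close> to \<open>w\<close> contributes one
  rescaled factor to the product at \<open>w\<close>.\<close>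

definition q' :: "'v \<Rightarrow> 'k" where
  "q' w = (if w = v then qi else q v ^ length (filter (\<lambda>h. tl h = v) (L w)) * q w)"

lemma S'_v: "S' v = {z \<in> D. mu (L v) z = 0}" and S'_other: "w \<noteq> v \<Longrightarrow> S' w = S w"
  by (simp_all add: S'_def)

lemma A'_L: "h \<in> set (L v) \<Longrightarrow> A' h x = E (nu h x)"
  and A'_rev_L: "h \<in> set (L v) \<Longrightarrow> A' (rev_arrow h) x = proj h x"
  and A'_other: "hd h \<noteq> v \<Longrightarrow> tl h \<noteq> v \<Longrightarrow> A' h = A h"
  using no_loop[of h] by (auto simp: A'_def in_L)

lemma T'_L: "h \<in> set (L v) \<Longrightarrow> T' h x = x + A' h (proj h x)"
  and T'_rev_L: "h \<in> set (L v) \<Longrightarrow> T' (rev_arrow h) x = scale (q v) (T (rev_arrow h) x)"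
  and T'_other: "hd h \<noteq> v \<Longrightarrow> tl h \<noteq> v \<Longrightarrow> T' h = T h"
  using no_loop[of h] by (auto simp: T'_def in_L)

lemma R'_L: "h \<in> set (L v) \<Longrightarrow> R' h x = x - A' h (scale (q v) (T (rev_arrow h) (proj h x)))"
  and R'_rev_L: "h \<in> set (L v) \<Longrightarrow> R' (rev_arrow h) x = scale qi (R (rev_arrow h) x)"
  and R'_other: "hd h \<noteq> v \<Longrightarrow> tl h \<noteq> v \<Longrightarrow> R' h = R h"
  using no_loop[of h] by (auto simp: R'_def in_L)

lemma arrow_cases:
  assumes "h \<in> arcs (double Q)"
  obtains (into) "h \<in> set (L v)" "hd h = v" "tl h \<noteq> v"
  | (out) k where "k \<in> set (L v)" "h = rev_arrow k" "hd k = v" "tl k \<noteq> v"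
  | (other) "hd h \<noteq> v" "tl h \<noteq> v"
  using assms no_loop[of h] no_loop[of "rev_arrow h"] in_L[of h] in_L[of "rev_arrow h"]
  by (metis rev_arrow_rev_arrow rev_arrow_simps)

lemma lin_E: "lin E"
  unfolding E_def[abs_def]
  by (intro lin_intros(4) lin_intros(1) lin_compose[OF lin_pi[OF subset_refl] lin_mu[OF subset_refl]] lin_intros(6))

lemma lin_A': "h \<in> arcs (double Q) \<Longrightarrow> lin (A' h)"
  using lin_compose[OF lin_E lin_nu[of h]] lin_A lin_proj in_L by (simp add: A'_def)

text \<open>Up to the factor \<open>qi\<close>, the two terms of \<open>E z\<close> are sent by
  \<open>mu\<close> to \<open>(1 - q v)\<close> and \<open>(q v - 1)\<close> times
  \<open>mu (L v) z\<close>, which cancel.\<close>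

lemma E_D:
  assumes "z \<in> D"
  shows "E z \<in> S' v"
proof -
  have m: "mu (L v) z \<in> S v" using mu_in[OF subset_refl assms] .
  have "E z \<in> D"
    unfolding E_def
    by (intro subspace_scale[OF subspace_D] subspace_add[OF subspace_D] pi_D[OF subset_refl m] assms)
  moreover have "mu (L v) (E z) = 0"
    unfolding E_def lin_simps(1,2)[OF lin_mu[OF subset_refl]] mu_pi_L[OF m]
    by (simp add: scale_left_distrib[symmetric])
  ultimately show ?thesis by (simp add: S'_v)
qed

lemma E_ker: "z \<in> S' v \<Longrightarrow> E z = scale (qi - 1) z"
  using q_v_nonzero lin_simps(3)[OF lin_pi[OF subset_refl]] by (simp add: S'_v E_def right_diff_distrib)

lemma E_nu:
  assumes "h \<in> set (L v)" "x \<in> S (tl h)"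
  shows "E (nu h x) = scale qi (scale (1 - q v) (nu h x) + pi (L v) (A h x))"
  using mu_nu[OF assms] by (simp add: E_def)

lemma A'_in:
  assumes "h \<in> arcs (double Q)" "x \<in> S' (tl h)"
  shows "A' h x \<in> S' (hd h)"
  using assms(1)
proof (cases h rule: arrow_cases)
  case into
  then show ?thesis using E_D[OF nu_D[of h x]] assms(2) by (simp add: A'_L S'_other)
next
  case (out k)
  then show ?thesis using assms(2) D_proj[of x k] by (simp add: A'_rev_L S'_other S'_v)
next
  case other
  then show ?thesis using A_in[OF assms(1)] assms(2) by (simp add: A'_other S'_other)
qed

lemma qi_scale: "scale qi (scale (1 - q v) x) = scale qi x - x"
  using q_v_nonzero by (simp only: scale_left_diff_distrib scale_right_diff_distrib scale_scale) simp

text \<open>The block entries behind the triangular factorisation. Before \<open>h\<close> the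
  correction in \<open>nu\<close> changes the coefficient from \<open>qi\<close> to
  \<open>qi * (q v - 1) + qi = 1\<close>; after \<open>h\<close> it remains
  \<open>qi\<close>.\<close>

lemma proj_A':
  assumes h: "h \<in> set (L v)" and k: "k \<in> set (L v)" and x: "x \<in> S (tl h)"
  shows "proj k (A' h x) =
    (if k \<in> set (bef h) then A (rev_arrow k) (A h x)
     else if k = h then scale qi (scale (1 - q v) x + A (rev_arrow h) (A h x))
     else scale qi (A (rev_arrow k) (A h x)))"
proof -
  have bef: "h \<notin> set (bef h)" using split_L[OF h] by metis
  have "proj k (A' h x) = scale qi (scale (1 - q v) (proj k (nu h x)) + A (rev_arrow k) (A h x))"
    using h k x by (simp add: A'_L E_nu lin_simps(1,2)[OF lin_proj] proj_pi)
  also have "proj k (nu h x) = (if k = h then x else 0) - (if k \<in> set (bef h) then A (rev_arrow k) (A h x) else 0)"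
    by (simp add: nu_def lin_simps(4)[OF lin_proj] proj_pi proj_inc)
  finally show ?thesis
    using bef qi_scale[of "- A (rev_arrow k) (A h x)"] by (auto simp: scale_right_distrib)
qed

text \<open>The diagonal entry: the added \<open>x\<close> cancels the \<open>- x\<close> coming
  from \<open>qi * (1 - q v) = qi - 1\<close>, which leaves \<open>qi\<close> times
  \<open>1 + b a\<close>.\<close>

lemma far_factor:
  assumes h: "h \<in> set (L v)" and x: "x \<in> S (tl h)"
  shows "x + proj h (A' h x) = scale qi (R (rev_arrow h) x)"
proof -
  have "h \<notin> set (bef h)" using split_L[OF h] by metis
  then show ?thesis
    using h x qi_scale[of x] by (simp add: proj_A' R_rev_L scale_right_distrib)
qed

text \<open>The last factor acts first, hence the induction from the end. It adds
  \<open>E (nu h y)\<close>, whose coordinates at the preceding arrows form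
  \<open>pi ks (A h y) = inc h y - nu h y\<close>; after \<open>E\<close> is applied the
  \<open>nu\<close> terms cancel and \<open>E (inc h y)\<close> is left.\<close>

lemma foldr_T'_prefix:
  assumes "L v = ks @ ls" "z \<in> D"
  shows "foldr T' ks z = z + E (\<Sum>k\<in>set ks. inc k (proj k z))"
  using assms
proof (induction ks arbitrary: ls z rule: rev_induct)
  case Nil
  then show ?case by (simp add: lin_simps(3)[OF lin_E])
next
  case (snoc h ks)
  have L: "L v = ks @ h # ls" using snoc.prems(1) by simp
  then have h: "h \<in> set (L v)" and hks: "h \<notin> set ks" and ks: "set ks \<subseteq> set (L v)"
    using distinct_L[OF v] by auto
  have bef: "bef h = ks" using bef_prefix[OF L] .
  define y where "y = proj h z"
  define w where "w = T' h z"
  have y: "y \<in> S (tl h)" using D_proj[OF snoc.prems(2) h] by (simp add: y_def)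
  have w: "w = z + A' h y" using h by (simp add: w_def T'_L y_def)
  have "A' h y \<in> D" using E_D[OF nu_D[OF h y]] h by (simp add: A'_L S'_v)
  then have wD: "w \<in> D" unfolding w using subspace_add[OF subspace_D snoc.prems(2)] by blast
  have "(\<Sum>k\<in>set ks. inc k (proj k w)) =
      (\<Sum>k\<in>set ks. inc k (proj k z)) + (\<Sum>k\<in>set ks. inc k (proj k (A' h y)))"
    unfolding w by (simp add: lin_simps(1)[OF lin_proj] lin_simps(1)[OF lin_inc] sum.distrib)
  also have "(\<Sum>k\<in>set ks. inc k (proj k (A' h y))) = pi ks (A h y)"
    unfolding pi_def using h y ks bef by (intro sum.cong) (auto simp: proj_A')
  also have "\<dots> = inc h y - nu h y" by (simp add: nu_def bef)
  finally have "foldr T' ks w = w + E ((\<Sum>k\<in>set ks. inc k (proj k z)) + (inc h y - nu h y))"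
    using snoc.IH[OF L wD] by simp
  also have "\<dots> = z + E ((\<Sum>k\<in>set ks. inc k (proj k z)) + inc h y)"
    using h unfolding w by (simp add: lin_simps(1,4)[OF lin_E] A'_L)
  finally show ?case using hks by (simp add: w_def y_def add.commute)
qed

lemma subspace_S'_v: "subspace (S' v)"
proof -
  have "lin (mu (L v))" by (rule lin_mu[OF subset_refl])
  then show ?thesis
    unfolding S'_v using subspace_D by (auto simp: subspace_def lin_simps)
qed

lemma foldr_scaled_T:
  assumes "set ks \<subseteq> arcs (double Q)" "\<And>h. h \<in> set ks \<Longrightarrow> hd h \<noteq> v"
  shows "foldr T' ks x = scale (q v ^ length (filter (\<lambda>h. tl h = v) ks)) (foldr T ks x)"
  using assms
proof (induction ks)
  case (Cons h ks)
  then have "h \<in> arcs (double Q)" "hd h \<noteq> v" by auto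
  then show ?case
    using Cons lin_simps(2)[OF lin_T[of h]] by (auto simp: T'_def)
qed simp

lemma mult_rep': "mult_rep scale Q pos L q' S' A' T' R'"
proof (intro mult_rep.intro mult_rep_axioms.intro vec_space_axioms fin_digraph_axioms;
    (fact pos set_L distinct_L lin_A' A'_in)?)
  fix w assume w: "w \<in> verts Q"
  show "q' w \<noteq> 0" using q_v_nonzero q_nonzero[OF w] by (simp add: q'_def)
  show "\<exists>n. has_dim (S' w) n"
  proof (cases "w = v")
    case True
    have "S' v \<subseteq> D" by (auto simp: S'_v)
    from has_dim_subset[OF has_dim_D subspace_S'_v this] show ?thesis using True by metis
  next
    case False
    then show ?thesis using S_dim[OF w] by (simp add: S'_other)
  qed
  show "foldr T' (L w) x = scale (q' w) x" if x: "x \<in> S' w" for x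
  proof (cases "w = v")
    case True
    then have xv: "x \<in> S' v" and xD: "x \<in> D" using x by (auto simp: S'_v)
    \<comment> \<open>For the full list the sum over the coordinates is \<open>x\<close> itself; as
      \<open>E\<close> is \<open>qi - 1\<close> on the kernel, \<open>x + E x\<close> equals
      \<open>qi\<close> times \<open>x\<close>.\<close>
    have "foldr T' (L v) x = x + E x"
      using foldr_T'_prefix[of "L v" "[]" x] xD by (simp add: D_def)
    then show ?thesis using True E_ker[OF xv] by (simp add: q'_def scale_left_diff_distrib)
  next
    case False
    have "foldr T' (L w) x = scale (q v ^ length (filter (\<lambda>h. tl h = v) (L w))) (foldr T (L w) x)"
      using False set_L[OF w] by (intro foldr_scaled_T) auto
    then show ?thesis using False rel[OF w, of x] x by (simp add: q'_def S'_other)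
  qed
next
  fix h assume h: "h \<in> arcs (double Q)"
  show "lin (T' h)"
    using lin_intros(1)[OF lin_intros(6) lin_compose[OF lin_A'[OF h] lin_proj]] lin_T[OF h] lin_intros(4)[OF lin_T[OF h]]
    by (simp add: T'_def)
  have "lin (\<lambda>z. scale (q v) (T (rev_arrow h) (proj h z)))"
    using h by (intro lin_intros(4) lin_compose[OF lin_T lin_proj]) simp
  then show "lin (R' h)"
    using lin_intros(2)[OF lin_intros(6) lin_compose[OF lin_A'[OF h]]] lin_R[OF h] lin_intros(4)[OF lin_R[OF h]]
    by (simp add: R'_def)
  fix x assume x: "x \<in> S' (hd h)"
  have "T' h x \<in> S' (hd h) \<and> R' h x \<in> S' (hd h) \<and> T' h (R' h x) = x \<and> R' h (T' h x) = x \<and>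
     (h \<in> pos \<longrightarrow> T' h x = x + A' h (A' (rev_arrow h) x)) \<and>
     (h \<notin> pos \<longrightarrow> R' h x = x + A' h (A' (rev_arrow h) x))"
    using h
  proof (cases h rule: arrow_cases)
    case into
    let ?k = "rev_arrow h"
    have k: "?k \<in> arcs (double Q)" "hd ?k = tl h" using h by auto
    define y where "y = proj h x"
    define t where "t = scale (q v) (T ?k y)"
    have y: "y \<in> S (tl h)" using x into D_proj[of x h] by (simp add: y_def S'_v)
    have Ty: "T ?k y \<in> S (tl h)" using T_in[OF k(1)] k(2) y by simp
    then have t: "t \<in> S (tl h)" using h by (simp add: t_def S_closed)
    have A'S: "A' h z \<in> S' v" if "z \<in> S (tl h)" for z
      using A'_in[OF h, of z] that into by (simp add: S'_other)
    have Tx: "T' h x = x + A' h y" and Rx: "R' h x = x - A' h t"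
      using into by (simp_all add: T'_L R'_L y_def t_def)
    \<comment> \<open>By \<open>far_factor\<close>, \<open>t\<close> is the solution of
      \<open>t + proj h (A' h t) = y\<close>. So \<open>t\<close> is the coordinate of
      \<open>R' h x\<close> at \<open>h\<close>, and \<open>T'\<close> adds back precisely what
      \<open>R'\<close> took away.\<close>
    have "t + proj h (A' h t) = R ?k (T ?k y)"
      using far_factor[OF into(1) t] lin_simps(2)[OF lin_R[OF k(1)]] q_v_nonzero by (simp add: t_def)
    then have "t + proj h (A' h t) = y" using RT[OF k(1)] k(2) y by simp
    then have "proj h (R' h x) = t"
      by (simp add: Rx lin_simps(4)[OF lin_proj] y_def[symmetric] diff_eq_eq)
    then have TR': "T' h (R' h x) = x" using into by (simp add: T'_L Rx)
    have "scale (q v) (T ?k (proj h (T' h x))) = scale (q v) (T ?k (y + proj h (A' h y)))"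
      by (simp add: Tx lin_simps(1)[OF lin_proj] y_def)
    also have "\<dots> = T ?k (R ?k y)"
      using far_factor[OF into(1) y] lin_simps(2)[OF lin_T[OF k(1)]] q_v_nonzero by simp
    also have "\<dots> = y" using TR[OF k(1)] k(2) y by simp
    finally have "R' h (T' h x) = x" using into by (simp add: R'_L Tx)
    moreover have "h \<in> pos" using into_pos h into by simp
    ultimately show ?thesis
      using TR' into x subspace_add[OF subspace_S'_v] subspace_diff[OF subspace_S'_v] A'S[OF y] A'S[OF t]
      by (simp add: Tx Rx) (simp add: A'_rev_L y_def)
  next
    case (out k)
    then have k: "k \<in> set (L v)" "h = rev_arrow k" "hd k = v" "tl k \<noteq> v" by auto
    have hk: "hd h = tl k" using k L_D by simp
    have xS: "x \<in> S (tl k)" and vt: "tl k \<in> verts Q" using x k hk L_D(1)[of k] by (auto simp: S'_other)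
    have "T h x \<in> S (tl k)" "R h x \<in> S (tl k)" "T h (R h x) = x" "R h (T h x) = x"
      using T_in[OF h] R_in[OF h] TR[OF h] RT[OF h] hk xS by auto
    then have "T' h x \<in> S' (hd h) \<and> R' h x \<in> S' (hd h) \<and> T' h (R' h x) = x \<and> R' h (T' h x) = x"
      using k hk q_v_nonzero S_closed(5)[OF vt] S'_other[OF k(4)] lin_simps(2)[OF lin_T[OF h]] lin_simps(2)[OF lin_R[OF h]]
      by (simp add: T'_rev_L R'_rev_L)
    moreover have "h \<notin> pos" using pos[OF h] into_pos[of k] k L_D(1)[of k] by simp
    moreover have "R' h x = x + A' h (A' (rev_arrow h) x)"
      using far_factor[OF k(1) xS] k by (simp add: R'_rev_L A'_rev_L)
    ultimately show ?thesis by blast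
  next
    case other
    then show ?thesis
      using x T_in[OF h] R_in[OF h] TR[OF h] RT[OF h] T_pos[OF h] R_neg[OF h]
      by (simp add: T'_other R'_other S'_other A'_other)
  qed
  then show "T' h x \<in> S' (hd h)" "R' h x \<in> S' (hd h)" "T' h (R' h x) = x" "R' h (T' h x) = x"
    "h \<in> pos \<Longrightarrow> T' h x = x + A' h (A' (rev_arrow h) x)"
    "h \<notin> pos \<Longrightarrow> R' h x = x + A' h (A' (rev_arrow h) x)"
    by blast+
qed

section \<open>Dimension, simplicity and endomorphisms under the reflection\<close>

lemma dim_S':
  "dim (S' v) + dim (S v) = (\<Sum>h\<in>set (L v). dim (S (tl h)))"
proof -
  let ?M = "mu (L v)" and ?P = "pi (L v)"
  interpret P: vec_space_pair scale scale by unfold_locales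
  have linM: "lin ?M" and linP: "lin ?P" by (rule lin_mu lin_pi, rule subset_refl)+
  have c: "q v - 1 \<noteq> 0" using q_ne by simp
  have S: "has_dim (S v) (dim (S v))" using S_dim[OF v] has_dim_dim by metis
  have S': "has_dim (S' v) (dim (S' v))"
    using mult_rep.S_dim[OF mult_rep' v] has_dim_dim by metis
  have eq0: "x = 0" if "x \<in> S v" "?M (?P x) = 0" for x
    using that mu_pi_L[OF that(1)] c by simp
  have inj: "inj_on ?P (S v)"
  proof (rule inj_onI)
    fix x y assume xy: "x \<in> S v" "y \<in> S v" "?P x = ?P y"
    then have "?M (?P (x - y)) = 0" by (simp add: lin_simps(4)[OF linP] lin_simps(3)[OF linM])
    then show "x = y" using eq0[of "x - y"] S_closed(3)[OF v xy(1,2)] by simp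
  qed
  have int: "S' v \<inter> ?P ` S v = {0}"
  proof -
    have "0 \<in> ?P ` S v" using S_closed(1)[OF v] lin_simps(3)[OF linP] by (metis image_eqI)
    moreover have "0 \<in> S' v" using subspace_S'_v by (rule subspace_0)
    moreover have "z = 0" if z: "z \<in> S' v" "z \<in> ?P ` S v" for z
    proof -
      obtain x where x: "x \<in> S v" "z = ?P x" using z(2) by blast
      then have "x = 0" using eq0[OF x(1)] z(1) by (simp add: S'_v)
      then show ?thesis using x(2) lin_simps(3)[OF linP] by simp
    qed
    ultimately show ?thesis by blast
  qed
  have "D = {u + w |u w. u \<in> S' v \<and> w \<in> ?P ` S v}"
  proof (intro equalityI subsetI)
    fix z assume z: "z \<in> D"
    \<comment> \<open>The component of \<open>z\<close> along the image of \<open>pi\<close>: since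
      \<open>mu\<close> after \<open>pi\<close> is the scalar \<open>q v - 1\<close>, invertible
      here, \<open>D\<close> splits into the kernel of \<open>mu\<close> and this image.\<close>
    define x where "x = scale (inverse (q v - 1)) (?M z)"
    have x: "x \<in> S v" unfolding x_def using S_closed(5)[OF v] mu_in[OF subset_refl z] by blast
    have "?M (?P x) = ?M z" using mu_pi_L[OF x] c by (simp add: x_def)
    then have "z - ?P x \<in> S' v"
      using subspace_diff[OF subspace_D z pi_D[OF subset_refl x]] by (simp add: S'_v lin_simps(4)[OF linM])
    moreover have "z = (z - ?P x) + ?P x" by simp
    ultimately show "z \<in> {u + w |u w. u \<in> S' v \<and> w \<in> ?P ` S v}" using x by blast
  next
    fix z assume "z \<in> {u + w |u w. u \<in> S' v \<and> w \<in> ?P ` S v}"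
    then show "z \<in> D" using pi_D[OF subset_refl] subspace_add[OF subspace_D] by (auto simp: S'_v)
  qed
  then have "has_dim D (dim (S' v) + dim (S v))"
    using has_dim_sum[OF S' P.has_dim_image[OF linP inj S] int] by simp
  then show ?thesis using has_dim_dim[OF has_dim_D] has_dim_dim by fastforce
qed

text \<open>Stable families are carried back to the old representation without an inverse functor:
  only the space at \<open>v\<close> has to be chosen, and the two extreme outcomes there determine
  the family at hand.\<close>

lemma rep_simple':
  assumes simple: "rep_simple Q scale S A T R"
  shows "rep_simple Q scale S' A' T' R'"
  unfolding rep_simple_def
proof (intro conjI allI impI)
  show "\<exists>w\<in>verts Q. S' w \<noteq> {0}"
  proof (rule ccontr)
    assume "\<not> (\<exists>w\<in>verts Q. S' w \<noteq> {0})"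
    then have z: "S w = {0}" if "w \<in> verts Q" "w \<noteq> v" for w using that S'_other by metis
    have "x = 0" if x: "x \<in> S v" for x
    proof -
      have "A (rev_arrow h) x = 0" if h: "h \<in> set (L v)" for h
        using A_rev_L[OF h x] z[of "tl h"] L_D[OF h] no_loop[of h] by simp
      then have "pi (L v) x = 0"
        using D_eqI[OF pi_D[OF subset_refl x] subspace_0[OF subspace_D]]
        by (simp add: proj_pi lin_simps(3)[OF lin_proj])
      then show ?thesis
        using mu_pi_L[OF x] q_ne lin_simps(3)[OF lin_mu[OF subset_refl]] by simp
    qed
    then have "S v = {0}" using S_closed(1)[OF v] by blast
    then show False using simple z unfolding rep_simple_def by metis
  qed
next
  fix Y' assume st: "rep_stable Q scale S' A' T' R' Y'"
  have Y'_sub: "subspace (Y' w)" "Y' w \<subseteq> S' w" if "w \<in> verts Q" for w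
    using st that unfolding rep_stable_def by auto
  have Y'_A: "A' h x \<in> Y' (hd h)" if "h \<in> arcs (double Q)" "x \<in> Y' (tl h)" for h x
    using st that unfolding rep_stable_def by blast
  have Y'_T: "T' h x \<in> Y' (hd h)" "R' h x \<in> Y' (hd h)" if "h \<in> arcs (double Q)" "x \<in> Y' (hd h)" for h x
    using st that unfolding rep_stable_def by blast+
  have Y'_S: "x \<in> S w" if "w \<in> verts Q" "w \<noteq> v" "x \<in> Y' w" for w x
    using Y'_sub(2)[OF that(1)] S'_other[OF that(2)] that(3) by blast
  have tl_v: "tl h \<in> verts Q" "tl h \<noteq> v" if "h \<in> set (L v)" for h
    using L_D[OF that] no_loop by auto
  \<comment> \<open>The largest possible choice at \<open>v\<close>: all vectors that the arrows out
    of \<open>v\<close> send into \<open>Y'\<close>. What remains to be shown is that arrows into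
    \<open>v\<close> land in it.\<close>
  define Y where "Y = Y'(v := {x \<in> S v. \<forall>h\<in>set (L v). A (rev_arrow h) x \<in> Y' (tl h)})"
  have Yv: "Y v = {x \<in> S v. \<forall>h\<in>set (L v). A (rev_arrow h) x \<in> Y' (tl h)}"
    and Yo: "w \<noteq> v \<Longrightarrow> Y w = Y' w" for w
    by (simp_all add: Y_def)
  have sub_Yv: "subspace (Y v)"
  proof (rule subspaceI)
    show "0 \<in> Y v"
      using S_closed(1)[OF v] L_D(1) tl_v Y'_sub(1) by (auto simp: Yv lin_simps(3)[OF lin_A] subspace_0)
    show "x + y \<in> Y v" if "x \<in> Y v" "y \<in> Y v" for x y
      using that S_closed(2)[OF v] L_D(1) tl_v Y'_sub(1) by (auto simp: Yv lin_simps(1)[OF lin_A] subspace_add)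
    show "scale c x \<in> Y v" if "x \<in> Y v" for c x
      using that S_closed(5)[OF v] L_D(1) tl_v Y'_sub(1) by (auto simp: Yv lin_simps(2)[OF lin_A] subspace_scale)
  qed
  have A_Yv: "A h x \<in> Y v" if h: "h \<in> set (L v)" and x: "x \<in> Y' (tl h)" for h x
  proof -
    have xS: "x \<in> S (tl h)" using Y'_S tl_v[OF h] x by blast
    have Ax: "A' h x \<in> Y' v" using Y'_A[of h x] L_D[OF h] x by simp
    \<comment> \<open>By \<open>proj_A'\<close> this vector is obtained from the coordinate at
      \<open>k\<close> of \<open>A' h x\<close>, which lies in \<open>Y'\<close>, by a nonzero
      scaling and, for \<open>k = h\<close>, subtraction of a multiple of \<open>x\<close>.\<close>
    have "A (rev_arrow k) (A h x) \<in> Y' (tl k)" if k: "k \<in> set (L v)" for k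
    proof -
      note sub = Y'_sub(1)[OF tl_v(1)[OF k]]
      have p: "proj k (A' h x) \<in> Y' (tl k)"
        using Y'_A[of "rev_arrow k" "A' h x"] Ax L_D[OF k] A'_rev_L[OF k] by simp
      show ?thesis
      proof (cases "k \<in> set (bef h)")
        case True
        then show ?thesis using p proj_A'[OF h k xS] by simp
      next
        case False
        have "A (rev_arrow k) (A h x) =
            scale (q v) (proj k (A' h x)) - (if k = h then scale (1 - q v) x else 0)"
          using False q_v_nonzero by (simp add: proj_A'[OF h k xS] scale_right_distrib)
        moreover have "(if k = h then scale (1 - q v) x else 0) \<in> Y' (tl k)"
          using x sub subspace_scale[OF sub] by (auto simp: subspace_0)
        ultimately show ?thesis using p sub by (simp only: subspace_diff subspace_scale)
      qed
    qed
    then show ?thesis using A_L[OF h xS] by (simp add: Yv)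
  qed
  have "rep_stable Q scale S A T R Y"
    unfolding rep_stable_def
  proof (intro conjI ballI)
    fix w assume w: "w \<in> verts Q"
    show "subspace (Y w)" using sub_Yv Y'_sub(1)[OF w] Yo by metis
    show "Y w \<subseteq> S w" using Y'_S[OF w] Yo Yv by (cases "w = v") auto
  next
    fix h x assume h: "h \<in> arcs (double Q)" and x: "x \<in> Y (tl h)"
    show "A h x \<in> Y (hd h)"
      using h
    proof (cases h rule: arrow_cases)
      case into
      then show ?thesis using A_Yv[of h x] x by (simp add: Yo)
    next
      case (out k)
      then show ?thesis using x L_D[of k] by (simp add: Yo Yv)
    next
      case other
      then show ?thesis using Y'_A[OF h] x by (simp add: Yo A'_other)
    qed
  next
    fix h x assume h: "h \<in> arcs (double Q)" and x: "x \<in> Y (hd h)"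
    have "T h x \<in> Y (hd h) \<and> R h x \<in> Y (hd h)"
      using h
    proof (cases h rule: arrow_cases)
      case into
      let ?k = "rev_arrow h"
      have k: "?k \<in> arcs (double Q)" "hd ?k = tl h" using h by auto
      have xS: "x \<in> S v" and b: "A ?k x \<in> Y' (tl h)" using x into by (auto simp: Yv)
      have "scale qi (T' ?k (A ?k x)) \<in> Y' (tl h)"
        using Y'_T(1)[OF k(1)] k(2) b Y'_sub(1)[OF tl_v(1)[OF into(1)]] by (simp add: subspace_scale)
      then have "T ?k (A ?k x) \<in> Y' (tl h)" using q_v_nonzero into by (simp add: T'_rev_L)
      then have "A h (T ?k (A ?k x)) \<in> Y v" "A h (A ?k x) \<in> Y v"
        using A_Yv[OF into(1)] b by auto
      then show ?thesis
        using x into T_L[OF into(1) xS] R_L[OF into(1) xS] subspace_add[OF sub_Yv] subspace_diff[OF sub_Yv] by simp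
    next
      case (out k)
      have hk: "hd h = tl k" using out L_D by simp
      have x': "x \<in> Y' (hd h)" using x out hk by (simp add: Yo)
      note sub = subspace_scale[OF Y'_sub(1)[OF tl_v(1)[OF out(1)]]]
      have "T h x = scale qi (T' h x)" "R h x = scale (q v) (R' h x)"
        using q_v_nonzero out by (simp_all add: T'_rev_L R'_rev_L)
      then show ?thesis using Y'_T[OF h x'] sub hk out by (simp add: Yo)
    next
      case other
      then show ?thesis using Y'_T[OF h, of x] x by (simp add: Yo T'_other R'_other)
    qed
    then show "T h x \<in> Y (hd h)" "R h x \<in> Y (hd h)" by auto
  qed
  then have "(\<forall>w\<in>verts Q. Y w = {0}) \<or> (\<forall>w\<in>verts Q. Y w = S w)"
    using simple unfolding rep_simple_def by blast
  then show "(\<forall>w\<in>verts Q. Y' w = {0}) \<or> (\<forall>w\<in>verts Q. Y' w = S' w)"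
  proof
    assume Y: "\<forall>w\<in>verts Q. Y w = {0}"
    have "z = 0" if z: "z \<in> Y' v" for z
    proof -
      have "z \<in> D" using Y'_sub(2)[OF v] z by (auto simp: S'_v)
      moreover have "proj h z = 0" if h: "h \<in> set (L v)" for h
      proof -
        have "Y' (tl h) = {0}" using Y tl_v[OF h] Yo by metis
        then show ?thesis using Y'_A[of "rev_arrow h" z] L_D[OF h] z A'_rev_L[OF h] by simp
      qed
      ultimately show ?thesis
        using D_eqI[OF _ subspace_0[OF subspace_D]] by (simp add: lin_simps(3)[OF lin_proj])
    qed
    then have "Y' v = {0}" using subspace_0[OF Y'_sub(1)[OF v]] by blast
    then show ?thesis using Y Yo by metis
  next
    assume Y: "\<forall>w\<in>verts Q. Y w = S w"
    \<comment> \<open>With \<open>Y'\<close> full at the tails, every arrow into \<open>v\<close>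
      has its values in \<open>Y' v\<close>, so each \<open>T'\<close> is the identity modulo
      \<open>Y' v\<close>. The whole product is also \<open>qi\<close>, hence
      \<open>(qi - 1) z\<close> lies in \<open>Y' v\<close>, and \<open>qi - 1\<close> is
      invertible.\<close>
    have "foldr T' ks z \<in> S' v \<and> foldr T' ks z - z \<in> Y' v" if z: "z \<in> S' v" and "set ks \<subseteq> set (L v)" for ks z
      using that(2)
    proof (induction ks)
      case Nil
      then show ?case using z subspace_0[OF Y'_sub(1)[OF v]] by simp
    next
      case (Cons h ks)
      let ?y = "foldr T' ks z"
      have h: "h \<in> set (L v)" and IH: "?y \<in> S' v" "?y - z \<in> Y' v" using Cons by auto
      have "proj h ?y \<in> S (tl h)" using IH(1) D_proj[OF _ h] by (simp add: S'_v)
      then have "proj h ?y \<in> Y' (tl h)" using Y tl_v[OF h] Yo by metis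
      then have A: "A' h (proj h ?y) \<in> Y' v" using Y'_A[of h] L_D[OF h] by metis
      have "T' h ?y = ?y + A' h (proj h ?y)" using h by (simp add: T'_L)
      moreover have "?y + A' h (proj h ?y) - z \<in> Y' v"
        using subspace_add[OF Y'_sub(1)[OF v] A IH(2)] by (simp add: algebra_simps)
      ultimately show ?case
        using A IH(1) Y'_sub(2)[OF v] subspace_add[OF subspace_S'_v] by auto
    qed
    then have "foldr T' (L v) z - z \<in> Y' v" if "z \<in> S' v" for z
      using that by blast
    then have "scale (qi - 1) z \<in> Y' v" if "z \<in> S' v" for z
      using that mult_rep.rel[OF mult_rep' v that] by (fastforce simp: q'_def scale_left_diff_distrib)
    moreover have "qi - 1 \<noteq> 0" using q_ne inverse_eq_1_iff by simp
    ultimately have "z \<in> Y' v" if "z \<in> S' v" for z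
      using that subspace_scale[OF Y'_sub(1)[OF v], of "scale (qi - 1) z" "inverse (qi - 1)"] by simp
    then have "Y' v = S' v" using Y'_sub(2)[OF v] by blast
    then show ?thesis using Y Yo S'_other by metis
  qed
qed

text \<open>Acting coordinatewise on \<open>D\<close>, an endomorphism commutes with
  \<open>mu\<close>, \<open>pi\<close>, \<open>nu\<close> and \<open>E\<close>, so it induces one of
  the reflected representation. The resulting scalar governs the spaces away from \<open>v\<close>
  directly, and \<open>S v\<close> through \<open>pi\<close>, which is injective because
  \<open>q v\<close> differs from 1.\<close>

lemma rep_brick':
  assumes brick: "rep_brick Q scale S' A'"
  shows "rep_brick Q scale S A"
  unfolding rep_brick_def
proof (intro allI impI)
  fix \<phi> assume endo: "rep_endo Q scale S A \<phi>"
  have lin_\<phi>: "lin (\<phi> w)" and \<phi>_in: "x \<in> S w \<Longrightarrow> \<phi> w x \<in> S w" if "w \<in> verts Q" for w x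
    using endo that unfolding rep_endo_def by auto
  have comm: "\<phi> (hd h) (A h x) = A h (\<phi> (tl h) x)" if "h \<in> arcs (double Q)" "x \<in> S (tl h)" for h x
    using endo that unfolding rep_endo_def by blast
  define \<phi>v where "\<phi>v z = (\<Sum>h\<in>set (L v). inc h (\<phi> (tl h) (proj h z)))" for z
  define \<phi>' where "\<phi>' = \<phi>(v := \<phi>v)"
  have lin_v: "lin \<phi>v"
    unfolding \<phi>v_def[abs_def]
    by (rule lin_intros(5), rule lin_compose[OF lin_inc lin_compose[OF lin_\<phi> lin_proj]])
      (simp add: L_D)
  have \<phi>v_D: "\<phi>v z \<in> D" if "z \<in> D" for z
    unfolding \<phi>v_def using that L_D by (intro D_sumI \<phi>_in D_proj) auto
  have proj_\<phi>: "proj h (\<phi>v z) = \<phi> (tl h) (proj h z)" if "h \<in> set (L v)" for h z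
    using that unfolding \<phi>v_def by (simp add: proj_sum)
  have mu_\<phi>: "set ks \<subseteq> set (L v) \<Longrightarrow> z \<in> D \<Longrightarrow> mu ks (\<phi>v z) = \<phi> v (mu ks z)" for ks z
  proof (induction ks)
    case Nil
    then show ?case using lin_simps(3)[OF lin_\<phi>[OF v]] by simp
  next
    case (Cons h ks)
    then have h: "h \<in> set (L v)" "set ks \<subseteq> set (L v)" by auto
    have "\<phi> v (A h (proj h z)) = A h (\<phi> (tl h) (proj h z))"
      using comm[of h "proj h z"] L_D[OF h(1)] D_proj[OF Cons.prems(2) h(1)] by simp
    moreover have "\<phi> v (T h (mu ks z)) = T h (\<phi> v (mu ks z))"
      using endo_T[OF endo, of h "mu ks z"] L_D[OF h(1)] mu_in[OF h(2) Cons.prems(2)] by simp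
    ultimately show ?case
      using Cons h lin_simps(1)[OF lin_\<phi>[OF v]] by (simp add: proj_\<phi>)
  qed
  have pi_\<phi>: "\<phi>v (pi ks x) = pi ks (\<phi> v x)" if ks: "set ks \<subseteq> set (L v)" and x: "x \<in> S v" for ks x
  proof (rule D_eqI)
    show "\<phi>v (pi ks x) \<in> D" "pi ks (\<phi> v x) \<in> D" using \<phi>v_D pi_D ks x \<phi>_in[OF v] by auto
    fix h assume h: "h \<in> set (L v)"
    have "\<phi> (tl h) (A (rev_arrow h) x) = A (rev_arrow h) (\<phi> v x)"
      using comm[of "rev_arrow h" x] L_D[OF h] x by simp
    then show "proj h (\<phi>v (pi ks x)) = proj h (pi ks (\<phi> v x))"
      using h lin_simps(3)[OF lin_\<phi>] L_D(1)[OF h] by (simp add: proj_\<phi> proj_pi)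
  qed
  have inc_\<phi>: "\<phi>v (inc h x) = inc h (\<phi> (tl h) x)" if h: "h \<in> set (L v)" and x: "x \<in> S (tl h)" for h x
  proof (rule D_eqI)
    show "\<phi>v (inc h x) \<in> D" "inc h (\<phi> (tl h) x) \<in> D"
      using \<phi>v_D inc_D h x \<phi>_in L_D(1)[OF h] by auto
    show "proj k (\<phi>v (inc h x)) = proj k (inc h (\<phi> (tl h) x))" if k: "k \<in> set (L v)" for k
      using lin_simps(3)[OF lin_\<phi>] L_D(1)[OF k] by (simp add: proj_\<phi>[OF k] proj_inc)
  qed
  have nu_\<phi>: "\<phi>v (nu h x) = nu h (\<phi> (tl h) x)" if h: "h \<in> set (L v)" and x: "x \<in> S (tl h)" for h x
    using inc_\<phi>[OF h x] pi_\<phi>[OF set_bef A_L[OF h x]] comm[of h x] L_D[OF h] x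
    by (simp add: nu_def lin_simps(4)[OF lin_v])
  have E_\<phi>: "\<phi>v (E z) = E (\<phi>v z)" if z: "z \<in> D" for z
    using mu_\<phi>[OF subset_refl z] pi_\<phi>[OF subset_refl mu_in[OF subset_refl z]]
    by (simp add: E_def lin_simps(1,2)[OF lin_v])
  have "rep_endo Q scale S' A' \<phi>'"
    unfolding rep_endo_def
  proof (intro conjI ballI)
    fix w assume w: "w \<in> verts Q"
    show "lin (\<phi>' w)" using lin_v lin_\<phi>[OF w] by (simp add: \<phi>'_def)
    show "\<phi>' w ` S' w \<subseteq> S' w"
      using \<phi>_in[OF w] \<phi>v_D mu_\<phi>[OF subset_refl] lin_simps(3)[OF lin_\<phi>[OF v]]
      by (cases "w = v") (auto simp: \<phi>'_def S'_v S'_other)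
  next
    fix h x assume h: "h \<in> arcs (double Q)" and x: "x \<in> S' (tl h)"
    show "\<phi>' (hd h) (A' h x) = A' h (\<phi>' (tl h) x)"
      using h
    proof (cases h rule: arrow_cases)
      case into
      then have xS: "x \<in> S (tl h)" using x by (simp add: S'_other)
      then show ?thesis using into E_\<phi>[OF nu_D[OF into(1) xS]] nu_\<phi>[OF into(1) xS] by (simp add: A'_L \<phi>'_def)
    next
      case (out k)
      then show ?thesis using proj_\<phi>[of k x] by (simp add: A'_rev_L \<phi>'_def)
    next
      case other
      then show ?thesis using comm[OF h, of x] x by (simp add: A'_other \<phi>'_def S'_other)
    qed
  qed
  then obtain c where c: "\<And>w x. w \<in> verts Q \<Longrightarrow> x \<in> S' w \<Longrightarrow> \<phi>' w x = scale c x"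
    using brick unfolding rep_brick_def by blast
  have other: "\<phi> w x = scale c x" if "w \<in> verts Q" "w \<noteq> v" "x \<in> S w" for w x
    using c[of w x] that S'_other by (simp add: \<phi>'_def)
  have at_v: "\<phi> v x = scale c x" if x: "x \<in> S v" for x
  proof -
    have "\<phi>v (pi (L v) x) = scale c (pi (L v) x)"
    proof (rule D_eqI)
      show "\<phi>v (pi (L v) x) \<in> D" "scale c (pi (L v) x) \<in> D"
        using \<phi>v_D pi_D[OF subset_refl x] subspace_scale[OF subspace_D] by auto
      show "proj h (\<phi>v (pi (L v) x)) = proj h (scale c (pi (L v) x))" if h: "h \<in> set (L v)" for h
        using other[of "tl h"] L_D[OF h] no_loop[of h] A_rev_L[OF h x] h
        by (simp add: proj_\<phi> proj_pi lin_simps(2)[OF lin_proj])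
    qed
    then have "mu (L v) (pi (L v) (\<phi> v x)) = mu (L v) (scale c (pi (L v) x))"
      using pi_\<phi>[OF subset_refl x] by simp
    then have "scale (q v - 1) (\<phi> v x) = scale (q v - 1) (scale c x)"
      using mu_pi_L[OF x] mu_pi_L[OF \<phi>_in[OF v x]]
      by (simp add: lin_simps(2)[OF lin_mu[OF subset_refl]] mult.commute)
    then show ?thesis using q_ne by (simp only: scale_cancel_left) simp
  qed
  show "\<exists>c. \<forall>w\<in>verts Q. \<forall>x\<in>S w. \<phi> w x = scale c x"
    using other at_v by metis
qed

end

section \<open>Dimension vectors of simple representations\<close>

definition rep_dim :: "('v, 'b) pre_digraph \<Rightarrow> ('k::field \<Rightarrow> 'w::ab_group_add \<Rightarrow> 'w) \<Rightarrow> ('v \<Rightarrow> 'w set) \<Rightarrow> 'v \<Rightarrow> int" where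
  "rep_dim Q scale S v = (if v \<in> verts Q then int (vector_space.dim scale (S v)) else 0)"

context mult_rep
begin

lemma rep_dim_in_lattice: "rep_dim Q scale S \<in> root_lattice Q"
  by (simp add: root_lattice_def rep_dim_def)

lemma rep_dim_nonneg: "0 \<le> rep_dim Q scale S v"
  by (simp add: rep_dim_def)

lemma rep_dim_eq_0: "v \<in> verts Q \<Longrightarrow> rep_dim Q scale S v = 0 \<longleftrightarrow> S v = {0}"
proof -
  assume v: "v \<in> verts Q"
  obtain n where n: "has_dim (S v) n" using S_dim[OF v] by blast
  have "dim {0} = 0" by (rule has_dim_dim[OF has_dim_0])
  then have "dim (S v) = 0 \<longleftrightarrow> S v = {0}"
    using n has_dim_dim[OF n] has_dim_0_iff[of "S v"] by metis
  then show ?thesis using v by (simp add: rep_dim_def)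
qed

text \<open>Restricting \<open>S\<close> to the vertices reachable from \<open>u\<close> inside the
  support gives a stable family, because an arrow leaving that set ends in a zero space. It is
  nonzero at \<open>u\<close>, so it is everything.\<close>

lemma connected_support:
  assumes simple: "rep_simple Q scale S A T R"
  shows "connected (induce_subgraph Q {v \<in> verts Q. rep_dim Q scale S v \<noteq> 0})"
proof -
  let ?V = "{v \<in> verts Q. rep_dim Q scale S v \<noteq> 0}"
  let ?H = "induce_subgraph Q ?V"
  have wf: "wf_digraph ?H" by (rule wellformed_induce_subgraph)
  interpret M: pair_wf_digraph "mk_symmetric ?H"
    by (rule wf_digraph.wellformed_mk_symmetric[OF wf])
  have edge: "(tail (double Q) h, head (double Q) h) \<in> parcs (mk_symmetric ?H)"
    if h: "h \<in> arcs (double Q)" and V: "tail (double Q) h \<in> ?V" "head (double Q) h \<in> ?V" for h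
  proof -
    obtain a where a: "a \<in> arcs ?H"
      "(tail (double Q) h, head (double Q) h) = (tail ?H a, head ?H a) \<or>
       (tail (double Q) h, head (double Q) h) = (head ?H a, tail ?H a)"
    proof (cases h)
      case (Inl a)
      then show thesis using that[of a] h V by simp
    next
      case (Inr a)
      then show thesis using that[of a] h V by simp
    qed
    then show ?thesis unfolding parcs_mk_symmetric by blast
  qed
  have reach: "u \<rightarrow>\<^sup>*\<^bsub>mk_symmetric ?H\<^esub> w" if u: "u \<in> ?V" and w: "w \<in> verts Q" "S w \<noteq> {0}" for u w
  proof -
    obtain C where C: "C = {w. u \<rightarrow>\<^sup>*\<^bsub>mk_symmetric ?H\<^esub> w}" by blast
    have uC: "u \<in> C" unfolding C mem_Collect_eq using u by (intro M.reachable_refl) simp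
    have CV: "C \<subseteq> ?V"
    proof
      fix w assume "w \<in> C"
      then have "u \<rightarrow>\<^sup>*\<^bsub>mk_symmetric ?H\<^esub> w" unfolding C by (rule CollectD)
      from M.reachable_in_verts(2)[OF this] show "w \<in> ?V" by simp
    qed
    have step: "head (double Q) h \<in> C"
      if "h \<in> arcs (double Q)" "tail (double Q) h \<in> C" "S (head (double Q) h) \<noteq> {0}" for h
    proof -
      have "head (double Q) h \<in> ?V" using that(1,3) rep_dim_eq_0 by simp
      then have "(tail (double Q) h, head (double Q) h) \<in> parcs (mk_symmetric ?H)"
        using edge[OF that(1)] that(2) CV by blast
      with CollectD[OF that(2)[unfolded C]] show ?thesis
        unfolding C mem_Collect_eq by (rule M.reachable_adj_trans)
    qed
    define Y where "Y w = (if w \<in> C then S w else {0})" for w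
    have Y0: "0 \<in> Y w" if "w \<in> verts Q" for w using S_closed(1)[OF that] by (simp add: Y_def)
    have YC: "Y w = S w" if "w \<in> C" for w using that by (simp add: Y_def)
    have YN: "Y w = {0}" if "w \<notin> C" for w using that by (simp add: Y_def)
    have "rep_stable Q scale S A T R Y"
      unfolding rep_stable_def
    proof (intro conjI ballI)
      fix w assume w: "w \<in> verts Q"
      show "subspace (Y w)" "Y w \<subseteq> S w"
        using S_subspace[OF w] S_closed(1)[OF w] by (auto simp: Y_def)
    next
      fix h x assume h: "h \<in> arcs (double Q)" and x: "x \<in> Y (tail (double Q) h)"
      note hv = head_tail_verts[OF h]
      show "A h x \<in> Y (head (double Q) h)"
      proof (cases "tail (double Q) h \<in> C")
        case False
        then have "A h x = 0" using x YN lin_simps(3)[OF lin_A[OF h]] by simp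
        then show ?thesis using Y0[OF hv(1)] by simp
      next
        case True
        then have "A h x \<in> S (head (double Q) h)" using x YC A_in[OF h] by simp
        then show ?thesis using step[OF h True] YC Y0[OF hv(1)] by fastforce
      qed
    next
      fix h x assume h: "h \<in> arcs (double Q)" and x: "x \<in> Y (head (double Q) h)"
      show "T h x \<in> Y (head (double Q) h)" "R h x \<in> Y (head (double Q) h)"
        using x T_in[OF h] R_in[OF h] YC YN lin_simps(3)[OF lin_T[OF h]] lin_simps(3)[OF lin_R[OF h]]
        by (cases "head (double Q) h \<in> C"; simp)+
    qed
    then have "(\<forall>w\<in>verts Q. Y w = {0}) \<or> (\<forall>w\<in>verts Q. Y w = S w)"
      using simple unfolding rep_simple_def by blast
    moreover have "Y u \<noteq> {0}" using u YC[OF uC] rep_dim_eq_0[of u] by simp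
    ultimately have "Y w = S w" using u w(1) by blast
    then have "w \<in> C" using YN w(2) by metis
    then show ?thesis unfolding C by simp
  qed
  have "?V \<noteq> {}" using simple rep_dim_eq_0 unfolding rep_simple_def by blast
  moreover have "S w \<noteq> {0}" if "w \<in> ?V" for w using that rep_dim_eq_0 by blast
  ultimately show ?thesis
    unfolding connected_def strongly_connected_def using reach by simp
qed

lemma finite_into: "finite {h \<in> arcs (double Q). head (double Q) h = v}"
  using finite_arcs_double by simp

text \<open>The two orientations of a loop at \<open>v\<close> both occur among the arrows into
  \<open>v\<close>, and their terms alone cancel twice the dimension at \<open>v\<close>.\<close>

lemma loopfree_of_sym_form_pos:
  assumes v: "v \<in> verts Q" and pos: "0 < sym_form Q (rep_dim Q scale S) (coord_vec v)"
  shows "loopfree_vertex Q v"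
proof (rule ccontr)
  let ?\<alpha> = "rep_dim Q scale S"
  let ?F = "{h \<in> arcs (double Q). head (double Q) h = v}"
  assume "\<not> loopfree_vertex Q v"
  then obtain a where a: "a \<in> arcs Q" "head Q a = v" "tail Q a = v"
    using v by (auto simp: loopfree_vertex_def)
  have "(\<Sum>h\<in>{Inl a, Inr a}. ?\<alpha> (tail (double Q) h)) \<le> (\<Sum>h\<in>?F. ?\<alpha> (tail (double Q) h))"
    using a rep_dim_nonneg by (intro sum_mono2 finite_into) auto
  then have "sym_form Q ?\<alpha> (coord_vec v) \<le> 0"
    using a sym_form_coord_vec[OF v, of ?\<alpha>] by simp
  then show False using pos by simp
qed

lemma fundamental_case:
  assumes "rep_simple Q scale S A T R"
    and "\<And>v. v \<in> verts Q \<Longrightarrow> sym_form Q (rep_dim Q scale S) (coord_vec v) \<le> 0"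
  shows "imaginary_root Q (rep_dim Q scale S)"
proof (rule imaginary_root.fundamental)
  have "rep_dim Q scale S \<noteq> (\<lambda>_. 0)"
    using assms(1) rep_dim_eq_0 unfolding rep_simple_def by metis
  then show "rep_dim Q scale S \<in> fundamental_region Q"
    using assms connected_support rep_dim_in_lattice rep_dim_nonneg
    unfolding fundamental_region_def by blast
qed

end

section \<open>Dimension vectors under reflection, and the descent\<close>

lemma (in mult_rep_at) rep_dim_reflection_defect:
  "sym_form Q (rep_dim Q scale S) (coord_vec v) =
    2 * int (dim (S v)) - int (\<Sum>h\<in>set (L v). dim (S (tl h)))"
  using set_L[OF v] v by (simp add: sym_form_coord_vec[OF v] rep_dim_def)

lemma (in mult_rep_reflect) rep_dim_reflection:
  "rep_dim Q scale S' = reflection Q v (rep_dim Q scale S)"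
proof (rule ext)
  fix w
  show "rep_dim Q scale S' w = reflection Q v (rep_dim Q scale S) w"
  proof (cases "w = v")
    case True
    have "int (dim (S' v)) + int (dim (S v)) = int (\<Sum>h\<in>set (L v). dim (S (tl h)))"
      using dim_S' by (metis of_nat_add)
    moreover have "reflection Q v (rep_dim Q scale S) v =
        rep_dim Q scale S v - sym_form Q (rep_dim Q scale S) (coord_vec v)"
      by (simp add: reflection_apply[OF rep_dim_in_lattice] coord_vec_def)
    moreover have "rep_dim Q scale S v = int (dim (S v))" "rep_dim Q scale S' v = int (dim (S' v))"
      using v by (simp_all add: rep_dim_def)
    ultimately show ?thesis unfolding True using rep_dim_reflection_defect by linarith
  next
    case False
    then show ?thesis
      by (simp add: reflection_apply[OF rep_dim_in_lattice] coord_vec_def rep_dim_def S'_other)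
  qed
qed

lemma (in mult_rep_at) one_dimensional:
  assumes x: "x \<noteq> 0" "S v = span {x}" and zero: "\<forall>w\<in>verts Q. w \<noteq> v \<longrightarrow> S w = {0}"
  shows "rep_dim Q scale S = coord_vec v" "rep_brick Q scale S A"
proof -
  have "dim (S v) = 1" using has_dim_dim[OF has_dim_1[OF x(1)]] x(2) by simp
  then show "rep_dim Q scale S = coord_vec v"
    using v zero has_dim_dim[OF has_dim_0] by (auto simp: rep_dim_def coord_vec_def fun_eq_iff)
  show "rep_brick Q scale S A"
    unfolding rep_brick_def
  proof (intro allI impI)
    fix \<phi> assume endo: "rep_endo Q scale S A \<phi>"
    then have lin: "lin (\<phi> w)" and mem: "\<phi> w ` S w \<subseteq> S w" if "w \<in> verts Q" for w
      using that unfolding rep_endo_def by auto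
    have "x \<in> S v" using x(2) by (simp add: span_base)
    then have "\<phi> v x \<in> span {x}" using mem[OF v] x(2) by blast
    then obtain c where c: "\<And>y. y \<in> span {x} \<Longrightarrow> \<phi> v y = scale c y"
      using one_dim_scalar[OF lin[OF v] x(1)] by metis
    have "\<phi> w y = scale c y" if "w \<in> verts Q" "y \<in> S w" for w y
      using that c x(2) zero lin_simps(3)[OF lin[of w]] by (cases "w = v") auto
    then show "\<exists>c. \<forall>w\<in>verts Q. \<forall>y\<in>S w. \<phi> w y = scale c y" by blast
  qed
qed

theorem simple_rep_root:
  fixes Q :: "('v, 'b) pre_digraph" and scale :: "'k::field \<Rightarrow> 'w::ab_group_add \<Rightarrow> 'w"
    and inc proj :: "'b + 'b \<Rightarrow> 'w \<Rightarrow> 'w"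
  assumes sum: "self_sum scale inc proj"
    and "mult_rep scale Q pos L q S A T R" and "rep_simple Q scale S A T R"
  shows "(real_root Q (rep_dim Q scale S) \<and> rep_brick Q scale S A) \<or> imaginary_root Q (rep_dim Q scale S)"
  using assms(2,3)
\<comment> \<open>Orientation, parameters, spaces and maps all change along the descent; the quiver,
  the order of the factors and the ambient space stay fixed.\<close>
proof (induction "\<Sum>v\<in>verts Q. vector_space.dim scale (S v)" arbitrary: pos q S A T R rule: less_induct)
  case less
  interpret mult_rep scale Q pos L q S A T R by (rule less.prems(1))
  let ?\<alpha> = "rep_dim Q scale S" and ?t = "tail (double Q)"
  show ?case
  proof (cases "\<forall>v\<in>verts Q. sym_form Q ?\<alpha> (coord_vec v) \<le> 0")
    case True
    then show ?thesis using fundamental_case[OF less.prems(2)] by blast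
  next
    case False
    then obtain v where v: "v \<in> verts Q" "0 < sym_form Q ?\<alpha> (coord_vec v)" by fastforce
    have lf: "loopfree_vertex Q v" using loopfree_of_sym_form_pos[OF v] .
    obtain pos' A' where re: "mult_rep scale Q pos' L q S A' T R"
      "\<And>h. h \<in> arcs (double Q) \<Longrightarrow> head (double Q) h = v \<Longrightarrow> h \<in> pos'"
      "rep_simple Q scale S A' T R" "rep_brick Q scale S A' \<Longrightarrow> rep_brick Q scale S A"
      using reorient[OF lf] less.prems(2) by metis
    interpret at: mult_rep_at scale Q pos' L q S A' T R inc proj v
      using re(1,2) sum lf by (intro mult_rep_at.intro mult_rep_at_axioms.intro)
    have defect: "int (\<Sum>h\<in>set (L v). dim (S (?t h))) < 2 * int (dim (S v))"
      using v(2) at.rep_dim_reflection_defect by simp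
    show ?thesis
    proof (cases "q v = 1")
      case True
      have "\<not> 2 * dim (S v) \<le> (\<Sum>h\<in>set (L v). dim (S (?t h)))"
        using defect by (simp only: of_nat_less_iff[symmetric, where 'a = int] not_le of_nat_mult of_nat_numeral)
      then obtain x where "x \<noteq> 0" "S v = span {x}" "\<forall>w\<in>verts Q. w \<noteq> v \<longrightarrow> S w = {0}"
        using at.trivial_parameter[OF True re(3)] by blast
      from at.one_dimensional[OF this] show ?thesis
        using real_root_coord_vec[OF lf] re(4) by simp
    next
      case False
      interpret r: mult_rep_reflect scale Q pos' L q S A' T R inc proj v
        by unfold_locales (rule False)
      have less_v: "dim (r.S' v) < dim (S v)" using r.dim_S' defect by linarith
      have "dim (r.S' w) \<le> dim (S w)" for w
        using less_v r.S'_other[of w] by (cases "w = v") auto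
      then have "(\<Sum>w\<in>verts Q. dim (r.S' w)) < (\<Sum>w\<in>verts Q. dim (S w))"
        using v(1) less_v finite_verts by (intro sum_strict_mono_ex1) blast+
      from less.hyps[OF this r.mult_rep' r.rep_simple'[OF re(3)]]
      have IH: "(real_root Q (rep_dim Q scale r.S') \<and> rep_brick Q scale r.S' r.A') \<or>
          imaginary_root Q (rep_dim Q scale r.S')" .
      have \<alpha>: "?\<alpha> = reflection Q v (rep_dim Q scale r.S')"
        using reflection_involutive[OF lf rep_dim_in_lattice] r.rep_dim_reflection by simp
      show ?thesis
        using IH
      proof
        assume "real_root Q (rep_dim Q scale r.S') \<and> rep_brick Q scale r.S' r.A'"
        then show ?thesis using \<alpha> real_root_reflection[OF _ lf] r.rep_brick' re(4) by metis
      next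
        assume "imaginary_root Q (rep_dim Q scale r.S')"
        then show ?thesis using \<alpha> imaginary_root.weyl[OF _ reflection_in_weyl_group[OF lf]] by metis
      qed
    qed
  qed
qed

section \<open>Modules over the multiplicative preprojective algebra\<close>

text \<open>The functions on lists over \<open>'h\<close> contain a direct sum of \<open>'h\<close>-many copies of themselves, which
  makes room for iterated reflections inside a fixed type.\<close>

definition list_inc :: "'h \<Rightarrow> ('h list \<Rightarrow> 'x::ab_group_add) \<Rightarrow> 'h list \<Rightarrow> 'x" where
  "list_inc h f = (\<lambda>l. case l of [] \<Rightarrow> 0 | k # l' \<Rightarrow> if k = h then f l' else 0)"

definition list_proj :: "'h \<Rightarrow> ('h list \<Rightarrow> 'x) \<Rightarrow> 'h list \<Rightarrow> 'x" where
  "list_proj h f = (\<lambda>l. f (h # l))"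

text \<open>The module is placed at the empty list, where everything in the image of
  \<open>list_inc\<close> vanishes.\<close>

definition list_base :: "'x::ab_group_add \<Rightarrow> 'h list \<Rightarrow> 'x" where
  "list_base x = (\<lambda>l. if l = [] then x else 0)"

definition fun_scale :: "('k \<Rightarrow> 'x \<Rightarrow> 'x) \<Rightarrow> 'k \<Rightarrow> ('i \<Rightarrow> 'x) \<Rightarrow> 'i \<Rightarrow> 'x" where
  "fun_scale s c f = (\<lambda>i. s c (f i))"

lemma vec_space_fun_scale:
  assumes "vector_space s"
  shows "vec_space (fun_scale s)"
proof -
  interpret vector_space s by fact
  show ?thesis
    by unfold_locales (auto simp: fun_scale_def fun_eq_iff scale_right_distrib scale_left_distrib)
qed

lemma self_sum_list:
  assumes "vector_space s"
  shows "self_sum (fun_scale s) list_inc list_proj"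
proof -
  interpret s: vector_space s by fact
  interpret vec_space "fun_scale s" using assms by (rule vec_space_fun_scale)
  have "lin (list_inc h)" "lin (list_proj h)" for h
    by (rule linI; auto simp: list_inc_def list_proj_def fun_scale_def fun_eq_iff split: list.split)+
  then show ?thesis
    by (intro self_sum.intro self_sum_axioms.intro vec_space_axioms)
      (auto simp: list_inc_def list_proj_def fun_eq_iff)
qed

lemma list_base_simps:
  "list_base 0 = 0" "list_base (x + y) = list_base x + list_base y"
  "list_base (x - y) = list_base x - list_base y" "list_base x = list_base y \<longleftrightarrow> x = y" "list_base x [] = x"
  by (auto simp: list_base_def fun_eq_iff)

lemma list_base_scale: "vector_space s \<Longrightarrow> list_base (s c x) = fun_scale s c (list_base x)"
proof -
  assume "vector_space s"
  then interpret vector_space s .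
  show ?thesis by (auto simp: list_base_def fun_scale_def fun_eq_iff)
qed

locale mpa_module = left_module "mpa Q ord q" act
  for Q :: "('v, 'b) pre_digraph" and ord :: "('b + 'b) rel" and q :: "'v \<Rightarrow> 'k::field"
    and act :: "('v \<times> (('b + 'b) + ('b + 'b)) list \<Rightarrow> 'k) set \<Rightarrow> 'x::ab_group_add \<Rightarrow> 'x" +
  assumes Q: "fin_digraph Q" and ord: "strict_linear_order_on (arcs (double Q)) ord"
begin

abbreviation "M \<equiv> mpa Q ord q"
abbreviation "P \<equiv> path_algebra (double Q) :: ('k, 'v \<times> ('b + 'b) list \<Rightarrow> 'k) module"
abbreviation "B \<equiv> loc_algebra Q :: ('k, 'v \<times> (('b + 'b) + ('b + 'b)) list \<Rightarrow> 'k) module"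
abbreviation hd :: "'b + 'b \<Rightarrow> 'v" where "hd \<equiv> head (double Q)"
abbreviation tl :: "'b + 'b \<Rightarrow> 'v" where "tl \<equiv> tail (double Q)"
abbreviation "p y \<equiv> mpa_ideal Q ord q +>\<^bsub>B\<^esub> y"
abbreviation "e v \<equiv> mpa_hom Q ord q (vertex_elt v)"
abbreviation "a h \<equiv> mpa_hom Q ord q (arrow_elt (double Q) h)"
abbreviation "u h \<equiv> mpa_hom Q ord q (one_plus Q h)"
abbreviation "uinv h \<equiv> p (loc_inverse Q h)"
abbreviation "s \<equiv> scalar_act M act"

sublocale fin_digraph Q by (rule Q)
sublocale D: fin_digraph "double Q" by (rule fin_digraph_double[OF Q])
sublocale Lo: fin_digraph "adjoin_loops (double Q)"
  by (rule fin_digraph_adjoin_loops) unfold_locales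
sublocale M: k_algebra M by (rule k_algebra_mpa[OF Q ord])
sublocale P: k_algebra P by (rule k_algebra_path_algebra) unfold_locales
sublocale B: k_algebra B by (rule k_algebra_path_algebra) unfold_locales

lemmas hom = alg_homD[OF mpa_hom[OF Q ord, of q]]
lemmas proj = alg_homD[OF mpa_proj[OF Q ord, of q]]

lemma hv: "h \<in> arcs (double Q) \<Longrightarrow> hd h \<in> verts Q" "h \<in> arcs (double Q) \<Longrightarrow> tl h \<in> verts Q"
  using D.head_in_verts D.tail_in_verts by auto

lemma vertex_closed: "v \<in> verts Q \<Longrightarrow> vertex_elt v \<in> carrier P"
  using vertex_elt_closed[of v "double Q"] by simp

lemma e_closed: "v \<in> verts Q \<Longrightarrow> e v \<in> carrier M"
  by (rule hom(1)[OF vertex_closed])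

lemma a_closed: "h \<in> arcs (double Q) \<Longrightarrow> a h \<in> carrier M"
  by (rule hom(1)[OF D.arrow_elt_closed])

lemma e_mult: "v \<in> verts Q \<Longrightarrow> w \<in> verts Q \<Longrightarrow> e v \<otimes>\<^bsub>M\<^esub> e w = (if v = w then e v else \<zero>\<^bsub>M\<^esub>)"
  using hom(2)[OF vertex_closed vertex_closed, of v w] alg_hom_zero[OF P.k_algebra_axioms M.k_algebra_axioms mpa_hom[OF Q ord]]
  by (cases "v = w") (simp_all add: vertex_elt_mult)

lemma e_a: "h \<in> arcs (double Q) \<Longrightarrow> e (hd h) \<otimes>\<^bsub>M\<^esub> a h = a h"
  using hom(2)[OF vertex_closed[OF hv(1)] D.arrow_elt_closed, of h h] by (simp add: arrow_elt_head)

lemma a_e: "h \<in> arcs (double Q) \<Longrightarrow> a h \<otimes>\<^bsub>M\<^esub> e (tl h) = a h"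
  using hom(2)[OF D.arrow_elt_closed vertex_closed[OF hv(2)], of h h] by (simp add: arrow_elt_tail)

lemma u_eq: "h \<in> arcs (double Q) \<Longrightarrow> u h = \<one>\<^bsub>M\<^esub> \<oplus>\<^bsub>M\<^esub> a h \<otimes>\<^bsub>M\<^esub> a (rev_arrow h)"
  by (simp add: one_plus_def hom D.arrow_elt_closed)

lemmas uw = mpa_inverse[OF Q ord, where q = q]

section \<open>The action of idempotents, arrows and inverses on a module\<close>

lemma act_zero: "r \<in> carrier M \<Longrightarrow> act r 0 = 0" "act \<zero>\<^bsub>M\<^esub> x = 0"
  using act_add_right[of r 0 0] act_add_left[of "\<zero>\<^bsub>M\<^esub>" "\<zero>\<^bsub>M\<^esub>" x] by auto

lemma act_diff: "r \<in> carrier M \<Longrightarrow> act r (x - y) = act r x - act r y"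
  using act_add_right[of r "x - y" y] by (simp add: algebra_simps)

lemma act_minus: "r \<in> carrier M \<Longrightarrow> t \<in> carrier M \<Longrightarrow> act (r \<ominus>\<^bsub>M\<^esub> t) x = act r x - act t x"
proof -
  assume rt: "r \<in> carrier M" "t \<in> carrier M"
  have "act (r \<ominus>\<^bsub>M\<^esub> t) x + act t x = act ((r \<ominus>\<^bsub>M\<^esub> t) \<oplus>\<^bsub>M\<^esub> t) x"
    using rt by (simp add: act_add_left)
  also have "(r \<ominus>\<^bsub>M\<^esub> t) \<oplus>\<^bsub>M\<^esub> t = r"
    using rt by (simp add: a_minus_def a_assoc l_neg)
  finally show ?thesis by (simp add: algebra_simps)
qed

lemma act_finsum:
  "finite I \<Longrightarrow> f \<in> I \<rightarrow> carrier M \<Longrightarrow> act (finsum M f I) x = (\<Sum>i\<in>I. act (f i) x)"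
  by (induction I rule: finite_induct) (auto simp: act_zero act_add_left)

lemma smult_one_comm:
  assumes "r \<in> carrier M"
  shows "(c \<odot>\<^bsub>M\<^esub> \<one>\<^bsub>M\<^esub>) \<otimes>\<^bsub>M\<^esub> r = c \<odot>\<^bsub>M\<^esub> r" "r \<otimes>\<^bsub>M\<^esub> (c \<odot>\<^bsub>M\<^esub> \<one>\<^bsub>M\<^esub>) = c \<odot>\<^bsub>M\<^esub> r"
  using assms M.smult_mult_l[OF one_closed assms, of c] M.smult_mult_r[OF assms one_closed, of c] by auto

lemma scalar_closed: "c \<odot>\<^bsub>M\<^esub> \<one>\<^bsub>M\<^esub> \<in> carrier M"
  by (simp add: M.smult_closed)

lemma act_smult: "r \<in> carrier M \<Longrightarrow> act (c \<odot>\<^bsub>M\<^esub> r) x = s c (act r x)"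
  unfolding scalar_act_def smult_one_comm(1)[symmetric] by (rule act_mult[OF scalar_closed])

lemma act_scalar: "r \<in> carrier M \<Longrightarrow> act r (s c x) = s c (act r x)"
  using act_mult[OF _ scalar_closed, of r c x] act_mult[OF scalar_closed, of r c x]
  by (simp add: scalar_act_def smult_one_comm)

lemma vector_space_s: "vector_space s"
proof
  show "s c (x + y) = s c x + s c y" for c x y
    unfolding scalar_act_def by (rule act_add_right[OF scalar_closed])
  show "s (c + d) x = s c x + s d x" for c d x
    unfolding scalar_act_def by (simp add: M.smult_l_distr act_add_left M.smult_closed)
  show "s c (s d x) = s (c * d) x" for c d x
    using act_smult[of "d \<odot>\<^bsub>M\<^esub> \<one>\<^bsub>M\<^esub>" c x] by (simp add: scalar_act_def M.smult_closed M.smult_assoc)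
  show "s 1 x = x" for x
    by (simp add: scalar_act_def M.smult_one act_one)
qed

sublocale s: vec_space s
  using vector_space_s by (simp add: vec_space_def)

sublocale W: self_sum "fun_scale s :: 'k \<Rightarrow> (('b + 'b) list \<Rightarrow> 'x) \<Rightarrow> _" list_inc list_proj
  by (rule self_sum_list[OF vector_space_s])

lemma lin_act: "r \<in> carrier M \<Longrightarrow> s.lin (act r)"
  by (rule s.linI) (simp_all add: act_add_right act_scalar)

lemma act_e: "v \<in> verts Q \<Longrightarrow> w \<in> verts Q \<Longrightarrow> act (e v) (act (e w) x) = (if v = w then act (e v) x else 0)"
  using e_mult[of v w] act_mult[of "e v" "e w" x] by (auto simp: e_closed act_zero)

lemma sum_e: "(\<Sum>v\<in>verts Q. act (e v) x) = x"
proof -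
  have "finsum M e (verts Q) = \<one>\<^bsub>M\<^esub>"
    using M.path_evalI[OF D.fin_digraph_axioms mpa_hom[OF Q ord]] by simp
  then show ?thesis
    using act_finsum[OF finite_verts, of e x] by (simp add: e_closed act_one)
qed

definition X :: "'v \<Rightarrow> 'x set" where
  "X v = range (act (e v))"

lemma X_iff: "v \<in> verts Q \<Longrightarrow> x \<in> X v \<longleftrightarrow> act (e v) x = x"
proof -
  assume v: "v \<in> verts Q"
  show ?thesis
  proof
    assume "x \<in> X v"
    then obtain y where "x = act (e v) y" unfolding X_def by (rule rangeE)
    then show "act (e v) x = x" using act_e[OF v v, of y] by simp
  next
    assume "act (e v) x = x"
    then show "x \<in> X v" unfolding X_def by (rule range_eqI[OF sym])
  qed
qed

lemma act_eX: "v \<in> verts Q \<Longrightarrow> act (e v) x \<in> X v"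
  by (simp add: X_def)

lemma act_e_other: "v \<in> verts Q \<Longrightarrow> w \<in> verts Q \<Longrightarrow> w \<noteq> v \<Longrightarrow> x \<in> X v \<Longrightarrow> act (e w) x = 0"
  using act_e[of w v x] X_iff[of v x] by simp

lemma act_a_e: "h \<in> arcs (double Q) \<Longrightarrow> act (a h) (act (e (tl h)) x) = act (a h) x"
  using act_mult[of "a h" "e (tl h)" x] by (simp add: a_closed e_closed hv a_e)

lemma act_e_a: "h \<in> arcs (double Q) \<Longrightarrow> act (e (hd h)) (act (a h) x) = act (a h) x"
  using act_mult[of "e (hd h)" "a h" x] by (simp add: a_closed e_closed hv e_a)

lemma act_e_a_other:
  "h \<in> arcs (double Q) \<Longrightarrow> v \<in> verts Q \<Longrightarrow> v \<noteq> hd h \<Longrightarrow> act (e v) (act (a h) x) = 0"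
  using act_e[of v "hd h" "act (a h) x"] by (simp add: act_e_a hv)

lemma act_a_other:
  "h \<in> arcs (double Q) \<Longrightarrow> v \<in> verts Q \<Longrightarrow> v \<noteq> tl h \<Longrightarrow> x \<in> X v \<Longrightarrow> act (a h) x = 0"
proof -
  assume h: "h \<in> arcs (double Q)" and "v \<in> verts Q" "v \<noteq> tl h" "x \<in> X v"
  then have "act (e (tl h)) x = 0" by (intro act_e_other[of v]) (auto simp: hv)
  then show ?thesis using act_a_e[OF h, of x] h by (simp add: act_zero(1) a_closed)
qed

lemma act_u: "h \<in> arcs (double Q) \<Longrightarrow> act (u h) x = x + act (a h) (act (a (rev_arrow h)) x)"
  by (simp add: u_eq act_add_left act_mult act_one a_closed)

lemma act_uw:
  "h \<in> arcs (double Q) \<Longrightarrow> act (u h) (act (uinv h) x) = x"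
  "h \<in> arcs (double Q) \<Longrightarrow> act (uinv h) (act (u h) x) = x"
  using act_mult[OF uw(4) uw(3), of h h x] act_mult[OF uw(3) uw(4), of h h x] by (simp_all add: uw act_one)

text \<open>\<open>1 + a b\<close> commutes with the idempotent at its head, and therefore so does
  its inverse.\<close>

lemma act_w_e: "h \<in> arcs (double Q) \<Longrightarrow> act (e (hd h)) (act (uinv h) x) = act (uinv h) (act (e (hd h)) x)"
proof -
  assume h: "h \<in> arcs (double Q)"
  let ?E = "e (hd h)" and ?P = "a h \<otimes>\<^bsub>M\<^esub> a (rev_arrow h)"
  have cl: "?E \<in> carrier M" "?P \<in> carrier M" using h by (simp_all add: e_closed a_closed hv)
  have "?E \<otimes>\<^bsub>M\<^esub> ?P = ?P"
    using h e_a[OF h] by (simp add: m_assoc[symmetric] e_closed a_closed hv)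
  moreover have "?P \<otimes>\<^bsub>M\<^esub> ?E = ?P"
    using h a_e[of "rev_arrow h"] by (simp add: m_assoc e_closed a_closed hv)
  ultimately have "uinv h \<otimes>\<^bsub>M\<^esub> ?E = ?E \<otimes>\<^bsub>M\<^esub> uinv h"
    using corner_inverse_commute[OF cl uw(3)[OF h]] uw(1,2)[OF h] u_eq[OF h] by simp
  then show ?thesis using act_mult[OF cl(1) uw(3)[OF h], of x] act_mult[OF uw(3)[OF h] cl(1), of x] by simp
qed

lemma act_u_other:
  assumes h: "h \<in> arcs (double Q)" and v: "v \<in> verts Q" "v \<noteq> hd h" and x: "x \<in> X v"
  shows "act (u h) x = x" "act (uinv h) x = x"
proof -
  have "act (a (rev_arrow h)) x = 0" using act_a_other[of "rev_arrow h" v x] assms by simp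
  then show "act (u h) x = x" using act_u[OF h, of x] h by (simp add: act_zero a_closed)
  then show "act (uinv h) x = x" using act_uw(2)[OF h, of x] by simp
qed

text \<open>\<open>1 + a b\<close> changes a vector only by something at the head of
  \<open>h\<close>, which the other idempotents do not see.\<close>

lemma act_e_w_other:
  assumes h: "h \<in> arcs (double Q)" and v: "v \<in> verts Q" "v \<noteq> hd h"
  shows "act (e v) (act (uinv h) x) = act (e v) x"
proof -
  have "act (e v) x = act (e v) (act (u h) (act (uinv h) x))" using act_uw(1)[OF h] by simp
  also have "\<dots> = act (e v) (act (uinv h) x)"
    using assms by (simp add: act_u act_add_right e_closed act_e_a_other)
  finally show ?thesis by simp
qed

lemma X_closed:
  assumes h: "h \<in> arcs (double Q)"
  shows "x \<in> X (tl h) \<Longrightarrow> act (a h) x \<in> X (hd h)"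
    "x \<in> X (hd h) \<Longrightarrow> act (uinv h) x \<in> X (hd h)" "x \<in> X (hd h) \<Longrightarrow> act (u h) x \<in> X (hd h)"
  using act_e_a[OF h] act_w_e[OF h, of x]
  by (simp_all add: X_iff hv[OF h] act_u[OF h] act_add_right e_closed)

abbreviation fac :: "'b + 'b \<Rightarrow> ('v \<times> (('b + 'b) + ('b + 'b)) list \<Rightarrow> 'k) set" where
  "fac h \<equiv> if arrow_sign h = 1 then u h else uinv h"

lemma fac_closed: "h \<in> arcs (double Q) \<Longrightarrow> fac h \<in> carrier M"
  using uw by simp

lemma act_list_prod:
  "set hs \<subseteq> arcs (double Q) \<Longrightarrow>
    list_prod M (map fac hs) \<in> carrier M \<and> act (list_prod M (map fac hs)) x = foldr (\<lambda>h. act (fac h)) hs x"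
proof (induction hs)
  case Nil
  then show ?case by (simp add: list_prod_def act_one)
next
  case (Cons h hs)
  have "list_prod M (map fac (h # hs)) = fac h \<otimes>\<^bsub>M\<^esub> list_prod M (map fac hs)"
    by (simp add: list_prod_def)
  then show ?case using Cons fac_closed[of h] act_mult[of "fac h" "list_prod M (map fac hs)" x]
    by (simp add: comp_def)
qed

text \<open>Factors with another head are the identity on \<open>X v\<close>, and those with head
  \<open>v\<close> preserve it. This splits the single relation of the algebra into one relation per
  vertex, in the induced order.\<close>

lemma foldr_fac_filter:
  assumes "set hs \<subseteq> arcs (double Q)" "v \<in> verts Q" "x \<in> X v"
  shows "foldr (\<lambda>h. act (fac h)) hs x = foldr (\<lambda>h. act (fac h)) (filter (\<lambda>h. hd h = v) hs) x \<and>
    foldr (\<lambda>h. act (fac h)) hs x \<in> X v"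
  using assms(1)
proof (induction hs)
  case Nil
  then show ?case using assms by simp
next
  case (Cons h hs)
  then have h: "h \<in> arcs (double Q)"
    and IH: "foldr (\<lambda>h. act (fac h)) hs x = foldr (\<lambda>h. act (fac h)) (filter (\<lambda>h. hd h = v) hs) x"
      "foldr (\<lambda>h. act (fac h)) hs x \<in> X v" by auto
  show ?case
  proof (cases "hd h = v")
    case True
    then show ?thesis using IH X_closed(2,3)[OF h, of "foldr (\<lambda>h. act (fac h)) hs x"] by simp
  next
    case False
    then show ?thesis
      using IH act_u_other[OF h assms(2) _ IH(2)] by simp
  qed
qed

lemma vertex_sum_act:
  assumes v: "v \<in> verts Q" and x: "x \<in> X v"
  shows "act (mpa_hom Q ord q (vertex_sum Q q)) x = s (q v) x"
proof -
  let ?f = "\<lambda>w. q w \<odot>\<^bsub>P\<^esub> vertex_elt w"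
  have cl: "?f w \<in> carrier P" if "w \<in> verts Q" for w using that by (simp add: P.smult_closed vertex_closed)
  have "finite I \<Longrightarrow> I \<subseteq> verts Q \<Longrightarrow>
      act (mpa_hom Q ord q (finsum P ?f I)) x = (\<Sum>w\<in>I. act (mpa_hom Q ord q (?f w)) x)" for I
  proof (induction I rule: finite_induct)
    case empty
    show ?case
      using alg_hom_zero[OF P.k_algebra_axioms M.k_algebra_axioms mpa_hom[OF Q ord]] by (simp add: act_zero)
  next
    case (insert w I)
    then have "?f w \<in> carrier P" "?f \<in> I \<rightarrow> carrier P" using cl by auto
    then show ?case using insert by (simp add: hom act_add_left)
  qed
  from this[OF finite_verts subset_refl]
  have "act (mpa_hom Q ord q (vertex_sum Q q)) x = (\<Sum>w\<in>verts Q. act (mpa_hom Q ord q (?f w)) x)"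
    unfolding vertex_sum_def .
  also have "\<dots> = (\<Sum>w\<in>verts Q. if w = v then s (q v) x else 0)"
  proof (rule sum.cong[OF refl])
    fix w assume w: "w \<in> verts Q"
    have "act (mpa_hom Q ord q (?f w)) x = s (q w) (act (e w) x)"
      using w by (simp add: hom vertex_closed act_smult e_closed)
    then show "act (mpa_hom Q ord q (?f w)) x = (if w = v then s (q v) x else 0)"
      using act_e_other[OF v w _ x] X_iff[OF v, of x] x by auto
  qed
  finally show ?thesis using v by simp
qed

lemma relation_act:
  assumes v: "v \<in> verts Q" and x: "x \<in> X v"
  shows "foldr (\<lambda>h. act (fac h)) (filter (\<lambda>h. hd h = v) (ordered_list ord (arcs (double Q)))) x = s (q v) x"
proof -
  let ?OL = "ordered_list ord (arcs (double Q))"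
  have set_OL: "set ?OL = arcs (double Q)" using set_arrow_list[OF Q ord] .
  have "list_prod M (map (\<lambda>h. u h [^]\<^bsub>M\<^esub> arrow_sign h) ?OL) = list_prod M (map fac ?OL)"
  proof (rule list_prod_map_cong)
    fix h assume "h \<in> set ?OL"
    then have h: "h \<in> arcs (double Q)" using set_OL by simp
    note wi = uw[OF h]
    show "u h [^]\<^bsub>M\<^esub> arrow_sign h = fac h"
    proof (cases "arrow_sign h = 1")
      case True
      then show ?thesis using wi(4) by (simp add: int_pow_def2)
    next
      case False
      then have "arrow_sign h = -1" using sign_cases[of h] by blast
      then show ?thesis using wi(3,4) inv_unique'[OF wi(4,3) wi(1,2)] by (simp add: int_pow_def2)
    qed
  qed
  moreover have "list_prod M (map (\<lambda>h. u h [^]\<^bsub>M\<^esub> arrow_sign h) ?OL) = mpa_hom Q ord q (vertex_sum Q q)"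
    using mpa_satisfies_condition[OF Q ord, of q] unfolding mpa_condition_def by (rule conjunct2)
  ultimately have prod: "list_prod M (map fac ?OL) = mpa_hom Q ord q (vertex_sum Q q)" by (rule trans[OF sym])
  have "act (list_prod M (map fac ?OL)) x = foldr (\<lambda>h. act (fac h)) ?OL x"
    using act_list_prod[OF equalityD1[OF set_OL], of x] by (rule conjunct2)
  then have "foldr (\<lambda>h. act (fac h)) ?OL x = s (q v) x"
    unfolding prod vertex_sum_act[OF v x] by (rule sym)
  then show ?thesis unfolding conjunct1[OF foldr_fac_filter[OF equalityD1[OF set_OL] v x]] .
qed

end

section \<open>The representation given by a module; its stable families and endomorphisms\<close>

context mpa_module
begin

text \<open>Extends a map of the module to all of the ambient space by ignoring the other
  coordinates, because the maps of a representation must be linear on the whole space.\<close>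

definition lift :: "('x \<Rightarrow> 'x) \<Rightarrow> (('b + 'b) list \<Rightarrow> 'x) \<Rightarrow> ('b + 'b) list \<Rightarrow> 'x" where
  "lift g f = list_base (g (f []))"

definition cofac :: "'b + 'b \<Rightarrow> ('v \<times> (('b + 'b) + ('b + 'b)) list \<Rightarrow> 'k) set" where
  "cofac h = (if arrow_sign h = 1 then uinv h else u h)"

definition S :: "'v \<Rightarrow> (('b + 'b) list \<Rightarrow> 'x) set" where
  "S v = list_base ` X v"

definition A :: "'b + 'b \<Rightarrow> (('b + 'b) list \<Rightarrow> 'x) \<Rightarrow> ('b + 'b) list \<Rightarrow> 'x" where
  "A h = lift (act (a h))"

definition T :: "'b + 'b \<Rightarrow> (('b + 'b) list \<Rightarrow> 'x) \<Rightarrow> ('b + 'b) list \<Rightarrow> 'x" where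
  "T h = lift (act (fac h))"

definition R :: "'b + 'b \<Rightarrow> (('b + 'b) list \<Rightarrow> 'x) \<Rightarrow> ('b + 'b) list \<Rightarrow> 'x" where
  "R h = lift (act (cofac h))"

definition incoming :: "'v \<Rightarrow> ('b + 'b) list" where
  "incoming v = filter (\<lambda>h. hd h = v) (ordered_list ord (arcs (double Q)))"

abbreviation "sW \<equiv> (fun_scale s :: 'k \<Rightarrow> (('b + 'b) list \<Rightarrow> 'x) \<Rightarrow> ('b + 'b) list \<Rightarrow> 'x)"

lemma lift_base: "lift g (list_base x) = list_base (g x)"
  by (simp add: lift_def list_base_simps)

lemma S_iff: "list_base x \<in> S v \<longleftrightarrow> x \<in> X v"
  by (auto simp: S_def list_base_simps)

lemma S_E:
  assumes "f \<in> S v"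
  obtains x where "f = list_base x" "x \<in> X v"
  using assms unfolding S_def by blast

lemma lin_lift:
  assumes "s.lin g"
  shows "W.lin (lift g)"
proof (rule W.linI)
  show "lift g (x + y) = lift g x + lift g y" for x y
    by (simp add: lift_def s.lin_simps(1)[OF assms] list_base_simps)
  show "lift g (fun_scale s c x) = fun_scale s c (lift g x)" for c x
    by (simp add: lift_def fun_scale_def[of s c x] s.lin_simps(2)[OF assms] list_base_scale[OF vector_space_s])
qed

lemma cofac_closed: "h \<in> arcs (double Q) \<Longrightarrow> cofac h \<in> carrier M"
  using uw by (simp add: cofac_def)

lemma foldr_T: "foldr T hs (list_base x) = list_base (foldr (\<lambda>h. act (fac h)) hs x)"
  by (induction hs) (simp_all add: T_def lift_base)

lemma lin_base: "Vector_Spaces.linear s sW list_base"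
  unfolding Vector_Spaces.linear_iff
  using vector_space_s W.vector_space_axioms by (simp add: list_base_simps list_base_scale)

context
  assumes q_nonzero: "\<forall>v\<in>verts Q. q v \<noteq> 0"
    and fin: "finite_dimensional_module M act"
    and simple: "simple_module M act"
begin

lemma has_dim_X: "v \<in> verts Q \<Longrightarrow> s.has_dim (X v) (s.dim (X v))"
proof -
  assume v: "v \<in> verts Q"
  obtain Z where Z: "finite Z" "s.span Z = UNIV"
    using fin unfolding finite_dimensional_module_def by blast
  interpret PP: vec_space_pair s s by unfold_locales
  have "s.span (act (e v) ` Z) = X v"
    unfolding X_def using PP.linear_span_image[OF lin_act[OF e_closed[OF v]], of Z] Z(2) by simp
  then show ?thesis using Z(1) by (intro s.has_dim_finite_span[of "act (e v) ` Z"]) auto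
qed

lemma has_dim_S: "v \<in> verts Q \<Longrightarrow> W.has_dim (S v) (s.dim (X v))"
proof -
  assume v: "v \<in> verts Q"
  interpret PW: vec_space_pair s sW by unfold_locales
  have "inj_on (list_base :: 'x \<Rightarrow> ('b + 'b) list \<Rightarrow> 'x) (X v)"
    by (rule inj_onI) (simp add: list_base_simps)
  then show ?thesis unfolding S_def by (rule PW.has_dim_image[OF lin_base _ has_dim_X[OF v]])
qed

lemma mult_rep_module: "mult_rep sW Q {h. arrow_sign h = 1} incoming q S A T R"
proof (intro mult_rep.intro mult_rep_axioms.intro W.vec_space_axioms Q)
  fix v assume v: "v \<in> verts Q"
  show "set (incoming v) = {h \<in> arcs (double Q). hd h = v}"
    using set_arrow_list[OF Q ord] by (auto simp: incoming_def)
  show "distinct (incoming v)"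
    using ordered_list(3)[OF ord D.finite_arcs] by (simp add: incoming_def)
  show "q v \<noteq> 0" using q_nonzero v by blast
  show "\<exists>n. W.has_dim (S v) n" using has_dim_S[OF v] by blast
  show "foldr T (incoming v) f = fun_scale s (q v) f" if "f \<in> S v" for f
  proof -
    obtain x where x: "f = list_base x" "x \<in> X v" using \<open>f \<in> S v\<close> by (rule S_E)
    show ?thesis
      unfolding x(1) foldr_T incoming_def relation_act[OF v x(2)] by (rule list_base_scale[OF vector_space_s])
  qed
next
  fix h assume h: "h \<in> arcs (double Q)"
  show "h \<in> {h. arrow_sign h = 1} \<longleftrightarrow> rev_arrow h \<notin> {h. arrow_sign h = 1}" by (cases h) auto
  show "W.lin (A h)" "W.lin (T h)" "W.lin (R h)"
    unfolding A_def T_def R_def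
    by (intro lin_lift lin_act a_closed fac_closed cofac_closed h)+
  show "A h f \<in> S (hd h)" if "f \<in> S (tl h)" for f
  proof -
    obtain x where x: "f = list_base x" "x \<in> X (tl h)" using \<open>f \<in> S (tl h)\<close> by (rule S_E)
    show ?thesis unfolding x(1) A_def lift_base S_iff by (rule X_closed(1)[OF h x(2)])
  qed
  fix f assume "f \<in> S (hd h)"
  then obtain x where x: "f = list_base x" "x \<in> X (hd h)" by (rule S_E)
  show "T h f \<in> S (hd h)" "R h f \<in> S (hd h)"
    unfolding x(1) T_def R_def cofac_def lift_base S_iff using X_closed(2,3)[OF h x(2)] by simp_all
  show "T h (R h f) = f" "R h (T h f) = f"
    unfolding x(1) T_def R_def cofac_def lift_base using act_uw[OF h, of x] by simp_all
  have AA: "f + A h (A (rev_arrow h) f) = list_base (act (u h) x)"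
    unfolding x(1) A_def lift_base act_u[OF h] list_base_simps(2) ..
  show "T h f = f + A h (A (rev_arrow h) f)" if "h \<in> {h. arrow_sign h = 1}"
    unfolding AA using that by (simp add: x(1) T_def lift_base)
  show "R h f = f + A h (A (rev_arrow h) f)" if "h \<notin> {h. arrow_sign h = 1}"
    unfolding AA using that by (simp add: x(1) R_def cofac_def lift_base)
qed

lemma rep_dim_module:
  "rep_dim Q sW S = (\<lambda>v. int (dimension_vector Q ord q act v))"
proof (rule ext)
  fix v
  show "rep_dim Q sW S v = int (dimension_vector Q ord q act v)"
  proof (cases "v \<in> verts Q")
    case True
    have "W.dim (S v) = s.dim (X v)" using has_dim_S[OF True] by (rule W.has_dim_dim)
    then show ?thesis using True by (simp add: rep_dim_def dimension_vector_def X_def)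
  next
    case False
    then show ?thesis by (simp add: rep_dim_def dimension_vector_def)
  qed
qed

text \<open>A stable family is closed under arrows, \<open>T\<close> and \<open>R\<close> only.
  Closure under the algebra is obtained from generators: the elements preserving the set contain
  vertices, arrows and adjoined loops, and are closed under products, sums and scalars.\<close>

lemma stable_submodule:
  assumes Y: "rep_stable Q sW S A T R Y"
  shows "left_submodule M act {x. \<forall>v\<in>verts Q. list_base (act (e v) x) \<in> Y v}" (is "left_submodule M act ?U")
proof -
  have sub: "W.subspace (Y v)" "Y v \<subseteq> S v" if "v \<in> verts Q" for v
    using Y that unfolding rep_stable_def by auto
  have YA: "A h f \<in> Y (hd h)" if "h \<in> arcs (double Q)" "f \<in> Y (tl h)" for h f
    using Y that unfolding rep_stable_def by blast
  have YT: "T h f \<in> Y (hd h)" "R h f \<in> Y (hd h)" if "h \<in> arcs (double Q)" "f \<in> Y (hd h)" for h f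
    using Y that unfolding rep_stable_def by blast+
  define G where "G = {r \<in> carrier M. \<forall>x\<in>?U. act r x \<in> ?U}"
  have U_zero: "0 \<in> ?U"
    using sub(1) by (simp add: act_zero e_closed list_base_simps W.subspace_0)
  have U_add: "x + y \<in> ?U" if "x \<in> ?U" "y \<in> ?U" for x y
    using that sub(1) by (simp add: act_add_right e_closed list_base_simps W.subspace_add)
  have U_diff: "x - y \<in> ?U" if "x \<in> ?U" "y \<in> ?U" for x y
    using that sub(1) by (simp add: act_diff e_closed list_base_simps W.subspace_diff)
  have U_scale: "s c x \<in> ?U" if "x \<in> ?U" for c x
    using that sub(1)
    by (simp add: act_scalar e_closed list_base_scale[OF vector_space_s] W.subspace_scale)
  have U_single: "y \<in> ?U" if v: "v \<in> verts Q" and y: "act (e v) y = y" "list_base y \<in> Y v" for v y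
  proof -
    have "list_base (act (e v') y) \<in> Y v'" if v': "v' \<in> verts Q" for v'
    proof (cases "v' = v")
      case True
      then show ?thesis using y by simp
    next
      case False
      have "act (e v') y = 0" using act_e_other[OF v v' False] X_iff[OF v] y(1) by blast
      then show ?thesis using W.subspace_0[OF sub(1)[OF v']] by (simp add: list_base_simps)
    qed
    then show ?thesis by blast
  qed
  have G_mult: "r \<otimes>\<^bsub>M\<^esub> t \<in> G" if "r \<in> G" "t \<in> G" for r t
    using that unfolding G_def by (simp add: act_mult)
  have G_e: "e v \<in> G" if v: "v \<in> verts Q" for v
  proof -
    have "act (e v) x \<in> ?U" if x: "x \<in> ?U" for x
    proof (rule U_single[OF v])
      show "act (e v) (act (e v) x) = act (e v) x" using act_e[OF v v] by simp
      show "list_base (act (e v) x) \<in> Y v" using x v by blast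
    qed
    then show ?thesis using e_closed[OF v] unfolding G_def by blast
  qed
  have G_a: "a h \<in> G" if h: "h \<in> arcs (double Q)" for h
  proof -
    have "act (a h) x \<in> ?U" if x: "x \<in> ?U" for x
    proof (rule U_single[OF hv(1)[OF h] act_e_a[OF h]])
      have "list_base (act (e (tl h)) x) \<in> Y (tl h)" using x hv(2)[OF h] by blast
      from YA[OF h this] show "list_base (act (a h) x) \<in> Y (hd h)"
        unfolding A_def lift_base act_a_e[OF h] .
    qed
    then show ?thesis using a_closed[OF h] unfolding G_def by blast
  qed
  have G_uinv: "uinv h \<in> G" if h: "h \<in> arcs (double Q)" for h
  proof -
    have "list_base (act (e v) (act (uinv h) x)) \<in> Y v" if x: "x \<in> ?U" and v: "v \<in> verts Q" for x v
    proof (cases "v = hd h")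
      case True
      have "list_base (act (e (hd h)) x) \<in> Y (hd h)" using x hv(1)[OF h] by blast
      from YT[OF h this] show ?thesis
        unfolding True act_w_e[OF h] T_def R_def cofac_def lift_base by (cases "arrow_sign h = 1") simp_all
    next
      case False
      then show ?thesis using act_e_w_other[OF h v False, of x] x v by simp
    qed
    then show ?thesis using uw(3)[OF h] unfolding G_def by blast
  qed
  \<comment> \<open>In the algebra the adjoined loop is \<open>uinv h - (1 - e (hd h))\<close>, by
    the definition of \<open>loc_inverse\<close>, so the cases already treated suffice.\<close>
  have G_loop: "p (arrow_elt (adjoin_loops (double Q)) (Inr h)) \<in> G" if h: "h \<in> arcs (double Q)" for h
  proof -
    let ?l = "arrow_elt (adjoin_loops (double Q)) (Inr h) :: _ \<Rightarrow> 'k"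
    let ?e = "vertex_elt (hd h) :: 'v \<times> (('b + 'b) + ('b + 'b)) list \<Rightarrow> 'k"
    have cl: "?l \<in> carrier B" "?e \<in> carrier B"
      using h hv(1)[OF h] Lo.arrow_elt_closed[of "Inr h"] vertex_elt_closed[of _ "adjoin_loops (double Q)"]
      by auto
    have li: "loc_inverse Q h = (\<one>\<^bsub>B\<^esub> \<ominus>\<^bsub>B\<^esub> ?e) \<oplus>\<^bsub>B\<^esub> ?l" by (simp add: loc_inverse_def)
    have l: "?l = loc_inverse Q h \<ominus>\<^bsub>B\<^esub> (\<one>\<^bsub>B\<^esub> \<ominus>\<^bsub>B\<^esub> ?e)"
      unfolding li using cl by (simp add: B.add_minus_cancel)
    note pm = alg_hom_minus[OF B.k_algebra_axioms M.k_algebra_axioms mpa_proj[OF Q ord]]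
    have lic: "loc_inverse Q h \<in> carrier B" by (rule loc_inverse_closed[OF Q h])
    have "p ?l = uinv h \<ominus>\<^bsub>M\<^esub> (\<one>\<^bsub>M\<^esub> \<ominus>\<^bsub>M\<^esub> p ?e)"
      using cl lic by (subst l) (simp add: pm proj(4))
    moreover have "p ?e = e (hd h)" by (simp add: mpa_hom_def)
    ultimately have pl: "p ?l = uinv h \<ominus>\<^bsub>M\<^esub> (\<one>\<^bsub>M\<^esub> \<ominus>\<^bsub>M\<^esub> e (hd h))" by simp
    have "act (p ?l) x = act (uinv h) x - (x - act (e (hd h)) x)" for x
      unfolding pl using uw(3)[OF h] e_closed[OF hv(1)[OF h]] by (simp add: act_minus act_one)
    moreover have "act (uinv h) x - (x - act (e (hd h)) x) \<in> ?U" if x: "x \<in> ?U" for x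
      using G_uinv[OF h] G_e[OF hv(1)[OF h]] x unfolding G_def by (intro U_diff) blast+
    ultimately show ?thesis using proj(1)[OF cl(1)] unfolding G_def by simp
  qed
  have G_path: "p (path_elt (v, bs)) \<in> G" if "is_path (adjoin_loops (double Q)) v bs" for v bs
    using that
  proof (induction bs arbitrary: v)
    case Nil
    then have "p (path_elt (v, [])) = e v" by (simp add: mpa_hom_def vertex_elt_def[symmetric])
    then show ?case using G_e Nil by simp
  next
    case (Cons b bs)
    then have b: "head (adjoin_loops (double Q)) b = v" "b \<in> arcs (adjoin_loops (double Q))"
      "is_path (adjoin_loops (double Q)) (tail (adjoin_loops (double Q)) b) bs" by auto
    have "p (arrow_elt (adjoin_loops (double Q)) b) \<in> G"
    proof (cases b)
      case (Inl h)
      then have "p (arrow_elt (adjoin_loops (double Q)) b) = a h" by (simp add: mpa_hom_def)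
      then show ?thesis using G_a Inl b by simp
    next
      case (Inr h)
      then show ?thesis using G_loop b by simp
    qed
    moreover have "(path_elt (tail (adjoin_loops (double Q)) b, bs) :: _ \<Rightarrow> 'k) \<in> carrier B"
      using b(3) by (intro path_elt_closed) (simp add: quiver_paths_def)
    then have "p (path_elt (v, b # bs)) =
        p (arrow_elt (adjoin_loops (double Q)) b) \<otimes>\<^bsub>M\<^esub> p (path_elt (tail (adjoin_loops (double Q)) b, bs))"
      unfolding path_elt_Cons[OF b(1)] by (rule proj(2)[OF Lo.arrow_elt_closed[OF b(2)]])
    ultimately show ?case using G_mult Cons.IH[OF b(3)] by simp
  qed
  have G_all: "p y \<in> G" if "y \<in> carrier B" for y
    using that
  proof (induction rule: path_algebra_induct)
    case zero
    have "p \<zero>\<^bsub>B\<^esub> = \<zero>\<^bsub>M\<^esub>"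
      by (rule alg_hom_zero[OF B.k_algebra_axioms M.k_algebra_axioms mpa_proj[OF Q ord]])
    then show ?case using U_zero unfolding G_def by (simp add: act_zero)
  next
    case (add f g)
    have fg: "p f \<in> carrier M" "p g \<in> carrier M" using proj(1) add by auto
    have "act (p f \<oplus>\<^bsub>M\<^esub> p g) x \<in> ?U" if x: "x \<in> ?U" for x
      using x add(3,4) U_add unfolding G_def act_add_left[OF fg] by blast
    then show ?case using fg unfolding proj(3)[OF add(1,2)] G_def by blast
  next
    case (elt c pt)
    obtain v bs where pt: "pt = (v, bs)" "is_path (adjoin_loops (double Q)) v bs"
      using elt by (auto simp: quiver_paths_def)
    have g: "p (path_elt pt) \<in> G" using G_path pt by simp
    then have cl: "p (path_elt pt) \<in> carrier M" unfolding G_def by blast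
    have "act (c \<odot>\<^bsub>M\<^esub> p (path_elt pt)) x \<in> ?U" if x: "x \<in> ?U" for x
      using x g U_scale unfolding G_def act_smult[OF cl] by blast
    then show ?case
      using M.smult_closed[OF cl] unfolding proj(5)[OF path_elt_closed[OF elt]] G_def by blast
  qed
  have "act r x \<in> ?U" if r: "r \<in> carrier M" and x: "x \<in> ?U" for r x
  proof -
    obtain y where "y \<in> carrier B" "r = p y"
      using r unfolding mpa_def by (rule quotient_algebra_carrierE)
    then show ?thesis using G_all x unfolding G_def by blast
  qed
  then show ?thesis using U_zero U_add unfolding left_submodule_def by blast
qed

lemma simple_nonzero: obtains x :: 'x where "x \<noteq> 0"
  using simple unfolding simple_module_def by blast

lemma rep_simple_module: "rep_simple Q sW S A T R"
  unfolding rep_simple_def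
proof (intro conjI allI impI)
  obtain x :: 'x where x: "x \<noteq> 0" by (rule simple_nonzero)
  have "\<exists>v\<in>verts Q. act (e v) x \<noteq> 0"
  proof (rule ccontr)
    assume "\<not> ?thesis"
    then have "(\<Sum>v\<in>verts Q. act (e v) x) = 0" by simp
    then show False using sum_e x by simp
  qed
  then obtain v where v: "v \<in> verts Q" "act (e v) x \<noteq> 0" by blast
  have "list_base (act (e v) x) \<in> S v" using act_eX[OF v(1)] by (simp add: S_iff)
  moreover have "list_base (act (e v) x) \<noteq> (0 :: ('b + 'b) list \<Rightarrow> 'x)"
    using v(2) by (auto simp: list_base_def fun_eq_iff)
  ultimately show "\<exists>v\<in>verts Q. S v \<noteq> {0}" using v(1) by blast
next
  fix Y assume Y: "rep_stable Q sW S A T R Y"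
  let ?U = "{x. \<forall>v\<in>verts Q. list_base (act (e v) x) \<in> Y v}"
  have sub: "W.subspace (Y v)" "Y v \<subseteq> S v" if "v \<in> verts Q" for v
    using Y that unfolding rep_stable_def by auto
  have "?U = {0} \<or> ?U = UNIV"
    using simple stable_submodule[OF Y] unfolding simple_module_def by blast
  then show "(\<forall>v\<in>verts Q. Y v = {0}) \<or> (\<forall>v\<in>verts Q. Y v = S v)"
  proof
    assume U: "?U = {0}"
    have "f = 0" if v: "v \<in> verts Q" and f: "f \<in> Y v" for v f
    proof -
      obtain x where x: "f = list_base x" "x \<in> X v" using f sub(2)[OF v] by (meson S_E subsetD)
      have "list_base (act (e v') x) \<in> Y v'" if v': "v' \<in> verts Q" for v'
      proof (cases "v' = v")
        case True
        then show ?thesis using f x X_iff[OF v] by simp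
      next
        case False
        then show ?thesis
          using act_e_other[OF v v' False x(2)] W.subspace_0[OF sub(1)[OF v']] by (simp add: list_base_simps)
      qed
      then have "x = 0" using U by blast
      then show ?thesis by (simp add: x(1) list_base_simps)
    qed
    then have "\<forall>v\<in>verts Q. Y v = {0}" using W.subspace_0[OF sub(1)] by blast
    then show ?thesis by blast
  next
    assume U: "?U = UNIV"
    have "f \<in> Y v" if v: "v \<in> verts Q" and f: "f \<in> S v" for v f
    proof -
      obtain x where x: "f = list_base x" "x \<in> X v" using f by (rule S_E)
      have "list_base (act (e v) x) \<in> Y v" using U v by blast
      then show ?thesis using x X_iff[OF v] by simp
    qed
    then show ?thesis using sub(2) by blast
  qed
qed

text \<open>A module endomorphism commutes with idempotents and arrows, so its lift, taken at every
  vertex, is an endomorphism of the representation. Being a scalar on each \<open>X v\<close>, it is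
  one on the module, which is the sum of these spaces.\<close>

lemma endomorphisms_module:
  assumes brick: "rep_brick Q sW S A"
  shows "bij_betw s UNIV (endomorphisms M act)"
proof (rule bij_betw_imageI)
  obtain x :: 'x where x: "x \<noteq> 0" by (rule simple_nonzero)
  show "inj s"
  proof (rule injI)
    fix c d assume "s c = s d"
    then have "s c x = s d x" by simp
    then show "c = d" using x s.scale_right_imp_eq by blast
  qed
  show "range s = endomorphisms M act"
  proof (intro equalityI subsetI)
    fix f assume "f \<in> range s"
    then show "f \<in> endomorphisms M act"
      unfolding endomorphisms_def by (auto simp: s.scale_right_distrib act_scalar)
  next
    fix f assume "f \<in> endomorphisms M act"
    then have f_add: "f (x + y) = f x + f y" and f_act: "r \<in> carrier M \<Longrightarrow> f (act r x) = act r (f x)" for x y r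
      unfolding endomorphisms_def by auto
    have f_scale: "f (s c x) = s c (f x)" for c x
      unfolding scalar_act_def by (rule f_act[OF scalar_closed])
    have lin_f: "s.lin f" by (rule s.linI[OF f_add f_scale])
    have "rep_endo Q sW S A (\<lambda>_. lift f)"
      unfolding rep_endo_def
    proof (intro conjI ballI)
      fix v assume v: "v \<in> verts Q"
      show "W.lin (lift f)" by (rule lin_lift[OF lin_f])
      show "lift f ` S v \<subseteq> S v"
      proof clarify
        fix g assume "g \<in> S v"
        then obtain y where y: "g = list_base y" "y \<in> X v" by (rule S_E)
        then show "lift f g \<in> S v"
          using f_act[OF e_closed[OF v], of y] by (simp add: lift_base S_iff X_iff[OF v])
      qed
    next
      fix h g assume h: "h \<in> arcs (double Q)" and "g \<in> S (tl h)"
      then obtain y where "g = list_base y" by (meson S_E)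
      then show "lift f (A h g) = A h (lift f g)"
        using f_act[OF a_closed[OF h]] by (simp add: A_def lift_base)
    qed
    then obtain c where c: "\<And>v g. v \<in> verts Q \<Longrightarrow> g \<in> S v \<Longrightarrow> lift f g = fun_scale s c g"
      using brick unfolding rep_brick_def by blast
    have fX: "f y = s c y" if "v \<in> verts Q" "y \<in> X v" for v y
    proof -
      have "(list_base (f y) :: ('b + 'b) list \<Rightarrow> 'x) = list_base (s c y)"
        using c[OF that(1), of "list_base y"] that(2)
        unfolding lift_base S_iff list_base_scale[OF vector_space_s] by blast
      then show ?thesis by (simp add: list_base_simps)
    qed
    have "f y = s c y" for y
    proof -
      have "f y = (\<Sum>v\<in>verts Q. f (act (e v) y))"
        using s.lin_simps(6)[OF lin_f, of "\<lambda>v. act (e v) y" "verts Q"] by (simp add: sum_e)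
      also have "\<dots> = (\<Sum>v\<in>verts Q. s c (act (e v) y))"
        using fX act_eX by (intro sum.cong) auto
      also have "\<dots> = s c y" by (simp add: s.scale_sum_right[symmetric] sum_e)
      finally show ?thesis .
    qed
    then show "f \<in> range s" by (metis ext rangeI)
  qed
qed

theorem simple_module_root:
  defines "\<alpha> \<equiv> (\<lambda>v. int (dimension_vector Q ord q act v))"
  shows "positive_root Q \<alpha> \<and> (real_root Q \<alpha> \<longrightarrow> bij_betw s UNIV (endomorphisms M act))"
proof -
  have "(real_root Q \<alpha> \<and> rep_brick Q sW S A) \<or> imaginary_root Q \<alpha>"
    using simple_rep_root[OF W.self_sum_axioms mult_rep_module rep_simple_module]
    unfolding \<alpha>_def rep_dim_module .
  \<comment> \<open>The form takes the value 2 on real roots and at most 0 on imaginary ones; for a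
    real root only the alternative with scalar endomorphisms is left.\<close>
  moreover have "\<not> imaginary_root Q \<alpha>" if "real_root Q \<alpha>"
    using sym_form_real_root[OF that] sym_form_imaginary_root[of \<alpha>] by auto
  moreover have "0 \<le> \<alpha> v" for v by (simp add: \<alpha>_def)
  ultimately show ?thesis using endomorphisms_module unfolding positive_root_def by blast
qed

end

end

theorem theorem1p8:
  fixes Q :: "('v, 'b) pre_digraph"
    and ord :: "('b + 'b) rel"
    and q :: "'v \<Rightarrow> 'k::field"
    and act :: "('v \<times> (('b + 'b) + ('b + 'b)) list \<Rightarrow> 'k) set \<Rightarrow> 'x::ab_group_add \<Rightarrow> 'x"
    and \<alpha> :: "'v \<Rightarrow> nat"
  assumes "fin_digraph Q"
    and "strict_linear_order_on (arcs (double Q)) ord"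
    and "\<forall>v\<in>verts Q. q v \<noteq> 0"
    and "left_module (mpa Q ord q) act"
    and "finite_dimensional_module (mpa Q ord q) act"
    and "simple_module (mpa Q ord q) act"
    and "dimension_vector Q ord q act = \<alpha>"
  shows "positive_root Q (\<lambda>v. int (\<alpha> v)) \<and>
    (real_root Q (\<lambda>v. int (\<alpha> v)) \<longrightarrow>
       bij_betw (scalar_act (mpa Q ord q) act) UNIV (endomorphisms (mpa Q ord q) act))"
proof -
  interpret mpa_module Q ord q act
    using assms(1,2,4) by (intro mpa_module.intro mpa_module_axioms.intro)
  show ?thesis using simple_module_root[OF assms(3,5,6)] unfolding assms(7) .
qed

end
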